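(* Let $(\mathcal{T}_1,\dots,\mathcal{T}_n)$, $\mathcal{T}_j=(T_{j,t})_{t\ge0}$, be a tuple of commuting normal contractive semigroups on a Hilbert space $\mathcal{H}$. Then it is jointly unitarily equivalent to a model $n$-normal contractive semigroup; that is, there exist a semifinite measure space $(X,\mu)$, functions $\psi_1,\dots,\psi_n\in L^\infty(X,\mu)$ with $\|\psi_j\|_\infty\le1$ and $\mu(\{x:\psi_j(x)=1\})=0$ for each $j$, and a unitary $\gamma:\mathcal{H}\to L^2(X,\mu)$ such that $T_{j,t}=\gamma^*M_{\varphi_t\circ\psi_j}\gamma$ for all $t\ge0$ and $j=1,\dots,n$.
   Context: A contractive semigroup is a strongly continuous one-parameter semigroup $(T_t)_{t\ge0}$ of contractions with $T_0=I$; it is normal if each $T_t$ is normal. Semigroups $(T_{i,t})$ and $(T_{j,t})$ commute if $T_{i,t}T_{j,t}=T_{j,t}T_{i,t}$ for all $t\ge0$. $\varphi_t(w)=e^{t\frac{w+1}{w-1}}$ for $w\in\overline{\mathbb{D}}\setminus\{1\}$, $(\varphi_t\circ\psi)(x)=\varphi_t(\psi(x))$, and $M_f$ is multiplication by $f$ on $L^2(X,\mu)$. *)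

theory Defs
  imports "HOL-Analysis.Analysis"
begin

text \<open>A complex Hilbert space is given by a carrier type 'h with its additive group
structure, a complex scalar multiplication sc and an inner product ip
(linear in the first argument, conjugate linear in the second).\<close>

definition hnorm :: "('h \<Rightarrow> 'h \<Rightarrow> complex) \<Rightarrow> 'h \<Rightarrow> real" where
  "hnorm ip x = sqrt (Re (ip x x))"

definition complex_hilbert_space ::
  "(complex \<Rightarrow> 'h::ab_group_add \<Rightarrow> 'h) \<Rightarrow> ('h \<Rightarrow> 'h \<Rightarrow> complex) \<Rightarrow> bool" where
  "complex_hilbert_space sc ip \<longleftrightarrow>
     vector_space sc \<and>
     (\<forall>x y z. ip (x + y) z = ip x z + ip y z) \<and>
     (\<forall>a x y. ip (sc a x) y = a * ip x y) \<and>
     (\<forall>x y. ip y x = cnj (ip x y)) \<and>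
     (\<forall>x. 0 \<le> Re (ip x x)) \<and>
     (\<forall>x. ip x x = 0 \<longrightarrow> x = 0) \<and>
     (\<forall>X :: nat \<Rightarrow> 'h. (\<forall>e>0. \<exists>N. \<forall>m\<ge>N. \<forall>k\<ge>N. hnorm ip (X m - X k) < e)
        \<longrightarrow> (\<exists>L. (\<lambda>k. hnorm ip (X k - L)) \<longlonglongrightarrow> 0))"

definition clinear_op :: "(complex \<Rightarrow> 'h::ab_group_add \<Rightarrow> 'h) \<Rightarrow> ('h \<Rightarrow> 'h) \<Rightarrow> bool" where
  "clinear_op sc A \<longleftrightarrow> (\<forall>a x y. A (sc a x + y) = sc a (A x) + A y)"

definition contraction :: "(complex \<Rightarrow> 'h::ab_group_add \<Rightarrow> 'h) \<Rightarrow> ('h \<Rightarrow> 'h \<Rightarrow> complex) \<Rightarrow> ('h \<Rightarrow> 'h) \<Rightarrow> bool" where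
  "contraction sc ip A \<longleftrightarrow> clinear_op sc A \<and> (\<forall>x. hnorm ip (A x) \<le> hnorm ip x)"

definition is_adjoint :: "('h \<Rightarrow> 'h \<Rightarrow> complex) \<Rightarrow> ('h \<Rightarrow> 'h) \<Rightarrow> ('h \<Rightarrow> 'h) \<Rightarrow> bool" where
  "is_adjoint ip A S \<longleftrightarrow> (\<forall>x y. ip (A x) y = ip x (S y))"

definition normal_op :: "('h \<Rightarrow> 'h \<Rightarrow> complex) \<Rightarrow> ('h \<Rightarrow> 'h) \<Rightarrow> bool" where
  "normal_op ip A \<longleftrightarrow> (\<exists>S. is_adjoint ip A S \<and> A \<circ> S = S \<circ> A)"

definition contractive_semigroup ::
  "(complex \<Rightarrow> 'h::ab_group_add \<Rightarrow> 'h) \<Rightarrow> ('h \<Rightarrow> 'h \<Rightarrow> complex) \<Rightarrow> (real \<Rightarrow> 'h \<Rightarrow> 'h) \<Rightarrow> bool" where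
  "contractive_semigroup sc ip T \<longleftrightarrow>
     T 0 = id \<and>
     (\<forall>s\<ge>0. \<forall>t\<ge>0. T (s + t) = T s \<circ> T t) \<and>
     (\<forall>t\<ge>0. contraction sc ip (T t)) \<and>
     (\<forall>x. ((\<lambda>t. hnorm ip (T t x - x)) \<longlongrightarrow> 0) (at_right 0))"

definition normal_contractive_semigroup ::
  "(complex \<Rightarrow> 'h::ab_group_add \<Rightarrow> 'h) \<Rightarrow> ('h \<Rightarrow> 'h \<Rightarrow> complex) \<Rightarrow> (real \<Rightarrow> 'h \<Rightarrow> 'h) \<Rightarrow> bool" where
  "normal_contractive_semigroup sc ip T \<longleftrightarrow>
     contractive_semigroup sc ip T \<and> (\<forall>t\<ge>0. normal_op ip (T t))"

definition phi :: "real \<Rightarrow> complex \<Rightarrow> complex" where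
  "phi t w = exp (complex_of_real t * ((w + 1) / (w - 1)))"

definition semifinite :: "'x measure \<Rightarrow> bool" where
  "semifinite M \<longleftrightarrow> (\<forall>A\<in>sets M. emeasure M A = \<infinity> \<longrightarrow>
      (\<exists>B\<in>sets M. B \<subseteq> A \<and> 0 < emeasure M B \<and> emeasure M B < \<infinity>))"

text \<open>Elements of L^2(X,mu), represented by functions (equality a.e.).\<close>
definition square_integrable :: "'x measure \<Rightarrow> ('x \<Rightarrow> complex) \<Rightarrow> bool" where
  "square_integrable M f \<longleftrightarrow> f \<in> borel_measurable M \<and> integrable M (\<lambda>x. (cmod (f x))\<^sup>2)"

definition L2_inner :: "'x measure \<Rightarrow> ('x \<Rightarrow> complex) \<Rightarrow> ('x \<Rightarrow> complex) \<Rightarrow> complex" where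
  "L2_inner M f g = (LINT x|M. f x * cnj (g x))"

definition unitary_to_L2 ::
  "('h \<Rightarrow> 'h \<Rightarrow> complex) \<Rightarrow> 'x measure \<Rightarrow> ('h \<Rightarrow> 'x \<Rightarrow> complex) \<Rightarrow> bool" where
  "unitary_to_L2 ip M \<gamma> \<longleftrightarrow>
     (\<forall>h. square_integrable M (\<gamma> h)) \<and>
     (\<forall>h k. L2_inner M (\<gamma> h) (\<gamma> k) = ip h k) \<and>
     (\<forall>f. square_integrable M f \<longrightarrow> (\<exists>h. AE x in M. \<gamma> h x = f x))"

end

theory Submission
  imports Defs
begin

text \<open>For a normal operator \<open>A\<close> the vectors with \<open>\<parallel>(A - \<lambda>)\<^sup>k x\<parallel> \<le> r\<^sup>k \<parallel>x\<parallel>\<close> for all \<open>k\<close> form a closed subspace,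
  the spectral subspace of the closed disc of radius \<open>r\<close> around \<open>\<lambda>\<close>. It reduces every operator that commutes
  with \<open>A\<close>, so the projections \<open>P\<^sub>k\<close> onto the disc subspaces of the operators \<open>T\<^sub>j\<close> at dyadic times (with
  centres in a countable dense set and radii \<open>1/p\<close>) commute, and since finitely many small discs cover the
  spectrum, the \<open>P\<^sub>k\<close> determine these operators. A vector \<open>v\<close> defines a measure on sequences \<open>w\<close> giving the
  cylinder \<open>w\<^sub>k = 1\<close> for \<open>k\<close> in a finite set the mass \<open>\<parallel>P\<^sub>k\<^sub>1 \<dots> P\<^sub>k\<^sub>m v\<parallel>\<^sup>2\<close>; the cyclic subspace of \<open>v\<close> is then \<open>L\<^sup>2\<close>
  of that measure, and a maximal family of orthogonal cyclic subspaces gives the measure space.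
  In this model \<open>T\<^sub>j\<close> at time \<open>2\<^sup>-\<^sup>m\<close> is multiplication by a function \<open>z\<^sub>m\<close>. Strong continuity keeps means of the
  powers of \<open>z\<^sub>m\<close> close to 1, which forces \<open>z\<^sub>m = exp (g / 2\<^sup>m)\<close> for a function \<open>g\<close> with \<open>Re g \<le> 0\<close>, and
  \<open>\<psi>\<^sub>j = (g + 1) / (g - 1)\<close>.\<close>

section \<open>Hilbert spaces\<close>

lemma of_real_cmod_power2: "(complex_of_real (cmod z))\<^sup>2 = z * cnj z"
  by (metis complex_norm_square of_real_power)

locale hilbert_space =
  fixes sc :: "complex \<Rightarrow> 'h::ab_group_add \<Rightarrow> 'h"
    and ip :: "'h \<Rightarrow> 'h \<Rightarrow> complex"
  assumes hilbert: "complex_hilbert_space sc ip"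
begin

sublocale vector_space sc
  using hilbert by (simp add: complex_hilbert_space_def)

sublocale vector_space_pair sc sc ..

abbreviation hilbert_norm :: "'h \<Rightarrow> real" (\<open>\<parallel>_\<parallel>\<close>) where
  "\<parallel>x\<parallel> \<equiv> hnorm ip x"

lemma ip_add_left: "ip (x + y) z = ip x z + ip y z"
  and ip_scale_left: "ip (sc a x) y = a * ip x y"
  and ip_self_nonneg: "0 \<le> Re (ip x x)"
  and ip_self_eq_0D: "ip x x = 0 \<Longrightarrow> x = 0"
  and ip_commute: "ip y x = cnj (ip x y)"
  using hilbert unfolding complex_hilbert_space_def by iprover+

lemma ip_add_right: "ip x (y + z) = ip x y + ip x z"
  by (metis complex_cnj_add ip_add_left ip_commute)

lemma ip_scale_right: "ip x (sc a y) = cnj a * ip x y"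
  by (metis complex_cnj_mult ip_commute ip_scale_left)

lemma ip_zero_left [simp]: "ip 0 y = 0"
  using ip_add_left[of 0 0 y] by simp

lemma ip_zero_right [simp]: "ip y 0 = 0"
  using ip_add_right[of y 0 0] by simp

lemma ip_minus_left: "ip (- x) y = - ip x y"
  using ip_add_left[of x "- x" y] by (simp add: add_eq_0_iff)

lemma ip_minus_right: "ip x (- y) = - ip x y"
  using ip_add_right[of x y "- y"] by (simp add: add_eq_0_iff)

lemma ip_diff_left: "ip (x - y) z = ip x z - ip y z"
  using ip_add_left[of x "- y" z] by (simp add: ip_minus_left)

lemma ip_diff_right: "ip x (y - z) = ip x y - ip x z"
  using ip_add_right[of x y "- z"] by (simp add: ip_minus_right)

lemmas ip_simps = ip_add_left ip_add_right ip_scale_left ip_scale_right ip_diff_left ip_diff_right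
  ip_minus_left ip_minus_right

lemma ip_eq_0_commute: "ip x y = 0 \<longleftrightarrow> ip y x = 0"
  by (simp add: ip_commute[of x y])

lemma eq_if_ip_eq: "(\<And>z. ip z x = ip z y) \<Longrightarrow> x = y"
  using ip_self_eq_0D[of "x - y"] by (simp add: ip_diff_right)

lemma hnorm_nonneg [simp]: "0 \<le> \<parallel>x\<parallel>"
  by (simp add: hnorm_def ip_self_nonneg)

lemma hnorm_power2: "\<parallel>x\<parallel>\<^sup>2 = Re (ip x x)"
  by (simp add: hnorm_def ip_self_nonneg)

lemma ip_self: "ip x x = complex_of_real (\<parallel>x\<parallel>\<^sup>2)"
proof -
  have "Im (ip x x) = 0"
    using arg_cong[OF ip_commute[of x x], of Im] by simp
  then show ?thesis by (simp add: hnorm_power2 complex_eq_iff)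
qed

lemma hnorm_zero [simp]: "\<parallel>0\<parallel> = 0"
  by (simp add: hnorm_def)

lemma hnorm_eq_0_iff [simp]: "\<parallel>x\<parallel> = 0 \<longleftrightarrow> x = 0"
  using ip_self_eq_0D[of x] by (auto simp: ip_self)

lemma hnorm_pos_iff [simp]: "0 < \<parallel>x\<parallel> \<longleftrightarrow> x \<noteq> 0"
  using hnorm_eq_0_iff[of x] hnorm_nonneg[of x] by linarith

lemma hnorm_scale: "\<parallel>sc a x\<parallel> = cmod a * \<parallel>x\<parallel>"
proof -
  have "ip (sc a x) (sc a x) = of_real ((cmod a)\<^sup>2) * ip x x"
    by (simp only: ip_simps complex_norm_square mult_ac)
  then have "\<parallel>sc a x\<parallel>\<^sup>2 = (cmod a * \<parallel>x\<parallel>)\<^sup>2"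
    by (simp add: hnorm_power2 power_mult_distrib)
  then show ?thesis by simp
qed

lemma hnorm_minus [simp]: "\<parallel>- x\<parallel> = \<parallel>x\<parallel>"
  by (simp add: hnorm_def ip_simps)

lemma hnorm_minus_commute: "\<parallel>x - y\<parallel> = \<parallel>y - x\<parallel>"
  using hnorm_minus[of "x - y"] by simp

lemma hnorm_add_power2: "\<parallel>x + y\<parallel>\<^sup>2 = \<parallel>x\<parallel>\<^sup>2 + \<parallel>y\<parallel>\<^sup>2 + 2 * Re (ip x y)"
  using arg_cong[OF ip_commute[of x y], of Re] by (simp add: hnorm_power2 ip_simps)

lemma hnorm_diff_power2: "\<parallel>x - y\<parallel>\<^sup>2 = \<parallel>x\<parallel>\<^sup>2 + \<parallel>y\<parallel>\<^sup>2 - 2 * Re (ip x y)"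
  using hnorm_add_power2[of x "- y"] by (simp add: ip_simps)

lemma pythagoras: "ip x y = 0 \<Longrightarrow> \<parallel>x + y\<parallel>\<^sup>2 = \<parallel>x\<parallel>\<^sup>2 + \<parallel>y\<parallel>\<^sup>2"
  by (simp add: hnorm_add_power2)

lemma parallelogram_law: "\<parallel>x + y\<parallel>\<^sup>2 + \<parallel>x - y\<parallel>\<^sup>2 = 2 * \<parallel>x\<parallel>\<^sup>2 + 2 * \<parallel>y\<parallel>\<^sup>2"
  by (simp add: hnorm_add_power2 hnorm_diff_power2)

lemma hnorm_power2_component:
  assumes "y \<noteq> 0"
  shows "\<parallel>x\<parallel>\<^sup>2 = \<parallel>x - sc (ip x y / ip y y) y\<parallel>\<^sup>2 + \<parallel>sc (ip x y / ip y y) y\<parallel>\<^sup>2"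
proof -
  let ?b = "ip x y / ip y y"
  have "ip (x - sc ?b y) y = 0"
    using assms by (simp add: ip_diff_left ip_scale_left ip_self)
  then have "ip (x - sc ?b y) (sc ?b y) = 0"
    by (simp only: ip_scale_right mult_zero_right)
  from pythagoras[OF this] show ?thesis by simp
qed

lemma cauchy_schwarz: "cmod (ip x y) \<le> \<parallel>x\<parallel> * \<parallel>y\<parallel>"
proof (cases "y = 0")
  case False
  have "\<parallel>sc (ip x y / ip y y) y\<parallel>\<^sup>2 \<le> \<parallel>x\<parallel>\<^sup>2"
    using hnorm_power2_component[OF False, of x] by simp
  then have "\<parallel>sc (ip x y / ip y y) y\<parallel> \<le> \<parallel>x\<parallel>"
    by (rule power2_le_imp_le) simp
  moreover have "\<parallel>sc (ip x y / ip y y) y\<parallel> = cmod (ip x y) / \<parallel>y\<parallel>"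
    by (simp add: hnorm_scale ip_self norm_divide norm_mult power2_eq_square)
  ultimately show ?thesis using False by (simp add: divide_le_eq)
qed simp

lemma Re_ip_le: "Re (ip x y) \<le> \<parallel>x\<parallel> * \<parallel>y\<parallel>"
  using cauchy_schwarz[of x y] complex_Re_le_cmod[of "ip x y"] by linarith

lemma hnorm_triangle_ineq: "\<parallel>x + y\<parallel> \<le> \<parallel>x\<parallel> + \<parallel>y\<parallel>"
proof (rule power2_le_imp_le)
  show "\<parallel>x + y\<parallel>\<^sup>2 \<le> (\<parallel>x\<parallel> + \<parallel>y\<parallel>)\<^sup>2"
    using Re_ip_le[of x y] by (simp add: hnorm_add_power2 power2_sum)
qed simp

lemma hnorm_triangle_ineq4: "\<parallel>x - y\<parallel> \<le> \<parallel>x\<parallel> + \<parallel>y\<parallel>"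
  using hnorm_triangle_ineq[of x "- y"] by simp

lemma hnorm_sum: "\<parallel>sum f A\<parallel> \<le> (\<Sum>a\<in>A. \<parallel>f a\<parallel>)"
proof (induction A rule: infinite_finite_induct)
  case (insert a A)
  then show ?case using hnorm_triangle_ineq[of "f a" "sum f A"] by simp
qed auto

sublocale metric: Metric_space UNIV "\<lambda>x y. \<parallel>x - y\<parallel>"
proof
  show "\<parallel>x - z\<parallel> \<le> \<parallel>x - y\<parallel> + \<parallel>y - z\<parallel>" for x y z
    using hnorm_triangle_ineq[of "x - y" "y - z"] by simp
qed (simp_all add: hnorm_minus_commute)

abbreviation hlim :: "(nat \<Rightarrow> 'h) \<Rightarrow> 'h \<Rightarrow> bool" where
  "hlim X L \<equiv> limitin metric.mtopology X L sequentially"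

lemma hlim_iff: "hlim X L \<longleftrightarrow> (\<lambda>k. \<parallel>X k - L\<parallel>) \<longlonglongrightarrow> 0"
  by (simp add: metric.limitin_metric_dist_null)

lemma hlim_unique: "hlim X L \<Longrightarrow> hlim X K \<Longrightarrow> L = K"
  by (rule metric.limitin_metric_unique) auto

lemma mcomplete: "metric.mcomplete"
proof -
  have "\<forall>X. (\<forall>e>0. \<exists>N. \<forall>m\<ge>N. \<forall>k\<ge>N. \<parallel>X m - X k\<parallel> < e) \<longrightarrow> (\<exists>L. (\<lambda>k. \<parallel>X k - L\<parallel>) \<longlonglongrightarrow> 0)"
    using hilbert unfolding complex_hilbert_space_def by (elim conjE)
  then show ?thesis
    by (simp only: metric.mcomplete_def metric.MCauchy_def hlim_iff subset_UNIV simp_thms all_simps)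
qed

lemma Cauchy_dominated_hlim:
  assumes "\<And>m k. \<parallel>X m - X k\<parallel> \<le> e m + e k" "e \<longlonglongrightarrow> (0::real)"
  shows "\<exists>L. hlim X L"
proof -
  have "metric.MCauchy X"
    unfolding metric.MCauchy_def
  proof (intro conjI allI impI)
    fix \<epsilon> :: real assume "\<epsilon> > 0"
    then have "\<forall>\<^sub>F k in sequentially. e k < \<epsilon> / 2"
      using assms(2) by (intro order_tendstoD(2)) auto
    then obtain N where "\<And>k. k \<ge> N \<Longrightarrow> e k < \<epsilon> / 2"
      by (auto simp: eventually_sequentially)
    then have "\<parallel>X m - X k\<parallel> < \<epsilon>" if "N \<le> m" "N \<le> k" for m k
      using assms(1)[of m k] that by (smt (verit) field_sum_of_halves)
    then show "\<exists>N. \<forall>m k. N \<le> m \<longrightarrow> N \<le> k \<longrightarrow> \<parallel>X m - X k\<parallel> < \<epsilon>" by blast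
  qed simp
  then show ?thesis using mcomplete by (simp add: metric.mcomplete_def)
qed

lemma hlim_sandwich:
  assumes "\<And>k. \<parallel>X k - L\<parallel> \<le> e k" "e \<longlonglongrightarrow> 0"
  shows "hlim X L"
  unfolding hlim_iff by (rule tendsto_sandwich[OF _ _ tendsto_const assms(2)]) (auto simp: assms(1))

lemma hlim_const [simp]: "hlim (\<lambda>k. L) L"
  by (simp add: hlim_iff)

lemma hlim_add:
  assumes "hlim X L" "hlim Y K"
  shows "hlim (\<lambda>k. X k + Y k) (L + K)"
proof (rule hlim_sandwich)
  show "\<parallel>X k + Y k - (L + K)\<parallel> \<le> \<parallel>X k - L\<parallel> + \<parallel>Y k - K\<parallel>" for k
    using hnorm_triangle_ineq[of "X k - L" "Y k - K"] by (simp add: algebra_simps)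
  show "(\<lambda>k. \<parallel>X k - L\<parallel> + \<parallel>Y k - K\<parallel>) \<longlonglongrightarrow> 0"
    using tendsto_add[of _ 0 _ _ 0] assms by (simp add: hlim_iff)
qed

lemma hlim_lipschitz:
  assumes "hlim X L" "\<And>x y. \<parallel>A x - A y\<parallel> \<le> c * \<parallel>x - y\<parallel>"
  shows "hlim (\<lambda>k. A (X k)) (A L)"
proof (rule hlim_sandwich)
  show "(\<lambda>k. c * \<parallel>X k - L\<parallel>) \<longlonglongrightarrow> 0"
    using assms(1) tendsto_mult_right_zero unfolding hlim_iff by blast
qed (rule assms(2))

lemma hlim_scale: "hlim X L \<Longrightarrow> hlim (\<lambda>k. sc a (X k)) (sc a L)"
  by (rule hlim_lipschitz[where c = "cmod a"]) (auto simp: scale_right_diff_distrib[symmetric] hnorm_scale)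

lemma hlim_diff: "hlim X L \<Longrightarrow> hlim Y K \<Longrightarrow> hlim (\<lambda>k. X k - Y k) (L - K)"
  using hlim_add[of X L "\<lambda>k. - Y k" "- K"] by (simp add: hlim_iff hnorm_minus_commute)

lemma hlim_ip_left:
  assumes "hlim X L"
  shows "(\<lambda>k. ip (X k) y) \<longlonglongrightarrow> ip L y"
proof (rule LIM_zero_cancel, rule tendsto_norm_zero_cancel, rule tendsto_sandwich[OF _ _ tendsto_const])
  show "\<forall>\<^sub>F k in sequentially. cmod (ip (X k) y - ip L y) \<le> \<parallel>X k - L\<parallel> * \<parallel>y\<parallel>"
    using cauchy_schwarz[of "X _ - L" y] by (simp add: ip_diff_left)
  show "(\<lambda>k. \<parallel>X k - L\<parallel> * \<parallel>y\<parallel>) \<longlonglongrightarrow> 0"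
    using assms tendsto_mult_left_zero unfolding hlim_iff by blast
qed auto

lemma hlim_hnorm:
  assumes "hlim X L"
  shows "(\<lambda>k. \<parallel>X k\<parallel>) \<longlonglongrightarrow> \<parallel>L\<parallel>"
proof (rule LIM_zero_cancel, rule tendsto_rabs_zero_cancel, rule tendsto_sandwich[OF _ _ tendsto_const])
  show "\<forall>\<^sub>F k in sequentially. \<bar>\<parallel>X k\<parallel> - \<parallel>L\<parallel>\<bar> \<le> \<parallel>X k - L\<parallel>"
    using metric.mdist_reverse_triangle[of _ 0 L] by simp
qed (use assms hlim_iff in auto)

section \<open>Closed subspaces and orthogonal projections\<close>

definition closed_subspace :: "'h set \<Rightarrow> bool" where
  "closed_subspace K \<longleftrightarrow> subspace K \<and> closedin metric.mtopology K"

lemma closed_subspaceI: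
  assumes "0 \<in> K" "\<And>x y. x \<in> K \<Longrightarrow> y \<in> K \<Longrightarrow> x + y \<in> K" "\<And>a x. x \<in> K \<Longrightarrow> sc a x \<in> K"
    and "\<And>X L. (\<And>k. X k \<in> K) \<Longrightarrow> hlim X L \<Longrightarrow> L \<in> K"
  shows "closed_subspace K"
  unfolding closed_subspace_def subspace_def metric.metric_closedin_iff_sequentially_closed
  using assms(1-3) by (auto simp: image_subset_iff intro: assms(4))

lemma closed_subspace_0: "closed_subspace K \<Longrightarrow> 0 \<in> K"
  and closed_subspace_add: "closed_subspace K \<Longrightarrow> x \<in> K \<Longrightarrow> y \<in> K \<Longrightarrow> x + y \<in> K"
  and closed_subspace_diff: "closed_subspace K \<Longrightarrow> x \<in> K \<Longrightarrow> y \<in> K \<Longrightarrow> x - y \<in> K"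
  and closed_subspace_scale: "closed_subspace K \<Longrightarrow> x \<in> K \<Longrightarrow> sc a x \<in> K"
  by (simp_all add: closed_subspace_def subspace_0 subspace_add subspace_diff
      subspace_scale)

lemma closed_subspace_hlim: "closed_subspace K \<Longrightarrow> (\<And>k. X k \<in> K) \<Longrightarrow> hlim X L \<Longrightarrow> L \<in> K"
  unfolding closed_subspace_def metric.metric_closedin_iff_sequentially_closed by blast

lemma closed_subspace_Int: "closed_subspace K \<Longrightarrow> closed_subspace L \<Longrightarrow> closed_subspace (K \<inter> L)"
  by (simp add: closed_subspace_def closedin_Int subspace_inter)

definition perp :: "'h set \<Rightarrow> 'h set" where
  "perp A = {x. \<forall>y\<in>A. ip x y = 0}"

lemma perpD: "x \<in> perp A \<Longrightarrow> y \<in> A \<Longrightarrow> ip x y = 0"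
  by (simp add: perp_def)

lemma closed_subspace_perp: "closed_subspace (perp A)"
proof (rule closed_subspaceI)
  fix X L assume X: "\<And>k. X k \<in> perp A" "hlim X L"
  have "ip L y = 0" if "y \<in> A" for y
    using hlim_ip_left[OF X(2), of y] perpD[OF X(1) that] LIMSEQ_unique[OF _ tendsto_const] by simp
  then show "L \<in> perp A" by (simp add: perp_def)
qed (auto simp: perp_def ip_simps)

lemma Int_perp_eq_0: "x \<in> A \<Longrightarrow> x \<in> perp A \<Longrightarrow> x = 0"
  using perpD ip_self_eq_0D by blast

lemma hnorm_diff_power2_le_of_lower_bound:
  assumes K: "closed_subspace K" "y \<in> K" "z \<in> K" and d: "\<And>w. w \<in> K \<Longrightarrow> d \<le> \<parallel>x - w\<parallel>\<^sup>2"
  shows "\<parallel>y - z\<parallel>\<^sup>2 \<le> 2 * (\<parallel>x - y\<parallel>\<^sup>2 - d) + 2 * (\<parallel>x - z\<parallel>\<^sup>2 - d)"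
proof -
  have "sc 2 x = x + x" using scale_left_distrib[of 1 1 x] by simp
  then have "(x - y) + (x - z) = sc 2 (x - sc (1/2) (y + z))"
    by (simp add: scale_right_diff_distrib)
  then have "\<parallel>(x - y) + (x - z)\<parallel>\<^sup>2 = 4 * \<parallel>x - sc (1/2) (y + z)\<parallel>\<^sup>2"
    by (simp add: hnorm_scale power_mult_distrib)
  moreover have "d \<le> \<parallel>x - sc (1/2) (y + z)\<parallel>\<^sup>2"
    by (intro d closed_subspace_scale closed_subspace_add K)
  moreover have "\<parallel>(x - y) - (x - z)\<parallel> = \<parallel>y - z\<parallel>" by (simp add: hnorm_minus_commute)
  ultimately show ?thesis using parallelogram_law[of "x - y" "x - z"] by simp
qed

lemma nearest_point_exists:
  assumes K: "closed_subspace K"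
  shows "\<exists>p\<in>K. \<forall>y\<in>K. \<parallel>x - p\<parallel>\<^sup>2 \<le> \<parallel>x - y\<parallel>\<^sup>2"
proof -
  define d where "d = (INF y\<in>K. \<parallel>x - y\<parallel>\<^sup>2)"
  have bdd: "bdd_below ((\<lambda>y. \<parallel>x - y\<parallel>\<^sup>2) ` K)" by (rule bdd_belowI[of _ 0]) auto
  have nonempty: "K \<noteq> {}" using closed_subspace_0[OF K] by auto
  have d_le: "d \<le> \<parallel>x - y\<parallel>\<^sup>2" if "y \<in> K" for y
    unfolding d_def by (rule cINF_lower[OF bdd that])
  define h :: "nat \<Rightarrow> real" where "h k = (1/2) ^ k" for k
  have h: "h \<longlonglongrightarrow> 0" "0 < h k" for k
    unfolding h_def by (auto intro: LIMSEQ_power_zero)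
  have "\<exists>y\<in>K. \<parallel>x - y\<parallel>\<^sup>2 < d + h k" for k
    using cINF_less_iff[OF nonempty bdd, of "d + h k"] h(2)[of k] by (simp flip: d_def)
  then obtain Y where Y: "\<And>k. Y k \<in> K" "\<And>k. \<parallel>x - Y k\<parallel>\<^sup>2 < d + h k"
    by metis
  have "\<exists>p. hlim Y p"
  proof (rule Cauchy_dominated_hlim)
    fix m k
    have "\<parallel>Y m - Y k\<parallel>\<^sup>2 \<le> 2 * (\<parallel>x - Y m\<parallel>\<^sup>2 - d) + 2 * (\<parallel>x - Y k\<parallel>\<^sup>2 - d)"
      by (rule hnorm_diff_power2_le_of_lower_bound[OF K Y(1) Y(1) d_le])
    also have "\<dots> \<le> 2 * h m + 2 * h k"
      using Y(2)[of m, THEN less_imp_le] Y(2)[of k, THEN less_imp_le] by (simp add: algebra_simps)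
    finally have "\<parallel>Y m - Y k\<parallel>\<^sup>2 \<le> 2 * h m + 2 * h k" .
    then have "\<parallel>Y m - Y k\<parallel> \<le> sqrt (2 * h m + 2 * h k)" by (rule real_le_rsqrt)
    also have "\<dots> \<le> sqrt (2 * h m) + sqrt (2 * h k)" by (rule sqrt_add_le_add_sqrt) (simp_all add: h_def)
    finally show "\<parallel>Y m - Y k\<parallel> \<le> sqrt (2 * h m) + sqrt (2 * h k)" .
  next
    show "(\<lambda>k. sqrt (2 * h k)) \<longlonglongrightarrow> 0"
      using tendsto_real_sqrt[OF tendsto_mult_right_zero[OF h(1)]] by simp
  qed
  then obtain p where p: "hlim Y p" by blast
  have "\<parallel>x - p\<parallel>\<^sup>2 \<le> d"
  proof (rule LIMSEQ_le)
    show "(\<lambda>k. \<parallel>x - Y k\<parallel>\<^sup>2) \<longlonglongrightarrow> \<parallel>x - p\<parallel>\<^sup>2"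
      by (intro tendsto_power hlim_hnorm hlim_diff hlim_const p)
    show "(\<lambda>k. d + h k) \<longlonglongrightarrow> d" using tendsto_add[OF tendsto_const h(1)] by simp
  qed (use Y(2) less_imp_le in blast)
  then show ?thesis using closed_subspace_hlim[OF K Y(1) p] d_le order_trans by blast
qed

lemma projection_exists:
  assumes K: "closed_subspace K"
  shows "\<exists>p\<in>K. x - p \<in> perp K"
proof -
  obtain p where p: "p \<in> K" "\<And>y. y \<in> K \<Longrightarrow> \<parallel>x - p\<parallel>\<^sup>2 \<le> \<parallel>x - y\<parallel>\<^sup>2"
    using nearest_point_exists[OF K] by blast
  have "ip (x - p) y = 0" if y: "y \<in> K" for y
  proof (cases "y = 0")
    case False
    define b where "b = ip (x - p) y / ip y y"
    have "\<parallel>x - p\<parallel>\<^sup>2 = \<parallel>x - (p + sc b y)\<parallel>\<^sup>2 + \<parallel>sc b y\<parallel>\<^sup>2"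
      using hnorm_power2_component[OF False, of "x - p"] by (simp add: b_def diff_diff_eq)
    moreover have "\<parallel>x - p\<parallel>\<^sup>2 \<le> \<parallel>x - (p + sc b y)\<parallel>\<^sup>2"
      by (intro p closed_subspace_add closed_subspace_scale K y)
    ultimately have "\<parallel>sc b y\<parallel> = 0" by simp
    then show ?thesis using False by (simp add: b_def hnorm_scale ip_self)
  qed simp
  with p show ?thesis by (auto simp: perp_def)
qed

definition proj :: "'h set \<Rightarrow> 'h \<Rightarrow> 'h" where
  "proj K x = (SOME p. p \<in> K \<and> x - p \<in> perp K)"

lemma
  assumes "closed_subspace K"
  shows proj_in: "proj K x \<in> K" and diff_proj_in_perp: "x - proj K x \<in> perp K"
  using someI_ex[OF projection_exists[OF assms, of x, unfolded Bex_def]] by (simp_all add: proj_def)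

lemma proj_eqI:
  assumes K: "closed_subspace K" and p: "p \<in> K" "x - p \<in> perp K"
  shows "proj K x = p"
proof -
  have "p - proj K x \<in> K" by (intro closed_subspace_diff K p proj_in)
  moreover have "(x - proj K x) - (x - p) \<in> perp K"
    by (intro closed_subspace_diff closed_subspace_perp diff_proj_in_perp K p)
  ultimately show ?thesis using Int_perp_eq_0[of "p - proj K x" K] by simp
qed

lemma proj_self: "closed_subspace K \<Longrightarrow> x \<in> K \<Longrightarrow> proj K x = x"
  by (rule proj_eqI) (auto simp: closed_subspace_0 closed_subspace_perp)

lemma is_adjoint_proj:
  assumes K: "closed_subspace K"
  shows "is_adjoint ip (proj K) (proj K)"
  unfolding is_adjoint_def
proof (intro allI)
  fix x y
  have "ip (x - proj K x) (proj K y) = 0" "ip (y - proj K y) (proj K x) = 0"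
    by (auto intro: perpD diff_proj_in_perp proj_in K)
  then show "ip (proj K x) y = ip x (proj K y)"
    using ip_eq_0_commute[of "y - proj K y" "proj K x"] by (simp add: ip_simps)
qed

lemma hnorm_proj_le:
  assumes K: "closed_subspace K"
  shows "\<parallel>proj K x\<parallel> \<le> \<parallel>x\<parallel>"
proof (rule power2_le_imp_le)
  have "ip (x - proj K x) (proj K x) = 0" by (rule perpD[OF diff_proj_in_perp[OF K] proj_in[OF K]])
  from pythagoras[OF this] show "\<parallel>proj K x\<parallel>\<^sup>2 \<le> \<parallel>x\<parallel>\<^sup>2" by simp
qed simp

lemma contraction_proj:
  assumes K: "closed_subspace K"
  shows "contraction sc ip (proj K)"
  unfolding contraction_def clinear_op_def
proof (intro conjI allI)
  fix a x y
  have "sc a x + y - (sc a (proj K x) + proj K y) = sc a (x - proj K x) + (y - proj K y)"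
    by (simp add: scale_right_diff_distrib)
  also have "\<dots> \<in> perp K"
    by (intro closed_subspace_add closed_subspace_scale closed_subspace_perp diff_proj_in_perp K)
  finally show "proj K (sc a x + y) = sc a (proj K x) + proj K y"
    by (intro proj_eqI K closed_subspace_add closed_subspace_scale proj_in)
qed (rule hnorm_proj_le[OF K])

lemma closed_subspace_eq_UNIV:
  assumes K: "closed_subspace K" and "\<And>x. x \<in> perp K \<Longrightarrow> x = 0"
  shows "K = UNIV"
proof -
  have "x \<in> K" for x
    using assms(2)[OF diff_proj_in_perp[OF K, of x]] proj_in[OF K, of x] by simp
  then show ?thesis by blast
qed

end

section \<open>Bounded operators and their adjoints\<close>

definition commuting :: "('a \<Rightarrow> 'a) \<Rightarrow> ('a \<Rightarrow> 'a) \<Rightarrow> bool" where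
  "commuting A B \<longleftrightarrow> A \<circ> B = B \<circ> A"

lemma commutingI: "(\<And>x. A (B x) = B (A x)) \<Longrightarrow> commuting A B"
  by (auto simp: commuting_def)

lemma commutingD: "commuting A B \<Longrightarrow> A (B x) = B (A x)"
  unfolding commuting_def by (rule comp_eq_dest)

lemma commuting_sym: "commuting A B \<Longrightarrow> commuting B A"
  by (simp add: commuting_def)

lemma commuting_refl: "commuting A A"
  by (simp add: commuting_def)

lemma commuting_comp:
  assumes "commuting A B" "commuting A C"
  shows "commuting A (\<lambda>x. B (C x))"
  by (rule commutingI) (simp only: commutingD[OF assms(1)] commutingD[OF assms(2)])

lemma commuting_funpow: "commuting A B \<Longrightarrow> commuting A (B ^^ k)"
proof (induction k)
  case (Suc k)
  from commuting_comp[OF Suc.prems Suc.IH[OF Suc.prems]] show ?case by (simp add: comp_def)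
qed (simp add: commuting_def)

lemma commuting_foldr: "(\<And>k. commuting A (P k)) \<Longrightarrow> commuting A (foldr P ks)"
proof (induction ks)
  case (Cons k ks)
  from commuting_comp[OF Cons.prems Cons.IH[OF Cons.prems]] show ?case by (simp add: comp_def)
qed (simp add: commuting_def)

context hilbert_space
begin

definition bounded_op :: "('h \<Rightarrow> 'h) \<Rightarrow> bool" where
  "bounded_op A \<longleftrightarrow> clinear_op sc A \<and> (\<exists>c. \<forall>x. \<parallel>A x\<parallel> \<le> c * \<parallel>x\<parallel>)"

lemma bounded_opI: "clinear_op sc A \<Longrightarrow> (\<And>x. \<parallel>A x\<parallel> \<le> c * \<parallel>x\<parallel>) \<Longrightarrow> bounded_op A"
  unfolding bounded_op_def by blast

lemma bounded_op_imp_linear: "bounded_op A \<Longrightarrow> Vector_Spaces.linear sc sc A"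
proof -
  assume "bounded_op A"
  then have lin: "A (sc a x + y) = sc a (A x) + A y" for a x y
    by (simp add: bounded_op_def clinear_op_def)
  moreover from this have "A 0 = 0" using lin[of 1 0 0] by simp
  ultimately show ?thesis
    using lin[of 1] lin[of _ _ 0] unfolding Vector_Spaces.linear_iff by (simp add: vector_space_axioms)
qed

lemma bounded_op_map_0: "bounded_op A \<Longrightarrow> A 0 = 0"
  and bounded_op_map_add: "bounded_op A \<Longrightarrow> A (x + y) = A x + A y"
  and bounded_op_map_diff: "bounded_op A \<Longrightarrow> A (x - y) = A x - A y"
  and bounded_op_map_scale: "bounded_op A \<Longrightarrow> A (sc a x) = sc a (A x)"
  by (simp_all add: bounded_op_imp_linear linear_0 linear_add linear_diff linear_scale)

lemma bounded_op_bound: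
  assumes "bounded_op A"
  obtains c where "c \<ge> 0" "\<And>x. \<parallel>A x\<parallel> \<le> c * \<parallel>x\<parallel>"
proof -
  obtain c where c: "\<And>x. \<parallel>A x\<parallel> \<le> c * \<parallel>x\<parallel>" using assms by (auto simp: bounded_op_def)
  have "\<parallel>A x\<parallel> \<le> max c 0 * \<parallel>x\<parallel>" for x
    using c[of x] mult_right_mono[of c "max c 0" "\<parallel>x\<parallel>"] by simp
  then show thesis using that[of "max c 0"] by simp
qed

lemma hlim_bounded_op:
  assumes A: "bounded_op A" and X: "hlim X L"
  shows "hlim (\<lambda>k. A (X k)) (A L)"
proof -
  obtain c where "\<And>x. \<parallel>A x\<parallel> \<le> c * \<parallel>x\<parallel>" using A by (rule bounded_op_bound) blast
  then have "\<parallel>A x - A y\<parallel> \<le> c * \<parallel>x - y\<parallel>" for x y by (simp flip: bounded_op_map_diff[OF A])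
  then show ?thesis by (rule hlim_lipschitz[OF X])
qed

lemma bounded_op_contraction: "contraction sc ip A \<Longrightarrow> bounded_op A"
  by (auto simp: contraction_def intro: bounded_opI[where c = 1])

lemma contraction_le: "contraction sc ip A \<Longrightarrow> \<parallel>A x\<parallel> \<le> \<parallel>x\<parallel>"
  by (simp add: contraction_def)

lemma contraction_id: "contraction sc ip (\<lambda>x. x)"
  by (simp add: contraction_def clinear_op_def)

lemma bounded_op_scale:
  assumes A: "bounded_op A"
  shows "bounded_op (\<lambda>x. sc a (A x))"
proof -
  obtain c where c: "\<And>x. \<parallel>A x\<parallel> \<le> c * \<parallel>x\<parallel>" using A by (rule bounded_op_bound) blast
  show ?thesis
  proof (rule bounded_opI)
    show "clinear_op sc (\<lambda>x. sc a (A x))"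
      by (simp add: clinear_op_def bounded_op_map_add[OF A] bounded_op_map_scale[OF A] scale_right_distrib mult.commute)
    show "\<parallel>sc a (A x)\<parallel> \<le> (cmod a * c) * \<parallel>x\<parallel>" for x
      using mult_left_mono[OF c[of x], of "cmod a"] by (simp add: hnorm_scale mult.assoc)
  qed
qed

lemma bounded_op_add:
  assumes A: "bounded_op A" and B: "bounded_op B"
  shows "bounded_op (\<lambda>x. A x + B x)"
proof -
  obtain c where c: "\<And>x. \<parallel>A x\<parallel> \<le> c * \<parallel>x\<parallel>" using A by (rule bounded_op_bound) blast
  obtain d where d: "\<And>x. \<parallel>B x\<parallel> \<le> d * \<parallel>x\<parallel>" using B by (rule bounded_op_bound) blast
  show ?thesis
  proof (rule bounded_opI)
    show "clinear_op sc (\<lambda>x. A x + B x)"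
      by (simp add: clinear_op_def bounded_op_map_add[OF A] bounded_op_map_scale[OF A]
          bounded_op_map_add[OF B] bounded_op_map_scale[OF B] scale_right_distrib)
    show "\<parallel>A x + B x\<parallel> \<le> (c + d) * \<parallel>x\<parallel>" for x
      using c[of x] d[of x] hnorm_triangle_ineq[of "A x" "B x"] by (simp add: distrib_right)
  qed
qed

lemma bounded_op_diff: "bounded_op A \<Longrightarrow> bounded_op B \<Longrightarrow> bounded_op (\<lambda>x. A x - B x)"
  using bounded_op_add[OF _ bounded_op_scale[of B "-1"], of A] by simp

lemma bounded_op_comp:
  assumes A: "bounded_op A" and B: "bounded_op B"
  shows "bounded_op (\<lambda>x. A (B x))"
proof -
  obtain c where c: "c \<ge> 0" "\<And>x. \<parallel>A x\<parallel> \<le> c * \<parallel>x\<parallel>" using A by (rule bounded_op_bound) blast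
  obtain d where d: "\<And>x. \<parallel>B x\<parallel> \<le> d * \<parallel>x\<parallel>" using B by (rule bounded_op_bound) blast
  show ?thesis
  proof (rule bounded_opI)
    show "clinear_op sc (\<lambda>x. A (B x))"
      by (simp add: clinear_op_def bounded_op_map_add[OF A] bounded_op_map_scale[OF A]
          bounded_op_map_add[OF B] bounded_op_map_scale[OF B])
    show "\<parallel>A (B x)\<parallel> \<le> (c * d) * \<parallel>x\<parallel>" for x
      using c(2)[of "B x"] mult_left_mono[OF d[of x] c(1)] by (simp add: mult.assoc)
  qed
qed

lemma bounded_op_id: "bounded_op (\<lambda>x. x)"
  by (rule bounded_op_contraction[OF contraction_id])

lemmas bounded_op_intros = bounded_op_id bounded_op_scale bounded_op_add bounded_op_diff

lemma bounded_op_funpow: "bounded_op A \<Longrightarrow> bounded_op (A ^^ k)"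
proof (induction k)
  case (Suc k)
  from bounded_op_comp[OF Suc.prems Suc.IH[OF Suc.prems]] show ?case by (simp add: comp_def)
qed (simp add: bounded_op_id id_def)

lemma riesz_representation:
  fixes \<phi> :: "'h \<Rightarrow> complex"
  assumes linear: "\<And>a x y. \<phi> (sc a x + y) = a * \<phi> x + \<phi> y"
    and bounded: "\<And>x. cmod (\<phi> x) \<le> c * \<parallel>x\<parallel>"
  shows "\<exists>k. \<forall>h. \<phi> h = ip h k"
proof -
  have add: "\<phi> (x + y) = \<phi> x + \<phi> y" for x y using linear[of 1 x y] by simp
  have zero: "\<phi> 0 = 0" using add[of 0 0] by simp
  have scale: "\<phi> (sc a x) = a * \<phi> x" for a x using linear[of a x 0] zero by simp
  have diff: "\<phi> (x - y) = \<phi> x - \<phi> y" for x y using add[of "x - y" y] by simp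
  define K where "K = {x. \<phi> x = 0}"
  have K: "closed_subspace K"
  proof (rule closed_subspaceI)
    fix X L assume X: "\<And>k. X k \<in> K" "hlim X L"
    have "(\<lambda>k. c * \<parallel>X k - L\<parallel>) \<longlonglongrightarrow> 0"
      using X(2) tendsto_mult_right_zero unfolding hlim_iff by blast
    moreover have "cmod (\<phi> L) \<le> c * \<parallel>X k - L\<parallel>" for k
      using bounded[of "X k - L"] X(1)[of k] by (simp add: diff K_def)
    ultimately have "cmod (\<phi> L) \<le> 0" by (meson LIMSEQ_le_const)
    then show "L \<in> K" by (simp add: K_def)
  qed (auto simp: K_def add scale zero)
  show ?thesis
  proof (cases "K = UNIV")
    case True
    then show ?thesis by (intro exI[of _ 0]) (auto simp: K_def)
  next
    case False
    then obtain x where x: "x \<noteq> 0" "x \<in> perp K"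
      using closed_subspace_eq_UNIV[OF K] by blast
    have "\<phi> h = ip h (sc (cnj (\<phi> x) / of_real (\<parallel>x\<parallel>\<^sup>2)) x)" for h
    proof -
      have "sc (\<phi> x) h - sc (\<phi> h) x \<in> K" by (simp add: K_def diff scale)
      then have "ip (sc (\<phi> x) h - sc (\<phi> h) x) x = 0"
        using perpD[OF x(2)] ip_eq_0_commute by blast
      then have "\<phi> x * ip h x = \<phi> h * of_real (\<parallel>x\<parallel>\<^sup>2)"
        by (simp add: ip_diff_left ip_scale_left ip_self)
      then show ?thesis using x(1) by (simp add: ip_scale_right field_simps)
    qed
    then show ?thesis by blast
  qed
qed

definition adj :: "('h \<Rightarrow> 'h) \<Rightarrow> 'h \<Rightarrow> 'h" where
  "adj A y = (SOME z. \<forall>x. ip (A x) y = ip x z)"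

lemma ip_adj_right:
  assumes A: "bounded_op A"
  shows "ip x (adj A y) = ip (A x) y"
proof -
  obtain c where c: "\<And>x. \<parallel>A x\<parallel> \<le> c * \<parallel>x\<parallel>" using A by (rule bounded_op_bound) blast
  have "\<exists>z. \<forall>x. ip (A x) y = ip x z"
  proof (rule riesz_representation)
    show "cmod (ip (A x) y) \<le> (c * \<parallel>y\<parallel>) * \<parallel>x\<parallel>" for x
      using cauchy_schwarz[of "A x" y] mult_right_mono[OF c[of x], of "\<parallel>y\<parallel>"] by (simp add: mult_ac)
  qed (simp add: bounded_op_map_add[OF A] bounded_op_map_scale[OF A] ip_simps)
  then have "\<forall>x. ip (A x) y = ip x (adj A y)" unfolding adj_def by (rule someI_ex)
  then show ?thesis by simp
qed

lemma ip_adj_left: "bounded_op A \<Longrightarrow> ip (adj A x) y = ip x (A y)"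
  by (metis ip_adj_right ip_commute)

lemma adj_eqI: "bounded_op A \<Longrightarrow> is_adjoint ip A S \<Longrightarrow> adj A = S"
  by (intro ext eq_if_ip_eq) (simp add: ip_adj_right is_adjoint_def)

lemma bounded_op_adj:
  assumes A: "bounded_op A"
  shows "bounded_op (adj A)"
proof -
  obtain c where c: "c \<ge> 0" "\<And>x. \<parallel>A x\<parallel> \<le> c * \<parallel>x\<parallel>" using A by (rule bounded_op_bound) blast
  show ?thesis
  proof (rule bounded_opI)
    show "clinear_op sc (adj A)"
      unfolding clinear_op_def by (intro allI eq_if_ip_eq) (simp add: ip_adj_right[OF A] ip_simps)
    fix y
    have "\<parallel>adj A y\<parallel> * \<parallel>adj A y\<parallel> = Re (ip (A (adj A y)) y)"
      by (simp add: ip_adj_right[OF A, symmetric] hnorm_power2[symmetric] power2_eq_square)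
    also have "\<dots> \<le> (c * \<parallel>adj A y\<parallel>) * \<parallel>y\<parallel>"
      using Re_ip_le[of "A (adj A y)" y] mult_right_mono[OF c(2)[of "adj A y"], of "\<parallel>y\<parallel>"] by simp
    finally have "\<parallel>adj A y\<parallel> * \<parallel>adj A y\<parallel> \<le> \<parallel>adj A y\<parallel> * (c * \<parallel>y\<parallel>)" by (simp add: mult_ac)
    then show "\<parallel>adj A y\<parallel> \<le> c * \<parallel>y\<parallel>" using c(1) by (cases "adj A y = 0") (simp_all add: mult_le_cancel_left)
  qed
qed

lemma adj_adj: "bounded_op A \<Longrightarrow> adj (adj A) = A"
  by (rule adj_eqI) (simp_all add: bounded_op_adj is_adjoint_def ip_adj_left)

lemma commuting_adj:
  assumes A: "bounded_op A" and B: "bounded_op B" and "commuting A B"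
  shows "commuting (adj A) (adj B)"
  by (intro commutingI eq_if_ip_eq) (simp add: ip_adj_right[OF A] ip_adj_right[OF B] commutingD[OF \<open>commuting A B\<close>])

lemma perp_invariant:
  assumes "bounded_op A" "\<And>y. y \<in> K \<Longrightarrow> adj A y \<in> K" "x \<in> perp K"
  shows "A x \<in> perp K"
  using assms by (simp add: perp_def ip_adj_right[symmetric])

lemma commuting_proj:
  assumes K: "closed_subspace K" and A: "bounded_op A"
    and invariant: "\<And>x. x \<in> K \<Longrightarrow> A x \<in> K" "\<And>x. x \<in> K \<Longrightarrow> adj A x \<in> K"
  shows "commuting (proj K) A"
proof (intro commutingI proj_eqI K)
  fix x
  show "A (proj K x) \<in> K" by (intro invariant proj_in K)
  have "A (x - proj K x) \<in> perp K"
    by (rule perp_invariant[OF A invariant(2) diff_proj_in_perp[OF K]])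
  then show "A x - A (proj K x) \<in> perp K" by (simp add: bounded_op_map_diff[OF A])
qed

lemma bounded_op_proj: "closed_subspace K \<Longrightarrow> bounded_op (proj K)"
  by (intro bounded_op_contraction contraction_proj)

lemma is_adjoint_adj: "bounded_op A \<Longrightarrow> is_adjoint ip A (adj A)"
  by (simp add: is_adjoint_def ip_adj_right)

lemma normal_op_iff: "bounded_op A \<Longrightarrow> normal_op ip A \<longleftrightarrow> commuting A (adj A)"
  unfolding normal_op_def commuting_def using adj_eqI is_adjoint_adj by blast

lemma normal_op_if_self_adjoint: "is_adjoint ip A A \<Longrightarrow> normal_op ip A"
  by (auto simp: normal_op_def)

lemma hnorm_adj:
  assumes A: "bounded_op A" "normal_op ip A"
  shows "\<parallel>adj A x\<parallel> = \<parallel>A x\<parallel>"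
proof -
  have "commuting A (adj A)" using A by (simp add: normal_op_iff)
  then have "ip (adj A x) (adj A x) = ip (A x) (A x)"
    by (metis A(1) commutingD ip_adj_left ip_adj_right)
  then show ?thesis by (simp add: hnorm_def)
qed

lemma normal_op_adj: "bounded_op A \<Longrightarrow> normal_op ip A \<Longrightarrow> normal_op ip (adj A)"
  by (simp add: normal_op_iff bounded_op_adj adj_adj commuting_sym)

lemma adj_funpow:
  assumes A: "bounded_op A"
  shows "adj (A ^^ k) = adj A ^^ k"
proof (rule adj_eqI[OF bounded_op_funpow[OF A]])
  have "ip ((A ^^ k) x) y = ip x ((adj A ^^ k) y)" for x y
  proof (induction k arbitrary: y)
    case (Suc k)
    then show ?case by (simp flip: ip_adj_right[OF A] funpow_swap1)
  qed simp
  then show "is_adjoint ip (A ^^ k) (adj A ^^ k)" by (simp add: is_adjoint_def)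
qed

lemma normal_op_funpow:
  assumes A: "bounded_op A" "normal_op ip A"
  shows "normal_op ip (A ^^ k)"
proof -
  have "commuting A (adj A)" using A by (simp add: normal_op_iff)
  then have "commuting (A ^^ k) (adj A ^^ k)"
    by (intro commuting_funpow commuting_sym[OF commuting_funpow[OF commuting_sym]])
  then show ?thesis using A by (simp add: normal_op_iff bounded_op_funpow adj_funpow)
qed

definition shift :: "('h \<Rightarrow> 'h) \<Rightarrow> complex \<Rightarrow> 'h \<Rightarrow> 'h" where
  "shift A l x = A x - sc l x"

lemma bounded_op_shift: "bounded_op A \<Longrightarrow> bounded_op (shift A l)"
  unfolding shift_def[abs_def] by (intro bounded_op_intros)

lemma adj_shift:
  assumes A: "bounded_op A"
  shows "adj (shift A l) = shift (adj A) (cnj l)"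
  by (rule adj_eqI[OF bounded_op_shift[OF A]])
    (simp add: is_adjoint_def shift_def ip_simps ip_adj_right[OF A])

lemma commuting_shift:
  assumes D: "bounded_op D" and comm: "commuting D A"
  shows "commuting D (shift A l)"
  by (rule commutingI)
    (simp add: shift_def bounded_op_map_diff[OF D] bounded_op_map_scale[OF D] commutingD[OF comm])

lemma normal_op_shift:
  assumes A: "bounded_op A" "normal_op ip A"
  shows "normal_op ip (shift A l)"
proof -
  have "commuting (adj A) A" using A by (simp add: normal_op_iff commuting_def)
  then have "commuting (adj A) (shift A l)" by (rule commuting_shift[OF bounded_op_adj[OF A(1)]])
  then have "commuting (shift A l) (shift (adj A) (cnj l))"
    by (intro commuting_shift bounded_op_shift A) (rule commuting_sym)
  then show ?thesis using A(1) by (simp add: normal_op_iff bounded_op_shift adj_shift)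
qed

lemma shift_invariant: "closed_subspace K \<Longrightarrow> x \<in> K \<Longrightarrow> A x \<in> K \<Longrightarrow> shift A l x \<in> K"
  unfolding shift_def by (intro closed_subspace_diff closed_subspace_scale)

end

section \<open>Square roots\<close>

primrec sqrt_majorant :: "nat \<Rightarrow> real" where
  "sqrt_majorant 0 = 0"
| "sqrt_majorant (Suc k) = (1 + (sqrt_majorant k)\<^sup>2) / 2"

lemma sqrt_majorant_bounds: "0 \<le> sqrt_majorant k \<and> sqrt_majorant k \<le> 1"
proof (induction k)
  case (Suc k)
  then have "(sqrt_majorant k)\<^sup>2 \<le> 1" by (simp add: power_le_one)
  then show ?case by simp
qed simp

lemma incseq_sqrt_majorant: "incseq sqrt_majorant"
proof (rule incseq_SucI)
  show "sqrt_majorant k \<le> sqrt_majorant (Suc k)" for k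
  proof (induction k)
    case (Suc k)
    then have "(sqrt_majorant k)\<^sup>2 \<le> (sqrt_majorant (Suc k))\<^sup>2"
      by (intro power_mono) (simp_all add: sqrt_majorant_bounds del: sqrt_majorant.simps)
    then show ?case by simp
  qed simp
qed

context hilbert_space
begin

lemma contraction_hlim:
  assumes Y: "\<And>k. contraction sc ip (Y k)" and Z: "\<And>x. hlim (\<lambda>k. Y k x) (Z x)"
  shows "contraction sc ip Z"
proof -
  have "\<parallel>Z x\<parallel> \<le> \<parallel>x\<parallel>" for x
    by (rule LIMSEQ_le_const2[OF hlim_hnorm[OF Z]]) (auto simp: contraction_le[OF Y])
  moreover have "Z (sc a x + y) = sc a (Z x) + Z y" for a x y
  proof (rule hlim_unique[OF Z])
    show "hlim (\<lambda>k. Y k (sc a x + y)) (sc a (Z x) + Z y)"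
      using hlim_add[OF hlim_scale[OF Z] Z] Y by (simp add: contraction_def clinear_op_def)
  qed
  ultimately show ?thesis by (simp add: contraction_def clinear_op_def)
qed

lemma hlim_funpow2_contractions:
  assumes Y: "\<And>k. contraction sc ip (Y k)" and Z: "\<And>x. hlim (\<lambda>k. Y k x) (Z x)"
  shows "hlim (\<lambda>k. Y k (Y k x)) (Z (Z x))"
proof (rule hlim_sandwich)
  fix k
  have "\<parallel>Y k (Y k x) - Y k (Z x)\<parallel> \<le> \<parallel>Y k x - Z x\<parallel>"
    using contraction_le[OF Y, of k "Y k x - Z x"] by (simp add: bounded_op_map_diff[OF bounded_op_contraction[OF Y]])
  then show "\<parallel>Y k (Y k x) - Z (Z x)\<parallel> \<le> \<parallel>Y k x - Z x\<parallel> + \<parallel>Y k (Z x) - Z (Z x)\<parallel>"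
    using metric.triangle[of "Y k (Y k x)" "Y k (Z x)" "Z (Z x)"] by simp
next
  show "(\<lambda>k. \<parallel>Y k x - Z x\<parallel> + \<parallel>Y k (Z x) - Z (Z x)\<parallel>) \<longlonglongrightarrow> 0"
    using tendsto_add[OF Z[of x, unfolded hlim_iff] Z[of "Z x", unfolded hlim_iff]] by simp
qed

text \<open>The iteration \<open>Y \<mapsto> (X + Y\<^sup>2) / 2\<close> is dominated by the same iteration on scalars with \<open>X = 1\<close>,
  so it converges in operator norm; its limit \<open>Z\<close> satisfies \<open>(1 - Z)\<^sup>2 = 1 - X\<close>.\<close>

primrec sqrt_iter :: "('h \<Rightarrow> 'h) \<Rightarrow> nat \<Rightarrow> 'h \<Rightarrow> 'h" where
  "sqrt_iter X 0 x = 0"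
| "sqrt_iter X (Suc k) x = sc (1/2) (X x + sqrt_iter X k (sqrt_iter X k x))"

context
  fixes X :: "'h \<Rightarrow> 'h"
  assumes X: "contraction sc ip X"
begin

lemma bounded_op_sqrt_iter: "bounded_op (sqrt_iter X k)"
proof (induction k)
  case 0
  show ?case using bounded_op_scale[OF bounded_op_id, of 0] by (simp add: fun_eq_iff[symmetric])
next
  case (Suc k)
  have "bounded_op (\<lambda>x. sc (1/2) (X x + sqrt_iter X k (sqrt_iter X k x)))"
    by (intro bounded_op_scale bounded_op_add bounded_op_comp[OF Suc Suc] bounded_op_contraction X)
  then show ?case by simp
qed

lemma commuting_sqrt_iter:
  assumes D: "bounded_op D" "commuting D X"
  shows "commuting D (sqrt_iter X k)"
proof (induction k)
  case 0
  show ?case by (rule commutingI) (simp add: bounded_op_map_0[OF D(1)])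
next
  case (Suc k)
  show ?case
    by (rule commutingI)
      (simp add: bounded_op_map_scale[OF D(1)] bounded_op_map_add[OF D(1)] commutingD[OF D(2)] commutingD[OF Suc])
qed

lemma hnorm_sqrt_iter_le: "\<parallel>sqrt_iter X k x\<parallel> \<le> sqrt_majorant k * \<parallel>x\<parallel>"
proof (induction k arbitrary: x)
  case (Suc k)
  let ?Y = "sqrt_iter X k" and ?y = "sqrt_majorant k"
  have "\<parallel>sqrt_iter X (Suc k) x\<parallel> \<le> 1/2 * (\<parallel>X x\<parallel> + \<parallel>?Y (?Y x)\<parallel>)"
    using hnorm_triangle_ineq[of "X x" "?Y (?Y x)"] by (simp add: hnorm_scale)
  also have "\<parallel>?Y (?Y x)\<parallel> \<le> ?y * (?y * \<parallel>x\<parallel>)"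
    using Suc[of "?Y x"] mult_left_mono[OF Suc[of x], of ?y] sqrt_majorant_bounds[of k] by linarith
  finally show ?case using contraction_le[OF X, of x] by (simp add: power2_eq_square field_simps)
qed simp

lemma contraction_sqrt_iter: "contraction sc ip (sqrt_iter X k)"
proof -
  have "\<parallel>sqrt_iter X k x\<parallel> \<le> \<parallel>x\<parallel>" for x
    using hnorm_sqrt_iter_le[of k x] sqrt_majorant_bounds[of k]
      mult_right_mono[of "sqrt_majorant k" 1 "\<parallel>x\<parallel>"] by simp
  then show ?thesis using bounded_op_sqrt_iter by (simp add: contraction_def bounded_op_def)
qed

lemma hnorm_sqrt_iter_Suc_diff:
  "\<parallel>sqrt_iter X (Suc k) x - sqrt_iter X k x\<parallel> \<le> (sqrt_majorant (Suc k) - sqrt_majorant k) * \<parallel>x\<parallel>"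
proof (induction k arbitrary: x)
  case 0
  show ?case using contraction_le[OF X, of x] by (simp add: hnorm_scale)
next
  case (Suc k)
  define U V where "U = sqrt_iter X (Suc k)" and "V = sqrt_iter X k"
  define u v where "u = sqrt_majorant (Suc k)" and "v = sqrt_majorant k"
  note IH = Suc[folded U_def V_def u_def v_def]
  have "v \<le> u" unfolding u_def v_def using incseq_sqrt_majorant by (rule incseqD) simp
  have "0 \<le> v" using sqrt_majorant_bounds by (simp add: v_def)
  have U: "bounded_op U" and V: "bounded_op V" by (simp_all only: U_def V_def bounded_op_sqrt_iter)
  have "sqrt_iter X (Suc (Suc k)) x = sc (1/2) (X x + U (U x))" "U x = sc (1/2) (X x + V (V x))"
    by (simp_all add: U_def V_def)
  then have "sqrt_iter X (Suc (Suc k)) x - U x = sc (1/2) ((U (U x) - V (U x)) + V (U x - V x))"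
    by (simp add: bounded_op_map_diff[OF V] flip: scale_right_diff_distrib)
  then have "\<parallel>sqrt_iter X (Suc (Suc k)) x - U x\<parallel> \<le> 1/2 * (\<parallel>U (U x) - V (U x)\<parallel> + \<parallel>V (U x - V x)\<parallel>)"
    using hnorm_triangle_ineq by (simp add: hnorm_scale)
  also have "\<parallel>U (U x) - V (U x)\<parallel> \<le> (u - v) * (u * \<parallel>x\<parallel>)"
    using IH[of "U x"] mult_left_mono[OF hnorm_sqrt_iter_le[of "Suc k" x, folded U_def u_def], of "u - v"] \<open>v \<le> u\<close>
    by linarith
  also have "\<parallel>V (U x - V x)\<parallel> \<le> v * ((u - v) * \<parallel>x\<parallel>)"
    using hnorm_sqrt_iter_le[of k "U x - V x", folded V_def v_def] mult_left_mono[OF IH[of x] \<open>0 \<le> v\<close>] by linarith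
  also have "1/2 * ((u - v) * (u * \<parallel>x\<parallel>) + v * ((u - v) * \<parallel>x\<parallel>)) = (sqrt_majorant (Suc (Suc k)) - u) * \<parallel>x\<parallel>"
  proof -
    have "sqrt_majorant (Suc (Suc k)) = (1 + u\<^sup>2) / 2" "u = (1 + v\<^sup>2) / 2"
      unfolding u_def v_def by (rule sqrt_majorant.simps)+
    then have diff: "sqrt_majorant (Suc (Suc k)) - u = (u\<^sup>2 - v\<^sup>2) / 2" by argo
    show ?thesis unfolding diff by (simp add: power2_eq_square field_simps)
  qed
  finally show ?case by (simp add: U_def u_def del: sqrt_iter.simps sqrt_majorant.simps)
qed

lemma hnorm_sqrt_iter_diff:
  assumes "k \<le> m"
  shows "\<parallel>sqrt_iter X m x - sqrt_iter X k x\<parallel> \<le> (sqrt_majorant m - sqrt_majorant k) * \<parallel>x\<parallel>"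
  using assms
proof (induction m rule: dec_induct)
  case (step m)
  have "\<parallel>sqrt_iter X (Suc m) x - sqrt_iter X k x\<parallel>
      \<le> \<parallel>sqrt_iter X (Suc m) x - sqrt_iter X m x\<parallel> + \<parallel>sqrt_iter X m x - sqrt_iter X k x\<parallel>"
    using metric.triangle by blast
  with step.IH hnorm_sqrt_iter_Suc_diff[of m x] show ?case by (simp add: algebra_simps)
qed simp

lemma sqrt_iter_converges: "\<exists>L. hlim (\<lambda>k. sqrt_iter X k x) L"
proof -
  obtain l where l: "sqrt_majorant \<longlonglongrightarrow> l" "\<And>k. sqrt_majorant k \<le> l"
    using incseq_convergent[OF incseq_sqrt_majorant, of 1] sqrt_majorant_bounds by blast
  show ?thesis
  proof (rule Cauchy_dominated_hlim)
    have "\<parallel>sqrt_iter X m x - sqrt_iter X k x\<parallel> \<le> (l - sqrt_majorant k) * \<parallel>x\<parallel>" if "k \<le> m" for m k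
      using hnorm_sqrt_iter_diff[OF that, of x] mult_right_mono[OF l(2)[of m] hnorm_nonneg[of x]]
      by (simp add: left_diff_distrib)
    moreover have "0 \<le> (l - sqrt_majorant k) * \<parallel>x\<parallel>" for k using l(2) by simp
    ultimately show "\<parallel>sqrt_iter X m x - sqrt_iter X k x\<parallel> \<le> (l - sqrt_majorant m) * \<parallel>x\<parallel> + (l - sqrt_majorant k) * \<parallel>x\<parallel>" for m k
      by (cases "k \<le> m") (smt (verit) hnorm_minus_commute nle_le)+
    show "(\<lambda>k. (l - sqrt_majorant k) * \<parallel>x\<parallel>) \<longlonglongrightarrow> 0"
      using tendsto_mult_left_zero[OF tendsto_diff[OF tendsto_const l(1), of l, simplified]] by simp
  qed
qed

lemma sqrt_iter_limit:
  obtains Z where "contraction sc ip Z" "\<And>x. sc 2 (Z x) = X x + Z (Z x)"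
    and "\<And>D. bounded_op D \<Longrightarrow> commuting D X \<Longrightarrow> commuting D Z"
proof -
  obtain Z where Z: "\<And>x. hlim (\<lambda>k. sqrt_iter X k x) (Z x)"
    using sqrt_iter_converges by metis
  have "sc 2 (Z x) = X x + Z (Z x)" for x
  proof -
    have "hlim (\<lambda>k. sqrt_iter X (Suc k) x) (sc (1/2) (X x + Z (Z x)))"
      unfolding sqrt_iter.simps
      by (rule hlim_scale[OF hlim_add[OF hlim_const hlim_funpow2_contractions[OF contraction_sqrt_iter Z]]])
    then have "Z x = sc (1/2) (X x + Z (Z x))"
      using hlim_unique limitin_sequentially_offset[OF Z[of x], of 1] by simp
    then have "sc 2 (Z x) = sc 2 (sc (1/2) (X x + Z (Z x)))" by simp
    then show ?thesis by simp
  qed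
  moreover have "contraction sc ip Z" by (rule contraction_hlim[OF contraction_sqrt_iter Z])
  moreover have "commuting D Z" if D: "bounded_op D" "commuting D X" for D
  proof (rule commutingI)
    show "D (Z x) = Z (D x)" for x
      using hlim_bounded_op[OF D(1) Z[of x]] Z[of "D x"] commutingD[OF commuting_sqrt_iter[OF D]] hlim_unique
      by simp
  qed
  ultimately show thesis using that by blast
qed

lemma sqrt_one_minus_contraction_exists:
  obtains S where "bounded_op S" "\<And>x. S (S x) = x - X x" "\<And>x. 0 \<le> Re (ip (S x) x)"
    and "\<And>D. bounded_op D \<Longrightarrow> commuting D X \<Longrightarrow> commuting D S"
proof -
  obtain Z where Z: "contraction sc ip Z" "\<And>x. sc 2 (Z x) = X x + Z (Z x)"
    "\<And>D. bounded_op D \<Longrightarrow> commuting D X \<Longrightarrow> commuting D Z"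
    using sqrt_iter_limit by blast
  note bounded = bounded_op_contraction[OF Z(1)]
  define S where "S x = x - Z x" for x
  show thesis
  proof (rule that[of S])
    show "bounded_op S" unfolding S_def[abs_def] by (intro bounded_op_intros bounded)
    show "S (S x) = x - X x" for x
    proof -
      have "sc 2 (Z x) = Z x + Z x" using scale_left_distrib[of 1 1 "Z x"] by simp
      then show ?thesis using Z(2)[of x] by (simp add: S_def bounded_op_map_diff[OF bounded] algebra_simps)
    qed
    show "0 \<le> Re (ip (S x) x)" for x
      using Re_ip_le[of "Z x" x] mult_right_mono[OF contraction_le[OF Z(1), of x], of "\<parallel>x\<parallel>"]
      by (simp add: S_def ip_diff_left hnorm_power2[symmetric] power2_eq_square)
    show "commuting D S" if "bounded_op D" "commuting D X" for D
      using commutingD[OF Z(3)[OF that]] bounded_op_map_diff[OF that(1)]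
      by (intro commutingI) (simp add: S_def)
  qed
qed

end

lemma abs_self_adjoint_contraction_exists:
  assumes B: "contraction sc ip B" "is_adjoint ip B B"
  obtains S where "bounded_op S" "\<And>x. S (S x) = B (B x)" "\<And>x. 0 \<le> Re (ip (S x) x)"
    and "\<And>D. bounded_op D \<Longrightarrow> commuting D B \<Longrightarrow> commuting D S"
proof -
  note bounded = bounded_op_contraction[OF B(1)]
  define X where "X x = x - B (B x)" for x
  have "bounded_op X" unfolding X_def[abs_def] by (intro bounded_op_intros bounded_op_comp[OF bounded bounded])
  moreover have "\<parallel>X x\<parallel> \<le> \<parallel>x\<parallel>" for x
  proof (rule power2_le_imp_le)
    have "Re (ip x (B (B x))) = \<parallel>B x\<parallel>\<^sup>2"
      using B(2) by (simp add: hnorm_power2 is_adjoint_def)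
    then have "\<parallel>X x\<parallel>\<^sup>2 = \<parallel>x\<parallel>\<^sup>2 + \<parallel>B (B x)\<parallel>\<^sup>2 - 2 * \<parallel>B x\<parallel>\<^sup>2"
      by (simp add: X_def hnorm_diff_power2)
    moreover have "\<parallel>B (B x)\<parallel>\<^sup>2 \<le> \<parallel>B x\<parallel>\<^sup>2" by (intro power_mono contraction_le B) simp
    ultimately show "\<parallel>X x\<parallel>\<^sup>2 \<le> \<parallel>x\<parallel>\<^sup>2" using zero_le_power2[of "\<parallel>B x\<parallel>"] by linarith
  qed simp
  ultimately have X: "contraction sc ip X" by (simp add: contraction_def bounded_op_def)
  have "commuting D X" if "bounded_op D" "commuting D B" for D
    by (rule commutingI) (simp add: X_def bounded_op_map_diff[OF that(1)] commutingD[OF that(2)])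
  moreover have "x - X x = B (B x)" for x by (simp add: X_def)
  ultimately show thesis
    using sqrt_one_minus_contraction_exists[OF X] that by metis
qed

section \<open>Spectral subspaces of normal operators\<close>

definition disc_space :: "('h \<Rightarrow> 'h) \<Rightarrow> real \<Rightarrow> 'h set" where
  "disc_space A r = {x. \<forall>k. \<parallel>(A ^^ k) x\<parallel> \<le> r ^ k * \<parallel>x\<parallel>}"

lemma disc_spaceD: "x \<in> disc_space A r \<Longrightarrow> \<parallel>(A ^^ k) x\<parallel> \<le> r ^ k * \<parallel>x\<parallel>"
  by (simp add: disc_space_def)

lemma disc_space_hnorm_le: "x \<in> disc_space A r \<Longrightarrow> \<parallel>A x\<parallel> \<le> r * \<parallel>x\<parallel>"
  using disc_spaceD[of x A r 1] by simp

lemma hnorm_funpow_power2_le: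
  assumes A: "bounded_op A" "normal_op ip A"
  shows "\<parallel>(A ^^ k) x\<parallel>\<^sup>2 \<le> \<parallel>x\<parallel> * \<parallel>(A ^^ (k + k)) x\<parallel>"
proof -
  have Ak: "bounded_op (A ^^ k)" "normal_op ip (A ^^ k)"
    using A by (simp_all add: bounded_op_funpow normal_op_funpow)
  have "\<parallel>(A ^^ k) x\<parallel>\<^sup>2 = Re (ip x (adj (A ^^ k) ((A ^^ k) x)))"
    by (simp add: hnorm_power2 ip_adj_right[OF Ak(1)])
  also have "\<dots> \<le> \<parallel>x\<parallel> * \<parallel>adj (A ^^ k) ((A ^^ k) x)\<parallel>" by (rule Re_ip_le)
  finally show ?thesis by (simp add: hnorm_adj[OF Ak] funpow_add)
qed

text \<open>For normal \<open>A\<close> the bound \<open>\<parallel>A\<^sup>k x\<parallel>\<^sup>2 \<le> \<parallel>x\<parallel> \<parallel>A\<^sup>2\<^sup>k x\<parallel>\<close> improves the constant \<open>c\<close> to \<open>\<parallel>x\<parallel>\<close>.\<close>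

lemma disc_spaceI:
  assumes A: "bounded_op A" "normal_op ip A" and r: "r > 0"
    and c: "\<And>k. \<parallel>(A ^^ k) x\<parallel> \<le> c * r ^ k"
  shows "x \<in> disc_space A r"
proof -
  define a where "a k = \<parallel>(A ^^ k) x\<parallel> / r ^ k" for k
  define s where "s = (SUP k. a k)"
  have "bdd_above (range a)"
    using c r by (intro bdd_aboveI[of _ c]) (auto simp: a_def divide_le_eq)
  then have a_le: "a k \<le> s" for k unfolding s_def by (rule cSUP_upper[rotated]) simp
  have "0 \<le> a 0" by (simp add: a_def)
  then have "0 \<le> s" using a_le[of 0] by linarith
  have "a k \<le> sqrt (\<parallel>x\<parallel> * s)" for k
  proof (rule real_le_rsqrt)
    have "(a k)\<^sup>2 \<le> \<parallel>x\<parallel> * \<parallel>(A ^^ (k + k)) x\<parallel> / (r ^ k)\<^sup>2"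
      using r hnorm_funpow_power2_le[OF A, of k x] by (simp add: a_def power_divide divide_right_mono)
    also have "\<dots> = \<parallel>x\<parallel> * a (k + k)" by (simp add: a_def power_add power2_eq_square)
    also have "\<dots> \<le> \<parallel>x\<parallel> * s" by (intro mult_left_mono a_le) simp
    finally show "(a k)\<^sup>2 \<le> \<parallel>x\<parallel> * s" .
  qed
  then have "s \<le> sqrt (\<parallel>x\<parallel> * s)" unfolding s_def by (intro cSUP_least) auto
  then have "s\<^sup>2 \<le> \<parallel>x\<parallel> * s"
    using \<open>0 \<le> s\<close> power_mono[of s "sqrt (\<parallel>x\<parallel> * s)" 2] by simp
  then have "s \<le> \<parallel>x\<parallel>" using \<open>0 \<le> s\<close> by (cases "s = 0") (auto simp: power2_eq_square)
  then have "a k \<le> \<parallel>x\<parallel>" for k using a_le[of k] by linarith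
  then show ?thesis using r by (auto simp: disc_space_def a_def divide_le_eq mult.commute)
qed

lemma closed_subspace_disc_space:
  assumes A: "bounded_op A" "normal_op ip A" and r: "r > 0"
  shows "closed_subspace (disc_space A r)"
proof (rule closed_subspaceI)
  have Ak: "bounded_op (A ^^ k)" for k by (rule bounded_op_funpow[OF A(1)])
  show "0 \<in> disc_space A r" by (simp add: disc_space_def bounded_op_map_0[OF Ak])
  show "x + y \<in> disc_space A r" if "x \<in> disc_space A r" "y \<in> disc_space A r" for x y
  proof (rule disc_spaceI[OF A r])
    fix k
    have "\<parallel>(A ^^ k) (x + y)\<parallel> \<le> \<parallel>(A ^^ k) x\<parallel> + \<parallel>(A ^^ k) y\<parallel>"
      by (simp add: bounded_op_map_add[OF Ak] hnorm_triangle_ineq)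
    also have "\<dots> \<le> r ^ k * \<parallel>x\<parallel> + r ^ k * \<parallel>y\<parallel>" using that by (intro add_mono disc_spaceD)
    finally show "\<parallel>(A ^^ k) (x + y)\<parallel> \<le> (\<parallel>x\<parallel> + \<parallel>y\<parallel>) * r ^ k" by (simp add: algebra_simps)
  qed
  show "sc a x \<in> disc_space A r" if "x \<in> disc_space A r" for a x
    using mult_left_mono[OF disc_spaceD[OF that], of "cmod a"]
    by (simp add: disc_space_def bounded_op_map_scale[OF Ak] hnorm_scale mult.left_commute)
  show "L \<in> disc_space A r" if X: "\<And>k. X k \<in> disc_space A r" "hlim X L" for X L
    unfolding disc_space_def
  proof (intro CollectI allI)
    fix k
    show "\<parallel>(A ^^ k) L\<parallel> \<le> r ^ k * \<parallel>L\<parallel>"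
    proof (rule LIMSEQ_le)
      show "(\<lambda>i. \<parallel>(A ^^ k) (X i)\<parallel>) \<longlonglongrightarrow> \<parallel>(A ^^ k) L\<parallel>" by (rule hlim_hnorm[OF hlim_bounded_op[OF Ak X(2)]])
      show "(\<lambda>i. r ^ k * \<parallel>X i\<parallel>) \<longlonglongrightarrow> r ^ k * \<parallel>L\<parallel>" by (intro tendsto_intros hlim_hnorm X)
    qed (use disc_spaceD[OF X(1)] in blast)
  qed
qed

lemma disc_space_invariant:
  assumes A: "bounded_op A" "normal_op ip A" and r: "r > 0"
    and D: "bounded_op D" "commuting D A" and x: "x \<in> disc_space A r"
  shows "D x \<in> disc_space A r"
proof -
  obtain c where c: "c \<ge> 0" "\<And>x. \<parallel>D x\<parallel> \<le> c * \<parallel>x\<parallel>" using D(1) by (rule bounded_op_bound) blast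
  show ?thesis
  proof (rule disc_spaceI[OF A r])
    fix k
    have "\<parallel>(A ^^ k) (D x)\<parallel> \<le> c * \<parallel>(A ^^ k) x\<parallel>"
      using c(2)[of "(A ^^ k) x"] by (simp add: commutingD[OF commuting_funpow[OF D(2)]])
    also have "\<dots> \<le> c * (r ^ k * \<parallel>x\<parallel>)" by (intro mult_left_mono disc_spaceD x c)
    finally show "\<parallel>(A ^^ k) (D x)\<parallel> \<le> c * \<parallel>x\<parallel> * r ^ k" by (simp add: mult_ac)
  qed
qed

lemma disc_space_adj:
  assumes A: "bounded_op A" "normal_op ip A"
  shows "disc_space (adj A) r = disc_space A r"
proof -
  have "\<parallel>(adj A ^^ k) x\<parallel> = \<parallel>(A ^^ k) x\<parallel>" for k x
    using hnorm_adj[of "A ^^ k" x] A by (simp add: bounded_op_funpow normal_op_funpow adj_funpow)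
  then show ?thesis by (simp add: disc_space_def)
qed

text \<open>Since \<open>A\<close> and its adjoint have the same disc spaces, these reduce every operator commuting with \<open>A\<close>.
  This takes the place of Fuglede's theorem.\<close>

lemma disc_space_invariant_adj:
  assumes A: "bounded_op A" "normal_op ip A" and r: "r > 0"
    and D: "bounded_op D" "commuting D A" and x: "x \<in> disc_space A r"
  shows "adj D x \<in> disc_space A r"
  using disc_space_invariant[OF bounded_op_adj normal_op_adj r bounded_op_adj commuting_adj, of A D x] A D x
  by (simp add: disc_space_adj)

lemma commuting_proj_disc_space:
  assumes A: "bounded_op A" "normal_op ip A" and r: "r > 0" and D: "bounded_op D" "commuting D A"
  shows "commuting (proj (disc_space A r)) D"
  by (rule commuting_proj[OF closed_subspace_disc_space[OF A r] D(1)])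
    (auto intro: disc_space_invariant[OF A r D] disc_space_invariant_adj[OF A r D])

text \<open>The vector is \<open>(\<bar>B\<bar> + B) x\<close>, on which \<open>B\<close> and \<open>\<bar>B\<bar>\<close> agree.\<close>

lemma positive_vector_exists:
  assumes B: "contraction sc ip B" "is_adjoint ip B B" and K: "closed_subspace K" "\<And>x. x \<in> K \<Longrightarrow> B x \<in> K"
    and x: "x \<in> K" "0 < Re (ip (B x) x)"
  obtains y where "y \<in> K" "y \<noteq> 0"
    and "\<And>D. bounded_op D \<Longrightarrow> commuting D B \<Longrightarrow> 0 \<le> Re (ip (B (D y)) (D y))"
proof -
  note bounded = bounded_op_contraction[OF B(1)]
  obtain S where S: "bounded_op S" "\<And>x. S (S x) = B (B x)" "\<And>x. 0 \<le> Re (ip (S x) x)"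
    "\<And>D. bounded_op D \<Longrightarrow> commuting D B \<Longrightarrow> commuting D S"
    using abs_self_adjoint_contraction_exists[OF B] by blast
  have BS: "commuting B S" by (rule S(4)[OF bounded commuting_refl])
  have "commuting (proj K) B"
    using K adj_eqI[OF bounded B(2)] by (intro commuting_proj bounded) auto
  then have "commuting (proj K) S" by (rule S(4)[OF bounded_op_proj[OF K(1)]])
  then have "proj K (S x) = S x" using commutingD[of "proj K" S x] proj_self[OF K(1) x(1)] by simp
  then have "S x \<in> K" using proj_in[OF K(1), of "S x"] by simp
  define y where "y = S x + B x"
  have "y \<noteq> 0"
  proof
    assume "y = 0"
    then have "Re (ip (S x) x) + Re (ip (B x) x) = 0"
      by (metis ip_add_left ip_zero_left plus_complex.sel(1) y_def zero_complex.sel(1))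
    then show False using S(3)[of x] x(2) by linarith
  qed
  moreover have "y \<in> K" unfolding y_def by (intro closed_subspace_add K \<open>S x \<in> K\<close> x)
  moreover have "0 \<le> Re (ip (B (D y)) (D y))" if D: "bounded_op D" "commuting D B" for D
  proof -
    have "B y = S y"
      by (simp add: y_def bounded_op_map_add[OF bounded] bounded_op_map_add[OF S(1)] S(2) commutingD[OF BS] add.commute)
    then have "B (D y) = S (D y)"
      using commutingD[OF D(2), of y] commutingD[OF S(4)[OF D], of y] by simp
    then show ?thesis using S(3) by simp
  qed
  ultimately show thesis using that by blast
qed

definition gap_op :: "('h \<Rightarrow> 'h) \<Rightarrow> real \<Rightarrow> 'h \<Rightarrow> 'h" where
  "gap_op A r x = sc (of_real (r\<^sup>2)) x - adj A (A x)"

context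
  fixes A :: "'h \<Rightarrow> 'h" and r :: real
  assumes A: "bounded_op A"
begin

lemma bounded_op_gap_op: "bounded_op (gap_op A r)"
  unfolding gap_op_def[abs_def] by (intro bounded_op_intros bounded_op_comp[OF bounded_op_adj] A)

lemma is_adjoint_gap_op: "is_adjoint ip (gap_op A r) (gap_op A r)"
  by (simp add: is_adjoint_def gap_op_def ip_simps ip_adj_left[OF A] ip_adj_right[OF A])

lemma Re_ip_gap_op: "Re (ip (gap_op A r x) x) = (r * \<parallel>x\<parallel>)\<^sup>2 - \<parallel>A x\<parallel>\<^sup>2"
  by (simp add: gap_op_def ip_scale_left ip_diff_left ip_adj_left[OF A] hnorm_power2 power_mult_distrib)

lemma commuting_gap_op:
  assumes "normal_op ip A"
  shows "commuting A (gap_op A r)"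
proof (rule commutingI)
  have normal: "commuting A (adj A)" using assms A by (simp add: normal_op_iff)
  show "A (gap_op A r x) = gap_op A r (A x)" for x
    by (simp add: gap_op_def bounded_op_map_diff[OF A] bounded_op_map_scale[OF A] commutingD[OF normal])
qed

end

lemma scaled_contraction:
  assumes A: "bounded_op A"
  obtains \<kappa> :: real where "\<kappa> > 0" "contraction sc ip (\<lambda>x. sc (of_real \<kappa>) (A x))"
proof -
  obtain c where c: "c \<ge> 0" "\<And>x. \<parallel>A x\<parallel> \<le> c * \<parallel>x\<parallel>" using A by (rule bounded_op_bound) blast
  define \<kappa> where "\<kappa> = 1 / (c + 1)"
  have \<kappa>: "\<kappa> > 0" "\<kappa> * c \<le> 1" using c(1) by (simp_all add: \<kappa>_def)
  have "\<parallel>sc (of_real \<kappa>) (A x)\<parallel> \<le> \<parallel>x\<parallel>" for x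
  proof -
    have "\<parallel>sc (of_real \<kappa>) (A x)\<parallel> = \<kappa> * \<parallel>A x\<parallel>" using \<kappa>(1) by (simp add: hnorm_scale)
    also have "\<dots> \<le> \<kappa> * (c * \<parallel>x\<parallel>)" using \<kappa>(1) by (intro mult_left_mono c) simp
    also have "\<dots> \<le> 1 * \<parallel>x\<parallel>" unfolding mult.assoc[symmetric] by (intro mult_right_mono \<kappa>) simp
    finally show ?thesis by simp
  qed
  moreover have "bounded_op (\<lambda>x. sc (of_real \<kappa>) (A x))" by (rule bounded_op_scale[OF A])
  ultimately show thesis using that[OF \<kappa>(1)] by (simp add: contraction_def bounded_op_def)
qed

lemma disc_space_nontrivial:
  assumes A: "bounded_op A" "normal_op ip A" and r: "r > 0" and K: "closed_subspace K"
    and invariant: "\<And>x. x \<in> K \<Longrightarrow> A x \<in> K" "\<And>x. x \<in> K \<Longrightarrow> adj A x \<in> K"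
    and x: "x \<in> K" "\<parallel>A x\<parallel> < r * \<parallel>x\<parallel>"
  shows "\<exists>y\<in>K \<inter> disc_space A r. y \<noteq> 0"
proof -
  obtain \<kappa> :: real where \<kappa>: "\<kappa> > 0" "contraction sc ip (\<lambda>x. sc (of_real \<kappa>) (gap_op A r x))"
    using scaled_contraction[OF bounded_op_gap_op[OF A(1)]] by blast
  define B where "B x = sc (of_real \<kappa>) (gap_op A r x)" for x
  have B: "contraction sc ip B" "is_adjoint ip B B"
    using \<kappa>(2) is_adjoint_gap_op[OF A(1), of r] by (simp_all add: B_def[abs_def] is_adjoint_def ip_simps)
  have form: "Re (ip (B z) z) = \<kappa> * ((r * \<parallel>z\<parallel>)\<^sup>2 - \<parallel>A z\<parallel>\<^sup>2)" for z
    by (simp add: B_def ip_scale_left Re_ip_gap_op[OF A(1)])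
  have "\<parallel>A x\<parallel>\<^sup>2 < (r * \<parallel>x\<parallel>)\<^sup>2" using x(2) by (intro power_strict_mono) auto
  then have "0 < Re (ip (B x) x)" using \<kappa>(1) by (simp add: form)
  moreover have "B z \<in> K" if "z \<in> K" for z
    unfolding B_def gap_op_def by (intro closed_subspace_scale closed_subspace_diff K invariant that)
  ultimately obtain y where y: "y \<in> K" "y \<noteq> 0"
    "\<And>D. bounded_op D \<Longrightarrow> commuting D B \<Longrightarrow> 0 \<le> Re (ip (B (D y)) (D y))"
    using positive_vector_exists[OF B K _ x(1)] by blast
  have "commuting A B"
    by (rule commutingI)
      (simp add: B_def bounded_op_map_scale[OF A(1)] commutingD[OF commuting_gap_op[OF A]])
  then have comm: "commuting (A ^^ k) B" for k
    by (intro commuting_sym[OF commuting_funpow]) (rule commuting_sym)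
  have A_le: "\<parallel>A ((A ^^ k) y)\<parallel> \<le> r * \<parallel>(A ^^ k) y\<parallel>" for k
  proof (rule power2_le_imp_le)
    show "\<parallel>A ((A ^^ k) y)\<parallel>\<^sup>2 \<le> (r * \<parallel>(A ^^ k) y\<parallel>)\<^sup>2"
      using y(3)[OF bounded_op_funpow[OF A(1)] comm] \<kappa>(1) by (simp add: form zero_le_mult_iff)
  qed (use r in simp)
  have "\<parallel>(A ^^ k) y\<parallel> \<le> r ^ k * \<parallel>y\<parallel>" for k
  proof (induction k)
    case (Suc k)
    have "\<parallel>(A ^^ Suc k) y\<parallel> \<le> r * \<parallel>(A ^^ k) y\<parallel>" using A_le by simp
    also have "\<dots> \<le> r * (r ^ k * \<parallel>y\<parallel>)" using Suc r by (intro mult_left_mono) auto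
    finally show ?case by (simp add: mult.assoc)
  qed simp
  then show ?thesis using y by (auto simp: disc_space_def)
qed

section \<open>Approximate eigenvectors\<close>

text \<open>Expand \<open>\<langle>P (x - P x / c), x - P x / c\<rangle> \<ge> 0\<close>.\<close>

lemma hnorm_power2_le_of_positive_form:
  assumes P: "bounded_op P" "is_adjoint ip P P" and c: "c > 0" "\<And>x. \<parallel>P x\<parallel> \<le> c * \<parallel>x\<parallel>"
    and K: "closed_subspace K" "\<And>x. x \<in> K \<Longrightarrow> P x \<in> K" "\<And>x. x \<in> K \<Longrightarrow> 0 \<le> Re (ip (P x) x)"
    and x: "x \<in> K"
  shows "\<parallel>P x\<parallel>\<^sup>2 \<le> c * Re (ip (P x) x)"
proof -
  define t where "t = 1 / c"
  have t: "t > 0" "c * t = 1" using c(1) by (simp_all add: t_def)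
  have "Re (ip (P (P x)) x) = \<parallel>P x\<parallel>\<^sup>2" "Re (ip (P x) (P x)) = \<parallel>P x\<parallel>\<^sup>2"
    using P(2) by (simp_all add: is_adjoint_def hnorm_power2)
  then have "Re (ip (P (x - sc (of_real t) (P x))) (x - sc (of_real t) (P x)))
      = Re (ip (P x) x) - 2 * t * \<parallel>P x\<parallel>\<^sup>2 + t\<^sup>2 * Re (ip (P (P x)) (P x))"
    by (simp add: bounded_op_map_diff[OF P(1)] bounded_op_map_scale[OF P(1)] ip_simps power2_eq_square algebra_simps)
  moreover have "x - sc (of_real t) (P x) \<in> K" by (intro closed_subspace_diff closed_subspace_scale K x)
  ultimately have "0 \<le> Re (ip (P x) x) - 2 * t * \<parallel>P x\<parallel>\<^sup>2 + t\<^sup>2 * Re (ip (P (P x)) (P x))"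
    using K(3) by metis
  moreover have "t\<^sup>2 * Re (ip (P (P x)) (P x)) \<le> t * \<parallel>P x\<parallel>\<^sup>2"
  proof -
    have "Re (ip (P (P x)) (P x)) \<le> c * \<parallel>P x\<parallel>\<^sup>2"
      using Re_ip_le[of "P (P x)" "P x"] mult_right_mono[OF c(2)[of "P x"] hnorm_nonneg[of "P x"]]
      by (simp add: power2_eq_square mult.assoc)
    then have "t\<^sup>2 * Re (ip (P (P x)) (P x)) \<le> t\<^sup>2 * (c * \<parallel>P x\<parallel>\<^sup>2)" by (rule mult_left_mono) simp
    also have "\<dots> = t * (c * t) * \<parallel>P x\<parallel>\<^sup>2" by (simp add: power2_eq_square)
    finally show ?thesis by (simp add: t(2))
  qed
  ultimately have "t * \<parallel>P x\<parallel>\<^sup>2 \<le> Re (ip (P x) x)" by (simp add: algebra_simps)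
  then show ?thesis using c(1) by (simp add: t_def divide_le_eq mult.commute)
qed

lemma quadratic_form_supremum:
  assumes A: "contraction sc ip A" and K: "closed_subspace K" and x0: "x0 \<in> K" "x0 \<noteq> 0"
  obtains a :: real where "\<bar>a\<bar> \<le> 1" "\<And>x. x \<in> K \<Longrightarrow> Re (ip (A x) x) \<le> a * \<parallel>x\<parallel>\<^sup>2"
    and "\<And>d. d > 0 \<Longrightarrow> \<exists>x\<in>K. \<parallel>x\<parallel> = 1 \<and> a - d < Re (ip (A x) x)"
proof -
  define U where "U = {x \<in> K. \<parallel>x\<parallel> = 1}"
  define a where "a = (SUP x\<in>U. Re (ip (A x) x))"
  have normalize: "sc (of_real (1 / \<parallel>x\<parallel>)) x \<in> U" if "x \<in> K" "x \<noteq> 0" for x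
    unfolding U_def using that by (auto simp: hnorm_scale norm_divide intro!: closed_subspace_scale K)
  then have "U \<noteq> {}" using x0 by blast
  have abs_le: "\<bar>Re (ip (A x) x)\<bar> \<le> 1" if "x \<in> U" for x
    using abs_Re_le_cmod[of "ip (A x) x"] cauchy_schwarz[of "A x" x] contraction_le[OF A, of x] that
    by (simp add: U_def)
  then have bdd: "bdd_above ((\<lambda>x. Re (ip (A x) x)) ` U)" by (intro bdd_aboveI[of _ 1]) (auto simp: abs_le_iff)
  have le_a: "Re (ip (A x) x) \<le> a" if "x \<in> U" for x unfolding a_def by (rule cSUP_upper[OF that bdd])
  obtain u where "u \<in> U" using \<open>U \<noteq> {}\<close> by blast
  then have "- 1 \<le> a" using le_a[of u] abs_le[of u] by linarith
  moreover have "a \<le> 1" unfolding a_def using abs_le by (intro cSUP_least \<open>U \<noteq> {}\<close>) (simp add: abs_le_iff)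
  ultimately have "\<bar>a\<bar> \<le> 1" by simp
  moreover have "Re (ip (A x) x) \<le> a * \<parallel>x\<parallel>\<^sup>2" if "x \<in> K" for x
  proof (cases "x = 0")
    case False
    from le_a[OF normalize[OF that False]] False show ?thesis
      by (simp add: bounded_op_map_scale[OF bounded_op_contraction[OF A]] ip_simps power2_eq_square field_simps)
  qed simp
  moreover have "\<exists>x\<in>K. \<parallel>x\<parallel> = 1 \<and> a - d < Re (ip (A x) x)" if "d > 0" for d
    using less_cSUP_iff[OF \<open>U \<noteq> {}\<close> bdd, of "a - d", folded a_def] that by (auto simp: U_def)
  ultimately show thesis by (rule that)
qed

lemma approx_eigenvector_self_adjoint:
  assumes A: "contraction sc ip A" "is_adjoint ip A A"
    and K: "closed_subspace K" "\<And>x. x \<in> K \<Longrightarrow> A x \<in> K" and x0: "x0 \<in> K" "x0 \<noteq> 0" and e: "e > 0"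
  shows "\<exists>\<alpha>::real. \<exists>x\<in>K. \<parallel>shift A (of_real \<alpha>) x\<parallel> < e * \<parallel>x\<parallel>"
proof -
  obtain a :: real where a: "\<bar>a\<bar> \<le> 1" "\<And>x. x \<in> K \<Longrightarrow> Re (ip (A x) x) \<le> a * \<parallel>x\<parallel>\<^sup>2"
    and approx: "\<And>d. d > 0 \<Longrightarrow> \<exists>x\<in>K. \<parallel>x\<parallel> = 1 \<and> a - d < Re (ip (A x) x)"
    using quadratic_form_supremum[OF A(1) K(1) x0] by blast
  define P where "P x = sc (of_real a) x - A x" for x
  have P: "bounded_op P" "is_adjoint ip P P"
    unfolding P_def[abs_def] using A(2) bounded_op_intros bounded_op_contraction[OF A(1)]
    by (simp_all add: is_adjoint_def ip_simps)
  have "\<parallel>P x\<parallel> \<le> 2 * \<parallel>x\<parallel>" for x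
    using hnorm_triangle_ineq4[of "sc (of_real a) x" "A x"] contraction_le[OF A(1), of x]
      mult_right_mono[OF a(1) hnorm_nonneg[of x]] by (simp add: P_def hnorm_scale)
  moreover have "0 \<le> Re (ip (P x) x)" if "x \<in> K" for x
    using a(2)[OF that] by (simp add: P_def ip_simps hnorm_power2)
  moreover have "P x \<in> K" if "x \<in> K" for x
    unfolding P_def by (intro closed_subspace_diff closed_subspace_scale K that)
  ultimately have P_le: "\<parallel>P x\<parallel>\<^sup>2 \<le> 2 * Re (ip (P x) x)" if "x \<in> K" for x
    using that hnorm_power2_le_of_positive_form[OF P, of 2 K x] K(1) by auto
  obtain x where "x \<in> K" "\<parallel>x\<parallel> = 1" "a - e\<^sup>2 / 2 < Re (ip (A x) x)"
    using approx[of "e\<^sup>2 / 2"] e by auto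
  then have "Re (ip (P x) x) < e\<^sup>2 / 2" using hnorm_power2[of x] by (simp add: P_def ip_simps)
  then have "2 * Re (ip (P x) x) < e\<^sup>2" by simp
  then have "\<parallel>P x\<parallel>\<^sup>2 < e\<^sup>2" by (rule le_less_trans[OF P_le[OF \<open>x \<in> K\<close>]])
  then have "\<parallel>P x\<parallel> < e" by (rule power2_less_imp_less) (use e in simp)
  then have "\<parallel>shift A (of_real a) x\<parallel> < e * \<parallel>x\<parallel>"
    unfolding P_def shift_def hnorm_minus_commute[of "A x"] \<open>\<parallel>x\<parallel> = 1\<close> by simp
  then show ?thesis using \<open>x \<in> K\<close> by blast
qed

definition Re_op :: "('h \<Rightarrow> 'h) \<Rightarrow> 'h \<Rightarrow> 'h" where
  "Re_op N x = sc (1/2) (N x + adj N x)"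

definition Im_op :: "('h \<Rightarrow> 'h) \<Rightarrow> 'h \<Rightarrow> 'h" where
  "Im_op N x = sc (- \<i>/2) (N x - adj N x)"

lemma cartesian_decomposition: "N x = Re_op N x + sc \<i> (Im_op N x)"
proof -
  have "Re_op N x + sc \<i> (Im_op N x) = sc (1/2) (N x + adj N x) + sc (1/2) (N x - adj N x)"
    by (simp add: Re_op_def Im_op_def)
  also have "\<dots> = sc (1/2 + 1/2) (N x)"
    unfolding scale_left_distrib by (simp add: scale_right_distrib scale_right_diff_distrib)
  finally show ?thesis by simp
qed

lemma
  assumes N: "bounded_op N"
  shows is_adjoint_Re_op: "is_adjoint ip (Re_op N) (Re_op N)"
    and is_adjoint_Im_op: "is_adjoint ip (Im_op N) (Im_op N)"
  by (simp_all add: is_adjoint_def Re_op_def Im_op_def ip_simps ip_adj_left[OF N] ip_adj_right[OF N] algebra_simps)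

lemma
  assumes N: "contraction sc ip N" "normal_op ip N"
  shows contraction_Re_op: "contraction sc ip (Re_op N)"
    and contraction_Im_op: "contraction sc ip (Im_op N)"
proof -
  note bounded = bounded_op_contraction[OF N(1)]
  have "\<parallel>Re_op N x\<parallel> \<le> \<parallel>x\<parallel>" "\<parallel>Im_op N x\<parallel> \<le> \<parallel>x\<parallel>" for x
    using hnorm_triangle_ineq[of "N x" "adj N x"] hnorm_triangle_ineq4[of "N x" "adj N x"] contraction_le[OF N(1), of x]
    by (simp_all add: Re_op_def Im_op_def hnorm_scale hnorm_adj[OF bounded N(2)] norm_mult)
  moreover have "bounded_op (Re_op N)" "bounded_op (Im_op N)"
    unfolding Re_op_def[abs_def] Im_op_def[abs_def] by (intro bounded_op_intros bounded_op_adj bounded)+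
  ultimately show "contraction sc ip (Re_op N)" "contraction sc ip (Im_op N)"
    by (simp_all add: contraction_def bounded_op_def)
qed

lemma
  assumes "closed_subspace K" "x \<in> K" "N x \<in> K" "adj N x \<in> K"
  shows Re_op_invariant: "Re_op N x \<in> K" and Im_op_invariant: "Im_op N x \<in> K"
  unfolding Re_op_def Im_op_def
  by (intro closed_subspace_scale closed_subspace_add closed_subspace_diff assms)+

lemma commuting_Re_op_Im_op:
  assumes N: "bounded_op N" "normal_op ip N"
  shows "commuting (Im_op N) (Re_op N)"
proof (rule commutingI)
  have normal: "commuting N (adj N)" using N by (simp add: normal_op_iff)
  note maps = bounded_op_map_add bounded_op_map_diff bounded_op_map_scale
  show "Im_op N (Re_op N x) = Re_op N (Im_op N x)" for x
    by (simp add: Re_op_def Im_op_def maps[OF N(1)] maps[OF bounded_op_adj[OF N(1)]] commutingD[OF normal]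
        scale_right_distrib scale_right_diff_distrib)
qed

text \<open>An approximate eigenvector of the real part spans a spectral subspace on which the real part is almost scalar;
  there take one of the imaginary part.\<close>

lemma approx_eigenvector_normal:
  assumes N: "contraction sc ip N" "normal_op ip N" and K: "closed_subspace K"
    and invariant: "\<And>x. x \<in> K \<Longrightarrow> N x \<in> K" "\<And>x. x \<in> K \<Longrightarrow> adj N x \<in> K"
    and x0: "x0 \<in> K" "x0 \<noteq> 0" and e: "e > 0"
  shows "\<exists>l. \<exists>x\<in>K. \<parallel>shift N l x\<parallel> < e * \<parallel>x\<parallel>"
proof -
  note bounded = bounded_op_contraction[OF N(1)]
  note Re = contraction_Re_op[OF N] is_adjoint_Re_op[OF bounded]
  note Im = contraction_Im_op[OF N] is_adjoint_Im_op[OF bounded]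
  have half_e: "e / 2 > 0" using e by simp
  have Re_K: "Re_op N x \<in> K" and Im_K: "Im_op N x \<in> K" if "x \<in> K" for x
    by (auto intro: Re_op_invariant Im_op_invariant K invariant that)
  obtain \<alpha> :: real and y where y: "y \<in> K" "\<parallel>shift (Re_op N) (of_real \<alpha>) y\<parallel> < e / 2 * \<parallel>y\<parallel>"
    using approx_eigenvector_self_adjoint[OF Re K Re_K x0 half_e] by blast
  define A where "A = shift (Re_op N) (of_real \<alpha>)"
  have A: "bounded_op A" "normal_op ip A"
    using Re by (simp_all add: A_def bounded_op_shift normal_op_shift bounded_op_contraction normal_op_if_self_adjoint)
  have adj_A: "adj A = A"
    using Re by (simp add: A_def adj_shift bounded_op_contraction adj_eqI)
  have A_K: "A x \<in> K" if "x \<in> K" for x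
    unfolding A_def by (intro shift_invariant K Re_K that)
  define L where "L = K \<inter> disc_space A (e / 2)"
  have L: "closed_subspace L"
    unfolding L_def by (rule closed_subspace_Int[OF K closed_subspace_disc_space[OF A half_e]])
  have "\<exists>y\<in>L. y \<noteq> 0" unfolding L_def
    by (rule disc_space_nontrivial[OF A half_e K A_K _ y(1)]) (use adj_A A_K y(2)[folded A_def] in simp_all)
  then obtain z where z: "z \<in> L" "z \<noteq> 0" by blast
  have "commuting (Im_op N) A"
    unfolding A_def using Im N bounded by (intro commuting_shift commuting_Re_op_Im_op bounded_op_contraction)
  then have Im_L: "Im_op N x \<in> L" if "x \<in> L" for x
    using that Im_K disc_space_invariant[OF A half_e bounded_op_contraction[OF Im(1)]] by (simp add: L_def)
  obtain \<beta> :: real and x where x: "x \<in> L" "\<parallel>shift (Im_op N) (of_real \<beta>) x\<parallel> < e / 2 * \<parallel>x\<parallel>"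
    using approx_eigenvector_self_adjoint[OF Im L Im_L z half_e] by blast
  have "shift N (of_real \<alpha> + \<i> * of_real \<beta>) x = A x + sc \<i> (shift (Im_op N) (of_real \<beta>) x)"
    by (subst shift_def, subst cartesian_decomposition)
      (simp add: A_def shift_def scale_left_distrib scale_right_diff_distrib)
  then have "\<parallel>shift N (of_real \<alpha> + \<i> * of_real \<beta>) x\<parallel> \<le> \<parallel>A x\<parallel> + \<parallel>shift (Im_op N) (of_real \<beta>) x\<parallel>"
    using hnorm_triangle_ineq[of "A x" "sc \<i> (shift (Im_op N) (of_real \<beta>) x)"] by (simp add: hnorm_scale)
  also have "\<dots> < e / 2 * \<parallel>x\<parallel> + e / 2 * \<parallel>x\<parallel>"
    using x disc_space_hnorm_le[of x A "e / 2"] by (intro add_le_less_mono) (simp_all add: L_def)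
  finally show ?thesis using x(1) by (auto simp: L_def)
qed

lemma disc_spaces_total:
  assumes N: "contraction sc ip N" "normal_op ip N" and r: "r > 0" and dense: "closure \<Lambda> = UNIV"
    and x: "x \<in> perp (\<Union>l\<in>\<Lambda>. disc_space (shift N l) r)"
  shows "x = 0"
proof (rule ccontr)
  assume "x \<noteq> 0"
  note bounded = bounded_op_contraction[OF N(1)]
  have comm: "commuting N (shift N l)" for l by (rule commuting_shift[OF bounded commuting_refl])
  have shift: "bounded_op (shift N l)" "normal_op ip (shift N l)" for l
    by (simp_all add: bounded_op_shift normal_op_shift bounded N(2))
  define D where "D = (\<Union>l\<in>\<Lambda>. disc_space (shift N l) r)"
  have D: "N y \<in> D" "adj N y \<in> D" if "y \<in> D" for y
    using that disc_space_invariant[OF shift r bounded comm] disc_space_invariant_adj[OF shift r bounded comm]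
    unfolding D_def by blast+
  define K where "K = perp D"
  have K: "closed_subspace K" unfolding K_def by (rule closed_subspace_perp)
  have invariant: "N z \<in> K" "adj N z \<in> K" if "z \<in> K" for z
    using that D perp_invariant[OF bounded, of D z] perp_invariant[OF bounded_op_adj[OF bounded], of D z]
    by (auto simp: K_def adj_adj[OF bounded])
  obtain l z where z: "z \<in> K" "\<parallel>shift N l z\<parallel> < r / 2 * \<parallel>z\<parallel>"
    using approx_eigenvector_normal[OF N K invariant x[folded D_def K_def] \<open>x \<noteq> 0\<close>, of "r / 2"] r by auto
  obtain l' where l': "l' \<in> \<Lambda>" "cmod (l - l') < r / 2"
    using dense closure_approachable[of l \<Lambda>] r by (metis UNIV_I dist_norm half_gt_zero norm_minus_commute)
  have "shift N l' z = shift N l z + sc (l - l') z" by (simp add: shift_def scale_left_diff_distrib)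
  then have "\<parallel>shift N l' z\<parallel> \<le> \<parallel>shift N l z\<parallel> + cmod (l - l') * \<parallel>z\<parallel>"
    using hnorm_triangle_ineq[of "shift N l z" "sc (l - l') z"] by (simp add: hnorm_scale)
  also have "\<dots> < r / 2 * \<parallel>z\<parallel> + r / 2 * \<parallel>z\<parallel>"
    using z l' by (intro add_less_le_mono mult_right_mono) auto
  finally have "\<parallel>shift N l' z\<parallel> < r * \<parallel>z\<parallel>" by simp
  then obtain y where "y \<in> K" "y \<in> disc_space (shift N l') r" "y \<noteq> 0"
    using disc_space_nontrivial[OF shift r K _ _ z(1), of l'] invariant
    by (auto simp: adj_shift[OF bounded] intro: shift_invariant[OF K])
  then show False using l'(1) Int_perp_eq_0[of y D] by (auto simp: K_def D_def)
qed

section \<open>Spectral projections of a commuting family\<close>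

lemma hnorm_ge_on_perp_disc_space:
  assumes H: "bounded_op H" "normal_op ip H" and s: "s > 0" and z: "z \<in> perp (disc_space H s)"
  shows "s * \<parallel>z\<parallel> \<le> \<parallel>H z\<parallel>"
proof (rule ccontr)
  let ?K = "disc_space H s"
  assume less: "\<not> s * \<parallel>z\<parallel> \<le> \<parallel>H z\<parallel>"
  have invariant: "H y \<in> ?K" "adj H y \<in> ?K" if "y \<in> ?K" for y
    using disc_space_invariant[OF H s H(1) commuting_refl that]
      disc_space_invariant_adj[OF H s H(1) commuting_refl that] .
  have "\<exists>y\<in>perp ?K \<inter> ?K. y \<noteq> 0"
  proof (rule disc_space_nontrivial[OF H s closed_subspace_perp _ _ z])
    show "H x \<in> perp ?K" if "x \<in> perp ?K" for x
      by (rule perp_invariant[OF H(1) invariant(2) that])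
    show "adj H x \<in> perp ?K" if "x \<in> perp ?K" for x
      by (rule perp_invariant[OF bounded_op_adj[OF H(1)] _ that]) (simp add: adj_adj[OF H(1)] invariant(1))
  qed (use less in simp)
  then show False using Int_perp_eq_0 by blast
qed

definition commutator :: "('h \<Rightarrow> 'h) \<Rightarrow> ('h \<Rightarrow> 'h) \<Rightarrow> 'h \<Rightarrow> 'h" where
  "commutator A B x = A (B x) - B (A x)"

lemma hnorm_commutator_swap: "\<parallel>commutator A B x\<parallel> = \<parallel>commutator B A x\<parallel>"
  by (simp add: commutator_def hnorm_minus_commute)

lemma bounded_op_commutator: "bounded_op A \<Longrightarrow> bounded_op B \<Longrightarrow> bounded_op (commutator A B)"
  unfolding commutator_def[abs_def] by (simp add: bounded_op_diff bounded_op_comp)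

lemma adj_commutator:
  assumes A: "bounded_op A" and B: "bounded_op B"
  shows "adj (commutator A B) = commutator (adj B) (adj A)"
  by (rule adj_eqI[OF bounded_op_commutator[OF A B]])
    (simp add: is_adjoint_def commutator_def ip_simps ip_adj_right[OF A] ip_adj_right[OF B])

lemma commuting_commutator:
  assumes "bounded_op Q" "commuting Q A" "commuting Q B"
  shows "commuting Q (commutator A B)"
  by (rule commutingI)
    (simp add: commutator_def bounded_op_map_diff[OF assms(1)] commutingD[OF assms(2)] commutingD[OF assms(3)])

lemma hnorm_commutator_le:
  assumes E: "contraction sc ip E" and r: "r \<ge> 0"
    and y: "y \<in> disc_space (shift N l) r" "E y \<in> disc_space (shift N l) r"
  shows "\<parallel>commutator E N y\<parallel> \<le> 2 * r * \<parallel>y\<parallel>"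
proof -
  note bounded = bounded_op_contraction[OF E]
  have "commutator E N y = E (shift N l y) - shift N l (E y)"
    by (simp add: commutator_def shift_def bounded_op_map_diff[OF bounded] bounded_op_map_scale[OF bounded])
  then have "\<parallel>commutator E N y\<parallel> \<le> \<parallel>E (shift N l y)\<parallel> + \<parallel>shift N l (E y)\<parallel>"
    using hnorm_triangle_ineq4 by simp
  also have "\<parallel>E (shift N l y)\<parallel> \<le> r * \<parallel>y\<parallel>"
    using contraction_le[OF E] disc_space_hnorm_le[OF y(1)] by (rule order_trans)
  also have "\<parallel>shift N l (E y)\<parallel> \<le> r * \<parallel>y\<parallel>"
    using disc_space_hnorm_le[OF y(2)] mult_left_mono[OF contraction_le[OF E] r] by (rule order_trans)
  finally show ?thesis by simp
qed

lemma hnorm_commutator_square_le: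
  assumes N: "bounded_op N" "normal_op ip N" and r: "r > 0"
    and E: "contraction sc ip E" "is_adjoint ip E E" "commuting (proj (disc_space (shift N l) r)) E"
    and z: "z \<in> disc_space (shift N l) r"
  shows "\<parallel>adj (commutator E N) (commutator E N z)\<parallel> \<le> (2 * r)\<^sup>2 * \<parallel>z\<parallel>"
proof -
  define K where "K = disc_space (shift N l) r"
  have shift: "bounded_op (shift N l)" "normal_op ip (shift N l)"
    using N by (simp_all add: bounded_op_shift normal_op_shift)
  have K: "closed_subspace K" unfolding K_def by (rule closed_subspace_disc_space[OF shift r])
  have K_adj: "K = disc_space (shift (adj N) (cnj l)) r"
    unfolding K_def adj_shift[OF N(1), symmetric] by (rule disc_space_adj[OF shift, symmetric])
  note bounded = bounded_op_contraction[OF E(1)]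
  have "commuting (proj K) N"
    unfolding K_def
    by (rule commuting_proj_disc_space[OF shift r N(1) commuting_shift[OF N(1) commuting_refl]])
  then have "commuting (proj K) (commutator E N)"
    by (intro commuting_commutator bounded_op_proj K E(3)[folded K_def])
  moreover have in_K: "D w \<in> K" if "commuting (proj K) D" "w \<in> K" for D w
    using commutingD[OF that(1), of w] proj_in[OF K, of "D w"] proj_self[OF K that(2)] by simp
  ultimately have "commutator E N z \<in> K" using z by (simp add: K_def)
  moreover have E_K: "E w \<in> K" if "w \<in> K" for w
    using in_K[OF E(3)[folded K_def] that] .
  ultimately have "\<parallel>commutator E (adj N) (commutator E N z)\<parallel> \<le> 2 * r * \<parallel>commutator E N z\<parallel>"
    using hnorm_commutator_le[OF E(1), of r _ "adj N" "cnj l"] r by (simp flip: K_adj)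
  also have "\<dots> \<le> 2 * r * (2 * r * \<parallel>z\<parallel>)"
    using hnorm_commutator_le[OF E(1), of r z N l] E_K[of z] r z by (intro mult_left_mono) (simp_all flip: K_def)
  finally show ?thesis
    by (simp add: adj_commutator[OF bounded N(1)] adj_eqI[OF bounded E(2)] hnorm_commutator_swap[of "adj N"]
        power2_eq_square mult_ac)
qed

lemma commuting_commutator_square:
  assumes Q: "bounded_op Q" "is_adjoint ip Q Q" and E: "bounded_op E" "commuting Q E" and N: "bounded_op N" "commuting Q N"
  shows "commuting Q (\<lambda>x. adj (commutator E N) (commutator E N x))"
proof -
  have comm: "commuting Q (commutator E N)" by (intro commuting_commutator Q E N)
  have "commuting Q (adj (commutator E N))"
    using commuting_adj[OF Q(1) bounded_op_commutator[OF E(1) N(1)] comm] by (simp add: adj_eqI[OF Q])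
  from commuting_comp[OF this comm] show ?thesis .
qed

text \<open>The discs around the points of \<open>\<Lambda>\<close> cut \<open>D\<^sup>* D\<close>, where \<open>D = E N - N E\<close>, into pieces of norm at most
  \<open>(2 r)\<^sup>2\<close>, so that no spectral subspace of \<open>D\<^sup>* D\<close> beyond \<open>s\<close> can be nonzero.\<close>

lemma disc_space_commutator_square_eq_UNIV:
  fixes E N :: "'h \<Rightarrow> 'h"
  defines "H \<equiv> \<lambda>x. adj (commutator E N) (commutator E N x)"
  assumes N: "contraction sc ip N" "normal_op ip N" and dense: "closure \<Lambda> = UNIV"
    and E: "contraction sc ip E" "is_adjoint ip E E" and r: "r > 0" "(2 * r)\<^sup>2 < s"
    and comm: "\<And>l. l \<in> \<Lambda> \<Longrightarrow> commuting (proj (disc_space (shift N l) r)) E"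
  shows "disc_space H s = UNIV"
proof -
  note N_bounded = bounded_op_contraction[OF N(1)] and E_bounded = bounded_op_contraction[OF E(1)]
  define D where "D = commutator E N"
  have D: "bounded_op D" unfolding D_def by (rule bounded_op_commutator[OF E_bounded N_bounded])
  have H: "bounded_op H" "normal_op ip H"
    unfolding H_def D_def[symmetric]
    by (simp_all add: bounded_op_comp bounded_op_adj D normal_op_if_self_adjoint is_adjoint_def ip_adj_left ip_adj_right)
  have s: "s > 0" using r(2) zero_le_power2[of "2 * r"] by linarith
  show ?thesis
  proof (rule closed_subspace_eq_UNIV[OF closed_subspace_disc_space[OF H s]])
    fix x assume x: "x \<in> perp (disc_space H s)"
    have "ip x y = 0" if l: "l \<in> \<Lambda>" and y: "y \<in> disc_space (shift N l) r" for l y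
    proof -
      define K where "K = disc_space (shift N l) r"
      have shift: "bounded_op (shift N l)" "normal_op ip (shift N l)"
        by (simp_all add: bounded_op_shift normal_op_shift N(2) N_bounded)
      have K: "closed_subspace K" unfolding K_def by (rule closed_subspace_disc_space[OF shift r(1)])
      note Q = bounded_op_proj[OF K] is_adjoint_proj[OF K]
      have "commuting (proj K) N"
        unfolding K_def
        by (rule commuting_proj_disc_space[OF shift r(1) N_bounded commuting_shift[OF N_bounded commuting_refl]])
      then have "commuting (proj K) H"
        unfolding H_def by (intro commuting_commutator_square Q E_bounded N_bounded comm[OF l, folded K_def])
      then have "proj K x \<in> perp (disc_space H s)"
        using disc_space_invariant[OF H s Q(1)]
        by (intro perp_invariant[OF Q(1) _ x]) (simp add: adj_eqI[OF Q])
      then have "s * \<parallel>proj K x\<parallel> \<le> \<parallel>H (proj K x)\<parallel>" by (rule hnorm_ge_on_perp_disc_space[OF H s])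
      also have "\<dots> \<le> (2 * r)\<^sup>2 * \<parallel>proj K x\<parallel>"
        unfolding H_def
        by (rule hnorm_commutator_square_le[OF N_bounded N(2) r(1) E comm[OF l]]) (use proj_in[OF K] in \<open>simp add: K_def\<close>)
      finally have "proj K x = 0" using r(2) by (simp add: mult_le_cancel_right)
      moreover have "ip x y = ip (proj K x) y"
        using Q(2) proj_self[OF K, of y] y by (simp add: is_adjoint_def K_def)
      ultimately show ?thesis by simp
    qed
    then show "x = 0"
      by (intro disc_spaces_total[OF N r(1) dense]) (auto simp: perp_def)
  qed
qed

lemma commuting_if_commuting_disc_projections:
  assumes N: "contraction sc ip N" "normal_op ip N" and dense: "closure \<Lambda> = UNIV"
    and E: "contraction sc ip E" "is_adjoint ip E E"
    and comm: "\<And>l p. l \<in> \<Lambda> \<Longrightarrow> commuting (proj (disc_space (shift N l) (1 / real (Suc p)))) E"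
  shows "commuting E N"
proof (rule commutingI)
  fix x
  define D where "D = commutator E N"
  have D: "bounded_op D"
    unfolding D_def by (intro bounded_op_commutator bounded_op_contraction E N)
  have "\<parallel>adj D (D x)\<parallel> \<le> 5 * (1 / real (Suc p))\<^sup>2 * \<parallel>x\<parallel>" for p
  proof -
    define r where "r = 1 / real (Suc p)"
    have r: "r > 0" by (simp add: r_def)
    then have "(2 * r)\<^sup>2 < 5 * r\<^sup>2" by (simp add: power_mult_distrib)
    then have "disc_space (\<lambda>x. adj D (D x)) (5 * r\<^sup>2) = UNIV"
      unfolding D_def by (rule disc_space_commutator_square_eq_UNIV[OF N dense E r _ comm[of _ p, folded r_def]])
    then show ?thesis using disc_space_hnorm_le[of x "\<lambda>x. adj D (D x)"] by (simp add: r_def)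
  qed
  moreover have "(\<lambda>p. 5 * (1 / real (Suc p))\<^sup>2 * \<parallel>x\<parallel>) \<longlonglongrightarrow> 5 * 0\<^sup>2 * \<parallel>x\<parallel>"
    by (intro tendsto_intros LIMSEQ_Suc[OF lim_1_over_n])
  ultimately have "\<parallel>adj D (D x)\<parallel> \<le> 5 * 0\<^sup>2 * \<parallel>x\<parallel>" by (meson LIMSEQ_le_const)
  then have "adj D (D x) = 0" using hnorm_nonneg[of "adj D (D x)"] hnorm_eq_0_iff[of "adj D (D x)"] by simp
  then have "ip (D x) (D x) = 0" using ip_adj_right[OF D, of x "D x"] by simp
  from ip_self_eq_0D[OF this] show "E (N x) = N (E x)" by (simp add: D_def commutator_def)
qed

end

locale commuting_projections = hilbert_space sc ip
  for sc :: "complex \<Rightarrow> 'h::ab_group_add \<Rightarrow> 'h" and ip :: "'h \<Rightarrow> 'h \<Rightarrow> complex" +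
  fixes P :: "nat \<Rightarrow> 'h \<Rightarrow> 'h"
  assumes contraction_P: "contraction sc ip (P k)"
    and is_adjoint_P: "is_adjoint ip (P k) (P k)"
    and P_idem: "P k (P k x) = P k x"
    and commuting_P: "commuting (P k) (P l)"

context hilbert_space
begin

lemma commuting_projections_from_nat_into:
  assumes \<K>: "countable \<K>" "\<K> \<noteq> {}" "\<And>K. K \<in> \<K> \<Longrightarrow> closed_subspace K"
    and comm: "\<And>K L. K \<in> \<K> \<Longrightarrow> L \<in> \<K> \<Longrightarrow> commuting (proj K) (proj L)"
  shows "commuting_projections sc ip (\<lambda>k. proj (from_nat_into \<K> k))"
proof unfold_locales
  fix k l x
  have K: "from_nat_into \<K> k \<in> \<K>" for k using \<K>(2) by (rule from_nat_into)
  note closed = \<K>(3)[OF K]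
  show "contraction sc ip (proj (from_nat_into \<K> k))" "is_adjoint ip (proj (from_nat_into \<K> k)) (proj (from_nat_into \<K> k))"
    "proj (from_nat_into \<K> k) (proj (from_nat_into \<K> k) x) = proj (from_nat_into \<K> k) x"
    using contraction_proj is_adjoint_proj proj_self proj_in closed by blast+
  show "commuting (proj (from_nat_into \<K> k)) (proj (from_nat_into \<K> l))" by (intro comm K)
qed

text \<open>The whole space is included only to make the family nonempty.\<close>

definition disc_spaces :: "('i \<Rightarrow> 'h \<Rightarrow> 'h) \<Rightarrow> 'i set \<Rightarrow> complex set \<Rightarrow> 'h set set" where
  "disc_spaces N I \<Lambda> = insert UNIV ((\<lambda>(i, l, p). disc_space (shift (N i) l) (1 / real (Suc p))) ` (I \<times> \<Lambda> \<times> UNIV))"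

lemma countable_disc_spaces: "countable I \<Longrightarrow> countable \<Lambda> \<Longrightarrow> countable (disc_spaces N I \<Lambda>)"
  unfolding disc_spaces_def by (intro countable_insert countable_image countable_SIGMA) auto

lemma disc_spaces_cases [consumes 1, case_names UNIV disc]:
  assumes "K \<in> disc_spaces N I \<Lambda>"
  obtains "K = UNIV" | i l r where "i \<in> I" "l \<in> \<Lambda>" "r > 0" "K = disc_space (shift (N i) l) r"
proof -
  from assms consider "K = UNIV" | i l p where "i \<in> I" "l \<in> \<Lambda>" "K = disc_space (shift (N i) l) (1 / real (Suc p))"
    by (auto simp: disc_spaces_def)
  then show thesis
  proof cases
    case 2
    from that(2)[OF this(1,2) _ this(3)] show ?thesis by simp
  qed (rule that(1))
qed

lemma closed_subspace_UNIV: "closed_subspace UNIV"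
  by (simp add: closed_subspace_def)

lemma
  assumes N: "\<And>i. i \<in> I \<Longrightarrow> bounded_op (N i)" "\<And>i. i \<in> I \<Longrightarrow> normal_op ip (N i)" and K: "K \<in> disc_spaces N I \<Lambda>"
  shows closed_subspace_disc_spaces: "closed_subspace K"
    and commuting_proj_disc_spaces: "bounded_op D \<Longrightarrow> (\<And>i. i \<in> I \<Longrightarrow> commuting D (N i)) \<Longrightarrow> commuting (proj K) D"
proof -
  have shift: "bounded_op (shift (N i) l)" "normal_op ip (shift (N i) l)" if "i \<in> I" for i l
    using that by (simp_all add: bounded_op_shift normal_op_shift N)
  show "closed_subspace K"
    using K by (cases rule: disc_spaces_cases) (auto intro: closed_subspace_UNIV closed_subspace_disc_space shift)
  assume D: "bounded_op D" "\<And>i. i \<in> I \<Longrightarrow> commuting D (N i)"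
  from K show "commuting (proj K) D"
  proof (cases rule: disc_spaces_cases)
    case UNIV
    then show ?thesis using proj_self[OF closed_subspace_UNIV] by (intro commutingI) simp
  next
    case (disc i l r)
    show ?thesis
      unfolding disc(4) by (rule commuting_proj_disc_space[OF shift[OF disc(1)] disc(3) D(1) commuting_shift[OF D(1) D(2)[OF disc(1)]]])
  qed
qed

lemma spectral_projections_exist:
  fixes N :: "'i \<Rightarrow> 'h \<Rightarrow> 'h" and I :: "'i set"
  assumes I: "countable I" and N: "\<And>i. i \<in> I \<Longrightarrow> contraction sc ip (N i)" "\<And>i. i \<in> I \<Longrightarrow> normal_op ip (N i)"
    and comm: "\<And>i j. i \<in> I \<Longrightarrow> j \<in> I \<Longrightarrow> commuting (N i) (N j)"
  obtains P where "commuting_projections sc ip P" "\<And>i k. i \<in> I \<Longrightarrow> commuting (N i) (P k)"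
    and "\<And>i E. i \<in> I \<Longrightarrow> contraction sc ip E \<Longrightarrow> is_adjoint ip E E \<Longrightarrow> (\<And>k. commuting (P k) E) \<Longrightarrow> commuting E (N i)"
proof -
  obtain \<Lambda> :: "complex set" where \<Lambda>: "countable \<Lambda>" "closure \<Lambda> = UNIV"
    using separable[of "UNIV :: complex set"] by (metis UNIV_eq_I subsetD UNIV_I)
  define \<K> where "\<K> = disc_spaces N I \<Lambda>"
  define P where "P k = proj (from_nat_into \<K> k)" for k
  have "countable \<K>" unfolding \<K>_def by (intro countable_disc_spaces I \<Lambda>)
  have "\<K> \<noteq> {}" by (simp add: \<K>_def disc_spaces_def)
  have range: "range (from_nat_into \<K>) = \<K>" by (intro range_from_nat_into) fact+
  have bounded: "bounded_op (N i)" if "i \<in> I" for i by (rule bounded_op_contraction[OF N(1)[OF that]])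
  have closed: "closed_subspace K" if "K \<in> \<K>" for K
    by (rule closed_subspace_disc_spaces[OF bounded N(2) that[unfolded \<K>_def]])
  have reducing: "commuting (proj K) D" if "K \<in> \<K>" "bounded_op D" "\<And>i. i \<in> I \<Longrightarrow> commuting D (N i)" for K D
    by (rule commuting_proj_disc_spaces[OF bounded N(2) that(1)[unfolded \<K>_def] that(2,3)])
  have N_\<K>: "commuting (proj K) (N i)" if "i \<in> I" "K \<in> \<K>" for i K
    by (rule reducing[OF that(2) bounded[OF that(1)] comm[OF that(1)]])
  have proj_commuting: "commuting (proj K) (proj L)" if "K \<in> \<K>" "L \<in> \<K>" for K L
    by (rule reducing[OF that(1) bounded_op_proj[OF closed[OF that(2)]] N_\<K>[OF _ that(2)]])
  have "commuting_projections sc ip P"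
    unfolding P_def[abs_def]
    by (rule commuting_projections_from_nat_into[OF \<open>countable \<K>\<close> \<open>\<K> \<noteq> {}\<close> closed proj_commuting])
  moreover have "commuting (N i) (P k)" if "i \<in> I" for i k
    unfolding P_def using range that by (intro commuting_sym[OF N_\<K>]) auto
  moreover have "commuting E (N i)"
    if "i \<in> I" "contraction sc ip E" "is_adjoint ip E E" "\<And>k. commuting (P k) E" for i E
  proof (rule commuting_if_commuting_disc_projections[OF N[OF that(1)] \<Lambda>(2) that(2,3)])
    fix l p assume "l \<in> \<Lambda>"
    then have "disc_space (shift (N i) l) (1 / real (Suc p)) \<in> \<K>"
      unfolding \<K>_def disc_spaces_def using that(1) by force
    then obtain k where "disc_space (shift (N i) l) (1 / real (Suc p)) = from_nat_into \<K> k" using range by (metis rangeE)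
    then show "commuting (proj (disc_space (shift (N i) l) (1 / real (Suc p)))) E"
      using that(4)[of k] by (simp add: P_def)
  qed
  ultimately show thesis using that by blast
qed

end

section \<open>Measures on binary sequences\<close>

text \<open>The children of a node of the binary tree are obtained by prepending a bit, so a node lists its path to the
  root. Cutting an interval of length \<open>m []\<close> successively into pieces of length \<open>m bs\<close> turns the mass
  distribution \<open>m\<close> into Lebesgue measure.\<close>

locale mass_tree =
  fixes m :: "bool list \<Rightarrow> real"
  assumes mass_nonneg: "0 \<le> m bs" and mass_split: "m bs = m (True # bs) + m (False # bs)"
begin

fun left_end :: "bool list \<Rightarrow> real" where
  "left_end [] = 0"
| "left_end (True # bs) = left_end bs"
| "left_end (False # bs) = left_end bs + m (True # bs)"

definition piece :: "bool list \<Rightarrow> real set" where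
  "piece bs = {left_end bs..<left_end bs + m bs}"

lemma piece_Cons: "x \<in> piece (b # bs) \<longleftrightarrow> x \<in> piece bs \<and> b = (x < left_end bs + m (True # bs))"
  using mass_split[of bs] mass_nonneg[of "True # bs"] mass_nonneg[of "False # bs"]
  by (cases b) (auto simp: piece_def)

primrec branch_of :: "real \<Rightarrow> nat \<Rightarrow> bool list" where
  "branch_of x 0 = []"
| "branch_of x (Suc n) = (x < left_end (branch_of x n) + m (True # branch_of x n)) # branch_of x n"

lemma branch_of_eq_iff: "x \<in> piece [] \<and> branch_of x n = bs \<longleftrightarrow> length bs = n \<and> x \<in> piece bs"
proof (induction bs arbitrary: n)
  case Nil
  show ?case by (cases n) auto
next
  case (Cons b bs)
  show ?case
  proof (cases n)
    case (Suc k)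
    have "branch_of x n = b # bs \<longleftrightarrow> branch_of x k = bs \<and> b = (x < left_end bs + m (True # bs))"
      by (auto simp: Suc)
    then show ?thesis using Cons[of k] by (auto simp: Suc piece_Cons)
  qed simp
qed

lemma piece_subset: "piece bs \<subseteq> piece []"
  using branch_of_eq_iff by blast

end

definition cylinder :: "nat list \<Rightarrow> (nat \<Rightarrow> 'b::zero_neq_one) set" where
  "cylinder ks = {w. \<forall>k\<in>set ks. w k = 1}"

definition cylinder_algebra :: "(nat \<Rightarrow> 'b::zero_neq_one) measure" where
  "cylinder_algebra = sigma UNIV (range cylinder)"

lemma space_cylinder_algebra [simp]: "space cylinder_algebra = UNIV"
  by (simp add: cylinder_algebra_def)

lemma sets_cylinder_algebra: "sets cylinder_algebra = sigma_sets UNIV (range cylinder)"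
  by (simp add: cylinder_algebra_def)

lemma sets_cylinder [measurable]: "cylinder ks \<in> sets cylinder_algebra"
  by (simp add: sets_cylinder_algebra sigma_sets.Basic)

lemma cylinder_Nil: "cylinder [] = UNIV"
  by (simp add: cylinder_def)

lemma cylinder_append: "cylinder (ks @ ls) = cylinder ks \<inter> cylinder ls"
  by (auto simp: cylinder_def)

lemma Int_stable_cylinders: "Int_stable (range cylinder)"
  by (auto simp: Int_stable_def cylinder_append[symmetric])

primrec bits :: "(nat \<Rightarrow> 'b::zero_neq_one) \<Rightarrow> nat \<Rightarrow> bool list" where
  "bits w 0 = []"
| "bits w (Suc n) = (w n = 1) # bits w n"

lemma nth_rev_bits: "k < n \<Longrightarrow> rev (bits w n) ! k \<longleftrightarrow> w k = 1"
proof (induction n)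
  case (Suc n)
  have "length (bits w n) = n" by (induction n) auto
  with Suc show ?case by (auto simp: nth_append less_Suc_eq)
qed simp

definition prefix_set :: "bool list \<Rightarrow> (nat \<Rightarrow> 'b::zero_neq_one) set" where
  "prefix_set bs = {w. bits w (length bs) = bs}"

lemma prefix_set_Cons:
  "prefix_set (b # bs) = prefix_set bs \<inter> (if b then cylinder [length bs] else - cylinder [length bs])"
  by (auto simp: prefix_set_def cylinder_def)

lemma sets_prefix_set [measurable]: "prefix_set bs \<in> sets cylinder_algebra"
proof (induction bs)
  case Nil
  show ?case using sets.top[of cylinder_algebra] by (simp add: prefix_set_def)
next
  case (Cons b bs)
  have "- cylinder [length bs] \<in> sets cylinder_algebra"
    using sets.compl_sets[OF sets_cylinder] by (simp add: Compl_eq_Diff_UNIV)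
  then show ?case using Cons by (simp add: prefix_set_Cons sets.Int)
qed

context mass_tree
begin

lemma measurable_branch_of: "(\<lambda>x. branch_of x n) \<in> measurable (restrict_space lborel (piece [])) (count_space UNIV)"
proof -
  have "(\<lambda>x. branch_of x n) -` {bs} \<inter> piece [] = (if length bs = n then piece bs else {})" for bs
    using branch_of_eq_iff[of _ n bs] by auto
  moreover have "piece bs \<in> sets lborel" for bs by (simp add: piece_def)
  ultimately show ?thesis
    using piece_subset
    by (auto simp: measurable_count_space_eq_countable space_restrict_space sets_restrict_space_iff)
qed

lemma measure_exists:
  "\<exists>\<mu> :: (nat \<Rightarrow> 'b::zero_neq_one) measure.
    sets \<mu> = sets cylinder_algebra \<and> (\<forall>bs. emeasure \<mu> (prefix_set bs) = ennreal (m bs))"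
proof -
  define L where "L = restrict_space lborel (piece [])"
  define f :: "real \<Rightarrow> nat \<Rightarrow> 'b" where "f x k = of_bool (hd (branch_of x (Suc k)))" for x k
  have f_eq_1: "f x k = 1 \<longleftrightarrow> hd (branch_of x (Suc k))" for x k by (simp add: f_def)
  have f: "f \<in> measurable L cylinder_algebra"
    unfolding cylinder_algebra_def
  proof (rule measurable_measure_of)
    fix A :: "(nat \<Rightarrow> 'b) set" assume "A \<in> range cylinder"
    then obtain ks where A: "A = cylinder ks" by blast
    have [measurable]: "Measurable.pred L (\<lambda>x. hd (branch_of x (Suc k)))" for k
      unfolding L_def by (rule measurable_compose[OF measurable_branch_of]) simp
    have "f -` A \<inter> space L = {x \<in> space L. \<forall>k\<in>set ks. hd (branch_of x (Suc k))}"
      unfolding A by (auto simp: cylinder_def f_eq_1 simp del: branch_of.simps)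
    also have "\<dots> \<in> sets L" by measurable
    finally show "f -` A \<inter> space L \<in> sets L" .
  qed auto
  have bits: "bits (f x) n = branch_of x n" for x n
    by (induction n) (simp_all add: f_eq_1)
  have "emeasure (distr L cylinder_algebra f) (prefix_set bs) = ennreal (m bs)" for bs
  proof -
    have "f -` prefix_set bs \<inter> space L = {x \<in> piece []. branch_of x (length bs) = bs}"
      by (auto simp: L_def space_restrict_space prefix_set_def bits)
    also have "\<dots> = piece bs" using branch_of_eq_iff[of _ "length bs" bs] by auto
    finally have "emeasure (distr L cylinder_algebra f) (prefix_set bs) = emeasure L (piece bs)"
      by (simp add: emeasure_distr[OF f])
    also have "\<dots> = emeasure lborel (piece bs)"
      unfolding L_def by (rule emeasure_restrict_space) (simp_all add: piece_subset, simp add: piece_def)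
    finally show ?thesis by (simp add: piece_def mass_nonneg)
  qed
  then show ?thesis by (intro exI[of _ "distr L cylinder_algebra f"]) simp
qed

end

context commuting_projections
begin

lemma bounded_op_P: "bounded_op (P k)"
  by (rule bounded_op_contraction[OF contraction_P])

lemma contraction_foldr: "contraction sc ip (foldr P ks)"
proof (induction ks)
  case (Cons k ks)
  have "bounded_op (\<lambda>x. P k (foldr P ks x))"
    by (rule bounded_op_comp[OF bounded_op_P bounded_op_contraction[OF Cons]])
  moreover have "\<parallel>P k (foldr P ks x)\<parallel> \<le> \<parallel>x\<parallel>" for x
    using contraction_le[OF contraction_P] contraction_le[OF Cons] by (rule order_trans)
  ultimately show ?case by (simp add: contraction_def bounded_op_def comp_def)
qed (use contraction_id in \<open>simp add: id_def\<close>)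

lemma bounded_op_foldr: "bounded_op (foldr P ks)"
  by (rule bounded_op_contraction[OF contraction_foldr])

lemma P_foldr: "P k (foldr P ks x) = foldr P ks (P k x)"
  by (rule commutingD[OF commuting_foldr[OF commuting_P]])

lemma foldr_foldr: "foldr P ks (foldr P ls x) = foldr P ls (foldr P ks x)"
  by (rule commutingD[OF commuting_foldr[OF commuting_sym[OF commuting_foldr[OF commuting_P]]]])

lemma foldr_idem: "foldr P ks (foldr P ks x) = foldr P ks x"
proof (induction ks)
  case (Cons k ks)
  then show ?case by (simp add: P_idem flip: P_foldr)
qed simp

lemma ip_P_left: "ip (P k x) y = ip x (P k y)"
  using is_adjoint_P by (simp add: is_adjoint_def)

lemma ip_foldr_left: "ip (foldr P ks x) y = ip x (foldr P ks y)"
  by (induction ks arbitrary: x y) (simp_all add: ip_P_left P_foldr)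

lemma ip_foldr_foldr: "ip (foldr P ks v) (foldr P ls v) = of_real (\<parallel>foldr P (ks @ ls) v\<parallel>\<^sup>2)"
proof -
  have "ip (foldr P (ks @ ls) v) (foldr P (ks @ ls) v) = ip (foldr P (ks @ ls) v) v"
    by (simp only: ip_foldr_left foldr_idem)
  also have "\<dots> = ip (foldr P ks v) (foldr P ls v)"
    by (simp add: foldr_foldr[of ks] ip_foldr_left)
  finally show ?thesis by (simp add: ip_self)
qed

lemma hnorm_P_split: "\<parallel>x\<parallel>\<^sup>2 = \<parallel>P k x\<parallel>\<^sup>2 + \<parallel>x - P k x\<parallel>\<^sup>2"
proof -
  have "ip (P k x) (x - P k x) = 0"
    by (simp add: ip_P_left bounded_op_map_diff[OF bounded_op_P] P_idem)
  from pythagoras[OF this] show ?thesis by simp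
qed

primrec component :: "'h \<Rightarrow> bool list \<Rightarrow> 'h" where
  "component v [] = v"
| "component v (b # bs) = (if b then P (length bs) (component v bs)
     else component v bs - P (length bs) (component v bs))"

lemma P_component: "k < length bs \<Longrightarrow> P k (component v bs) = (if rev bs ! k then component v bs else 0)"
proof (induction bs)
  case (Cons b bs)
  note P_simps = bounded_op_map_0[OF bounded_op_P] bounded_op_map_diff[OF bounded_op_P] P_idem
  show ?case
  proof (cases "k = length bs")
    case True
    then show ?thesis by (simp add: nth_append P_simps)
  next
    case False
    then have "P k (component v bs) = (if rev bs ! k then component v bs else 0)" "k < length bs"
      using Cons by auto
    then show ?thesis
      using commutingD[OF commuting_P[of k "length bs"], of "component v bs"] by (simp add: nth_append P_simps)
  qed
qed simp

lemma foldr_component: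
  "\<forall>k\<in>set ks. k < length bs \<Longrightarrow>
    foldr P ks (component v bs) = (if \<forall>k\<in>set ks. rev bs ! k then component v bs else 0)"
  by (induction ks) (simp_all add: P_component bounded_op_map_0[OF bounded_op_P])

lemma hnorm_foldr_component_split:
  "\<parallel>foldr P ks (component v bs)\<parallel>\<^sup>2
    = \<parallel>foldr P ks (component v (True # bs))\<parallel>\<^sup>2 + \<parallel>foldr P ks (component v (False # bs))\<parallel>\<^sup>2"
  using hnorm_P_split[of "foldr P ks (component v bs)" "length bs"]
  by (simp add: bounded_op_map_diff[OF bounded_op_foldr] P_foldr)

lemma spectral_measure_exists:
  "\<exists>\<mu> :: (nat \<Rightarrow> 'b::zero_neq_one) measure.
    sets \<mu> = sets cylinder_algebra \<and> (\<forall>ks. emeasure \<mu> (cylinder ks) = ennreal (\<parallel>foldr P ks v\<parallel>\<^sup>2))"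
proof -
  interpret mass_tree "\<lambda>bs. \<parallel>component v bs\<parallel>\<^sup>2"
    using hnorm_foldr_component_split[of "[]" v] by unfold_locales simp_all
  obtain \<mu> :: "(nat \<Rightarrow> 'b) measure" where sets: "sets \<mu> = sets cylinder_algebra"
    and prefix: "\<And>bs. emeasure \<mu> (prefix_set bs) = ennreal (\<parallel>component v bs\<parallel>\<^sup>2)"
    using measure_exists by blast
  have "emeasure \<mu> (cylinder ks \<inter> prefix_set bs) = ennreal (\<parallel>foldr P ks (component v bs)\<parallel>\<^sup>2)"
    if "\<forall>k\<in>set ks. k < d + length bs" for d ks bs
    using that
  proof (induction d arbitrary: bs)
    case 0
    have "cylinder ks \<inter> prefix_set bs = (if \<forall>k\<in>set ks. rev bs ! k then prefix_set bs else {} :: (nat \<Rightarrow> 'b) set)"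
    proof -
      have "w \<in> cylinder ks \<longleftrightarrow> (\<forall>k\<in>set ks. rev bs ! k)" if "w \<in> prefix_set bs" for w :: "nat \<Rightarrow> 'b"
        using nth_rev_bits[of _ "length bs" w] that 0 by (simp add: cylinder_def prefix_set_def)
      then show ?thesis by auto
    qed
    then show ?case using 0 by (simp add: foldr_component prefix)
  next
    case (Suc d)
    have union: "cylinder ks \<inter> prefix_set bs
        = (cylinder ks \<inter> prefix_set (True # bs)) \<union> (cylinder ks \<inter> prefix_set (False # bs))"
      by (auto simp: prefix_set_Cons)
    have "emeasure \<mu> (cylinder ks \<inter> prefix_set bs)
        = emeasure \<mu> (cylinder ks \<inter> prefix_set (True # bs)) + emeasure \<mu> (cylinder ks \<inter> prefix_set (False # bs))"
      unfolding union
      by (rule plus_emeasure[symmetric]) (auto simp: sets intro!: sets.Int, auto simp: prefix_set_Cons)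
    also have "\<dots> = ennreal (\<parallel>foldr P ks (component v bs)\<parallel>\<^sup>2)"
      using Suc.IH[of "True # bs"] Suc.IH[of "False # bs"] Suc.prems hnorm_foldr_component_split[of ks v bs]
      by (simp del: component.simps flip: ennreal_plus)
    finally show ?case .
  qed
  from this[of ks "Suc (sum_list ks)" "[]" for ks]
  have "emeasure \<mu> (cylinder ks) = ennreal (\<parallel>foldr P ks v\<parallel>\<^sup>2)" for ks
    by (simp add: prefix_set_def less_Suc_eq_le member_le_sum_list)
  with sets show ?thesis by blast
qed

end

section \<open>Sums of measures over slices\<close>

definition slice_sum :: "'a set \<Rightarrow> 'b measure \<Rightarrow> ('a \<Rightarrow> 'b measure) \<Rightarrow> ('a \<times> 'b) measure" where
  "slice_sum S N \<mu> = measure_of UNIV {A. \<forall>v. Pair v -` A \<in> sets N}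
     (\<lambda>A. \<integral>\<^sup>+v. emeasure (\<mu> v) (Pair v -` A) \<partial>count_space S)"

lemma space_slice_sum: "space (slice_sum S N \<mu>) = UNIV"
  by (simp add: slice_sum_def space_measure_of_conv)

lemma sets_slice_sum:
  assumes "space N = UNIV"
  shows "A \<in> sets (slice_sum S N \<mu>) \<longleftrightarrow> (\<forall>v. Pair v -` A \<in> sets N)"
proof -
  have "sigma_algebra UNIV {A. \<forall>v. Pair v -` A \<in> sets N}"
    unfolding sigma_algebra_iff2
    using sets.compl_sets[of _ N] assms by (auto simp: vimage_UN vimage_Diff intro!: sets.countable_UN)
  then have "sets (slice_sum S N \<mu>) = {A. \<forall>v. Pair v -` A \<in> sets N}"
    unfolding slice_sum_def by (rule sigma_algebra.sets_measure_of_eq)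
  then show ?thesis by simp
qed

lemma Pair_vimage_slice: "Pair u -` ({v} \<times> A) = (if u = v then A else {})"
  by auto

context
  fixes S :: "'a set" and N :: "'b measure" and \<mu> :: "'a \<Rightarrow> 'b measure"
  assumes N: "space N = UNIV" and sets_\<mu>: "\<And>v. sets (\<mu> v) = sets N"
begin

lemma emeasure_slice_sum:
  assumes "A \<in> sets (slice_sum S N \<mu>)"
  shows "emeasure (slice_sum S N \<mu>) A = (\<integral>\<^sup>+v. emeasure (\<mu> v) (Pair v -` A) \<partial>count_space S)"
proof (rule emeasure_measure_of[OF slice_sum_def])
  show "countably_additive (sets (slice_sum S N \<mu>)) (\<lambda>A. \<integral>\<^sup>+v. emeasure (\<mu> v) (Pair v -` A) \<partial>count_space S)"
  proof (rule countably_additiveI)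
    fix A :: "nat \<Rightarrow> ('a \<times> 'b) set"
    assume A: "range A \<subseteq> sets (slice_sum S N \<mu>)" "disjoint_family A"
    have "(\<Sum>i. emeasure (\<mu> v) (Pair v -` A i)) = emeasure (\<mu> v) (Pair v -` (\<Union>i. A i))" for v
      unfolding vimage_UN
    proof (rule suminf_emeasure)
      show "disjoint_family (\<lambda>i. Pair v -` A i)" using A(2) unfolding disjoint_family_on_def by blast
    qed (use A(1) in \<open>auto simp: sets_\<mu> sets_slice_sum[OF N] image_subset_iff\<close>)
    then show "(\<Sum>i. \<integral>\<^sup>+v. emeasure (\<mu> v) (Pair v -` A i) \<partial>count_space S)
        = (\<integral>\<^sup>+v. emeasure (\<mu> v) (Pair v -` (\<Union>i. A i)) \<partial>count_space S)"
      by (simp flip: nn_integral_suminf)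
  qed
qed (use assms in \<open>auto simp: positive_def\<close>)

lemma sets_slice:
  assumes "A \<in> sets N"
  shows "{v} \<times> A \<in> sets (slice_sum S N \<mu>)"
  using assms by (simp add: sets_slice_sum[OF N] Pair_vimage_slice)

lemma sets_Int_slice:
  assumes "A \<in> sets (slice_sum S N \<mu>)"
  shows "A \<inter> {v} \<times> UNIV \<in> sets (slice_sum S N \<mu>)"
  using sets_slice[OF sets.top, of v] assms by (simp add: N sets.Int)

lemma emeasure_slice:
  assumes "v \<in> S" "A \<in> sets N"
  shows "emeasure (slice_sum S N \<mu>) ({v} \<times> A) = emeasure (\<mu> v) A"
proof -
  have "emeasure (slice_sum S N \<mu>) ({v} \<times> A) = (\<integral>\<^sup>+u. emeasure (\<mu> v) A * indicator {v} u \<partial>count_space S)"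
    unfolding emeasure_slice_sum[OF sets_slice[OF assms(2)]]
    by (intro nn_integral_cong) (simp add: Pair_vimage_slice)
  also have "\<dots> = emeasure (\<mu> v) A"
    using assms(1) by (subst nn_integral_cmult_indicator) (auto simp: emeasure_count_space_finite)
  finally show ?thesis .
qed

lemma emeasure_Int_slice:
  assumes "v \<in> S" "A \<in> sets (slice_sum S N \<mu>)"
  shows "emeasure (slice_sum S N \<mu>) (A \<inter> {v} \<times> UNIV) = emeasure (\<mu> v) (Pair v -` A)"
proof -
  have "A \<inter> {v} \<times> UNIV = {v} \<times> (Pair v -` A)" by auto
  then show ?thesis using assms by (simp add: emeasure_slice sets_slice_sum[OF N])
qed

lemma emeasure_slice_sum_eq_0:
  assumes A: "A \<in> sets (slice_sum S N \<mu>)"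
    and slices: "\<And>v. v \<in> S \<Longrightarrow> emeasure (slice_sum S N \<mu>) (A \<inter> {v} \<times> UNIV) = 0"
  shows "emeasure (slice_sum S N \<mu>) A = 0"
  unfolding emeasure_slice_sum[OF A]
  by (subst nn_integral_0_iff_AE) (auto simp: AE_count_space slices simp flip: emeasure_Int_slice[OF _ A])

lemma AE_slice_sumI:
  assumes Q: "{x. Q x} \<in> sets (slice_sum S N \<mu>)"
    and slices: "\<And>v. v \<in> S \<Longrightarrow> AE x in slice_sum S N \<mu>. fst x = v \<longrightarrow> Q x"
  shows "AE x in slice_sum S N \<mu>. Q x"
proof (rule AE_I')
  let ?M = "slice_sum S N \<mu>"
  have B: "- {x. Q x} \<in> sets ?M"
    using sets.compl_sets[OF Q] by (simp add: space_slice_sum Compl_eq_Diff_UNIV)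
  have "emeasure ?M (- {x. Q x} \<inter> {v} \<times> UNIV) = 0" if "v \<in> S" for v
  proof -
    have "{x \<in> space ?M. \<not> (fst x = v \<longrightarrow> Q x)} = - {x. Q x} \<inter> {v} \<times> UNIV"
      by (auto simp: space_slice_sum)
    from AE_iff_measurable[OF sets_Int_slice[OF B] this] show ?thesis using slices[OF that] by simp
  qed
  with B show "- {x. Q x} \<in> null_sets ?M" by (simp add: null_sets_def emeasure_slice_sum_eq_0)
qed auto

lemma semifinite_slice_sum:
  assumes finite: "\<And>v. v \<in> S \<Longrightarrow> emeasure (\<mu> v) UNIV < \<infinity>"
  shows "semifinite (slice_sum S N \<mu>)"
  unfolding semifinite_def
proof (intro ballI impI)
  let ?M = "slice_sum S N \<mu>"
  fix A assume A: "A \<in> sets ?M" and "emeasure ?M A = \<infinity>"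
  then obtain v where v: "v \<in> S" "emeasure ?M (A \<inter> {v} \<times> UNIV) \<noteq> 0"
    using emeasure_slice_sum_eq_0[OF A] by force
  have UNIV: "UNIV \<in> sets N" using sets.top[of N] N by simp
  have "emeasure ?M (A \<inter> {v} \<times> UNIV) \<le> emeasure ?M ({v} \<times> UNIV)"
    by (rule emeasure_mono[OF _ sets_slice[OF UNIV]]) blast
  also have "\<dots> < \<infinity>" using finite[OF v(1)] by (simp add: emeasure_slice[OF v(1) UNIV])
  finally show "\<exists>B\<in>sets ?M. B \<subseteq> A \<and> 0 < emeasure ?M B \<and> emeasure ?M B < \<infinity>"
    using v(2) by (intro bexI[OF _ sets_Int_slice[OF A, of v]]) (simp add: zero_less_iff_neq_zero)
qed

end

lemma semifinite_AE_I:
  assumes M: "semifinite M" and Q: "{x \<in> space M. Q x} \<in> sets M"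
    and finite: "\<And>B. B \<in> sets M \<Longrightarrow> emeasure M B < \<infinity> \<Longrightarrow> AE x in M. x \<in> B \<longrightarrow> Q x"
  shows "AE x in M. Q x"
proof (rule ccontr)
  define A where "A = {x \<in> space M. \<not> Q x}"
  have A: "A \<in> sets M"
    using sets.compl_sets[OF Q] by (auto simp: A_def set_diff_eq intro: back_subst[of "\<lambda>A. A \<in> sets M"])
  assume "\<not> (AE x in M. Q x)"
  then have "emeasure M A \<noteq> 0" using AE_iff_measurable[OF A] by (auto simp: A_def)
  then obtain B where B: "B \<in> sets M" "B \<subseteq> A" "0 < emeasure M B" "emeasure M B < \<infinity>"
    using M A unfolding semifinite_def by (metis infinity_ennreal_def less_top order_refl zero_less_iff_neq_zero)
  have "AE x in M. x \<notin> B" using finite[OF B(1,4)] B(2) by (auto simp: A_def)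
  then have "emeasure M B = 0" using B(1) AE_iff_measurable[OF B(1), of "\<lambda>x. x \<notin> B"] sets.sets_into_space by blast
  with B(3) show False by simp
qed

section \<open>Square integrable functions\<close>

lemma density_unique_complex:
  fixes f f' :: "'x \<Rightarrow> complex"
  assumes f: "integrable M f" "integrable M f'"
    and eq: "\<And>A. A \<in> sets M \<Longrightarrow> (LINT x:A|M. f x) = (LINT x:A|M. f' x)"
  shows "AE x in M. f x = f' x"
proof -
  have AE_eq: "AE x in M. c (f x) = c (f' x)" if c: "bounded_linear c" for c :: "complex \<Rightarrow> real"
  proof (rule density_unique_real)
    have "(LINT x:A|M. c (g x)) = c (LINT x:A|M. g x)" if "A \<in> sets M" "integrable M g" for A and g :: "'x \<Rightarrow> complex"
      using integral_bounded_linear[OF c integrable_mult_indicator[OF that]] linear_simps(5)[OF c]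
      by (simp add: set_lebesgue_integral_def)
    then show "(LINT x:A|M. c (f x)) = (LINT x:A|M. c (f' x))" if "A \<in> sets M" for A
      using that f by (simp add: eq)
  qed (intro integrable_bounded_linear[OF c] f)+
  from AE_eq[OF bounded_linear_Re] AE_eq[OF bounded_linear_Im] show ?thesis
    by eventually_elim (rule complex_eqI)
qed

definition L2_norm :: "'x measure \<Rightarrow> ('x \<Rightarrow> complex) \<Rightarrow> real" where
  "L2_norm M f = sqrt (LINT x|M. (cmod (f x))\<^sup>2)"

abbreviation L2_dist :: "'x measure \<Rightarrow> ('x \<Rightarrow> complex) \<Rightarrow> ('x \<Rightarrow> complex) \<Rightarrow> real" where
  "L2_dist M f g \<equiv> L2_norm M (\<lambda>x. f x - g x)"

lemma L2_norm_nonneg [simp]: "0 \<le> L2_norm M f"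
  by (simp add: L2_norm_def)

lemma L2_norm_power2: "(L2_norm M f)\<^sup>2 = (LINT x|M. (cmod (f x))\<^sup>2)"
  by (simp add: L2_norm_def)

lemma L2_norm_zero [simp]: "L2_norm M (\<lambda>x. 0) = 0"
  by (simp add: L2_norm_def)

lemma L2_dist_commute: "L2_dist M f g = L2_dist M g f"
  by (simp add: L2_norm_def norm_minus_commute)

lemma L2_norm_cmult: "L2_norm M (\<lambda>x. c * f x) = cmod c * L2_norm M f"
  by (simp add: L2_norm_def norm_mult power_mult_distrib real_sqrt_mult)

lemma L2_norm_cong_AE:
  assumes "f \<in> borel_measurable M" "g \<in> borel_measurable M" "AE x in M. f x = g x"
  shows "L2_norm M f = L2_norm M g"
  unfolding L2_norm_def using assms by (intro arg_cong[where f = sqrt] integral_cong_AE) auto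

lemma borel_measurable_cnj [measurable (raw)]:
  assumes "f \<in> borel_measurable M"
  shows "(\<lambda>x. cnj (f x)) \<in> borel_measurable M"
  by (rule measurable_compose[OF assms borel_measurable_continuous_onI]) (intro continuous_intros)

lemma square_integrable_measurable [measurable_dest]: "square_integrable M f \<Longrightarrow> f \<in> borel_measurable M"
  and square_integrable_power2: "square_integrable M f \<Longrightarrow> integrable M (\<lambda>x. (cmod (f x))\<^sup>2)"
  by (simp_all add: square_integrable_def)

lemma nn_integral_power2:
  assumes "square_integrable M f"
  shows "(\<integral>\<^sup>+x. ennreal ((cmod (f x))\<^sup>2) \<partial>M) = ennreal ((L2_norm M f)\<^sup>2)"
  unfolding L2_norm_power2 using square_integrable_power2[OF assms] by (rule nn_integral_eq_integral) simp

lemma square_integrable_zero: "square_integrable M (\<lambda>x. 0)"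
  by (simp add: square_integrable_def)

lemma square_integrable_cmult: "square_integrable M f \<Longrightarrow> square_integrable M (\<lambda>x. c * f x)"
  unfolding square_integrable_def by (auto simp: norm_mult power_mult_distrib)

lemma square_integrable_add:
  assumes f: "square_integrable M f" and g: "square_integrable M g"
  shows "square_integrable M (\<lambda>x. f x + g x)"
  unfolding square_integrable_def
proof
  note [measurable] = square_integrable_measurable[OF f] square_integrable_measurable[OF g]
  show "(\<lambda>x. f x + g x) \<in> borel_measurable M" by measurable
  show "integrable M (\<lambda>x. (cmod (f x + g x))\<^sup>2)"
  proof (rule Bochner_Integration.integrable_bound)
    show "integrable M (\<lambda>x. 2 * (cmod (f x))\<^sup>2 + 2 * (cmod (g x))\<^sup>2)"
      using square_integrable_power2[OF f] square_integrable_power2[OF g] by simp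
    have "(cmod (f x + g x))\<^sup>2 \<le> 2 * (cmod (f x))\<^sup>2 + 2 * (cmod (g x))\<^sup>2" for x
    proof -
      have "(cmod (f x + g x))\<^sup>2 \<le> (cmod (f x) + cmod (g x))\<^sup>2" by (intro power_mono norm_triangle_ineq) simp
      also have "\<dots> \<le> 2 * (cmod (f x))\<^sup>2 + 2 * (cmod (g x))\<^sup>2"
        using sum_squares_bound[of "cmod (f x)" "cmod (g x)"] by (simp add: power2_sum)
      finally show ?thesis .
    qed
    then show "AE x in M. norm ((cmod (f x + g x))\<^sup>2) \<le> norm (2 * (cmod (f x))\<^sup>2 + 2 * (cmod (g x))\<^sup>2)" by simp
  qed measurable
qed

lemma square_integrable_diff:
  "square_integrable M f \<Longrightarrow> square_integrable M g \<Longrightarrow> square_integrable M (\<lambda>x. f x - g x)"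
  using square_integrable_add[OF _ square_integrable_cmult[of M g "-1"], of f] by simp

lemma integrable_cmod_mult:
  assumes f: "square_integrable M f" and g: "square_integrable M g"
  shows "integrable M (\<lambda>x. cmod (f x) * cmod (g x))"
proof (rule Bochner_Integration.integrable_bound)
  note [measurable] = square_integrable_measurable[OF f] square_integrable_measurable[OF g]
  show "integrable M (\<lambda>x. (cmod (f x))\<^sup>2 + (cmod (g x))\<^sup>2)"
    using square_integrable_power2[OF f] square_integrable_power2[OF g] by simp
  show "(\<lambda>x. cmod (f x) * cmod (g x)) \<in> borel_measurable M" by measurable
  have "cmod (f x) * cmod (g x) \<le> (cmod (f x))\<^sup>2 + (cmod (g x))\<^sup>2" for x
    using sum_squares_bound[of "cmod (f x)" "cmod (g x)"] mult_nonneg_nonneg[OF norm_ge_zero norm_ge_zero, of "f x" "g x"]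
    by linarith
  then show "AE x in M. norm (cmod (f x) * cmod (g x)) \<le> norm ((cmod (f x))\<^sup>2 + (cmod (g x))\<^sup>2)" by simp
qed

lemma integrable_L2_inner:
  assumes f: "square_integrable M f" and g: "square_integrable M g"
  shows "integrable M (\<lambda>x. f x * cnj (g x))"
proof (rule Bochner_Integration.integrable_bound[OF integrable_cmod_mult[OF f g]])
  note [measurable] = square_integrable_measurable[OF f] square_integrable_measurable[OF g]
  show "(\<lambda>x. f x * cnj (g x)) \<in> borel_measurable M" by measurable
qed (simp add: norm_mult)

lemma L2_cauchy_schwarz:
  assumes f: "square_integrable M f" and g: "square_integrable M g"
  shows "cmod (L2_inner M f g) \<le> L2_norm M f * L2_norm M g"
proof -
  note [measurable] = square_integrable_measurable[OF f] square_integrable_measurable[OF g]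
  let ?I = "LINT x|M. cmod (f x) * cmod (g x)"
  have I: "(\<integral>\<^sup>+x. ennreal (cmod (f x)) * ennreal (cmod (g x)) \<partial>M) = ennreal ?I"
    using nn_integral_eq_integral[OF integrable_cmod_mult[OF f g]] by (simp add: ennreal_mult)
  have I_nonneg: "0 \<le> ?I" by (intro Bochner_Integration.integral_nonneg) simp
  have "ennreal (?I\<^sup>2) \<le> ennreal ((L2_norm M f)\<^sup>2 * (L2_norm M g)\<^sup>2)"
    using Cauchy_Schwarz_nn_integral[of "\<lambda>x. ennreal (cmod (f x))" M "\<lambda>x. ennreal (cmod (g x))"] I_nonneg
    by (simp add: I ennreal_power ennreal_mult nn_integral_power2[OF f] nn_integral_power2[OF g])
  then have "?I\<^sup>2 \<le> (L2_norm M f * L2_norm M g)\<^sup>2" by (simp add: power_mult_distrib)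
  then have "?I \<le> L2_norm M f * L2_norm M g" by (rule power2_le_imp_le) simp
  moreover have "cmod (L2_inner M f g) \<le> ?I"
    unfolding L2_inner_def using integral_norm_bound[of M "\<lambda>x. f x * cnj (g x)"] by (simp add: norm_mult)
  ultimately show ?thesis by linarith
qed

lemma L2_inner_self: "L2_inner M f f = of_real ((L2_norm M f)\<^sup>2)"
proof -
  have "f x * cnj (f x) = complex_of_real ((cmod (f x))\<^sup>2)" for x by (simp add: of_real_cmod_power2)
  then show ?thesis unfolding L2_inner_def L2_norm_power2 by (simp only: integral_complex_of_real)
qed

lemma L2_inner_commute: "L2_inner M g f = cnj (L2_inner M f g)"
proof -
  have "cnj (L2_inner M f g) = (LINT x|M. cnj (f x * cnj (g x)))"
    unfolding L2_inner_def by (rule Bochner_Integration.integral_cnj[symmetric])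
  then show ?thesis by (simp add: L2_inner_def mult.commute)
qed

lemma L2_inner_linear_left:
  assumes "square_integrable M f" "square_integrable M g" "square_integrable M h"
  shows "L2_inner M (\<lambda>x. c * f x + g x) h = c * L2_inner M f h + L2_inner M g h"
  unfolding L2_inner_def using integrable_L2_inner[OF assms(1,3)] integrable_L2_inner[OF assms(2,3)]
  by (simp add: distrib_right mult.assoc)

lemma L2_inner_diff_left:
  assumes "square_integrable M f" "square_integrable M g" "square_integrable M h"
  shows "L2_inner M (\<lambda>x. f x - g x) h = L2_inner M f h - L2_inner M g h"
  using L2_inner_linear_left[OF assms(2,1,3), of "-1"] by simp

lemma L2_inner_cong_AE:
  assumes "square_integrable M f" "square_integrable M f'" "square_integrable M g" "AE x in M. f x = f' x"
  shows "L2_inner M f g = L2_inner M f' g"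
  unfolding L2_inner_def using assms by (intro integral_cong_AE) (auto simp: square_integrable_def)

lemma L2_norm_add_power2:
  assumes f: "square_integrable M f" and g: "square_integrable M g"
  shows "(L2_norm M (\<lambda>x. f x + g x))\<^sup>2 = (L2_norm M f)\<^sup>2 + (L2_norm M g)\<^sup>2 + 2 * Re (L2_inner M f g)"
proof -
  note sum = square_integrable_add[OF f g]
  have "L2_inner M h (\<lambda>x. f x + g x) = L2_inner M h f + L2_inner M h g" if "square_integrable M h" for h
    using arg_cong[OF L2_inner_linear_left[OF f g that, of 1], of cnj] by (simp flip: L2_inner_commute)
  then have "L2_inner M (\<lambda>x. f x + g x) (\<lambda>x. f x + g x)
      = L2_inner M f f + L2_inner M g g + (L2_inner M f g + L2_inner M g f)"
    using L2_inner_linear_left[OF f g sum, of 1] f g by simp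
  from arg_cong[OF this, of Re] show ?thesis
    by (simp add: L2_inner_self L2_inner_commute[of M g f] flip: of_real_power)
qed

lemma L2_norm_triangle_ineq:
  assumes f: "square_integrable M f" and g: "square_integrable M g"
  shows "L2_norm M (\<lambda>x. f x + g x) \<le> L2_norm M f + L2_norm M g"
proof (rule power2_le_imp_le)
  have "Re (L2_inner M f g) \<le> L2_norm M f * L2_norm M g"
    using complex_Re_le_cmod L2_cauchy_schwarz[OF f g] by (rule order_trans)
  then show "(L2_norm M (\<lambda>x. f x + g x))\<^sup>2 \<le> (L2_norm M f + L2_norm M g)\<^sup>2"
    by (simp add: L2_norm_add_power2[OF f g] power2_sum)
qed simp

lemma L2_dist_triangle:
  assumes "square_integrable M f" "square_integrable M g" "square_integrable M h"
  shows "L2_dist M f h \<le> L2_dist M f g + L2_dist M g h"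
  using L2_norm_triangle_ineq[OF square_integrable_diff[OF assms(1,2)] square_integrable_diff[OF assms(2,3)]] by simp

lemma L2_norm_diff_le:
  assumes "square_integrable M f" "square_integrable M g"
  shows "\<bar>L2_norm M f - L2_norm M g\<bar> \<le> L2_dist M f g"
  using L2_norm_triangle_ineq[OF square_integrable_diff[OF assms] assms(2)]
    L2_norm_triangle_ineq[OF square_integrable_diff[OF assms(2,1)] assms(1)] L2_dist_commute[of M f g]
  by simp

lemma L2_norm_eq_0_AE:
  assumes "square_integrable M f" "L2_norm M f = 0"
  shows "AE x in M. f x = 0"
  using assms integral_nonneg_eq_0_iff_AE[OF square_integrable_power2[OF assms(1)]] by (simp add: L2_norm_def)

lemma L2_norm_tendsto:
  assumes "\<And>n. square_integrable M (f n)" "square_integrable M g" "(\<lambda>n. L2_dist M (f n) g) \<longlonglongrightarrow> 0"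
  shows "(\<lambda>n. L2_norm M (f n)) \<longlonglongrightarrow> L2_norm M g"
proof (rule LIM_zero_cancel, rule tendsto_rabs_zero_cancel, rule tendsto_sandwich[OF _ _ tendsto_const assms(3)])
  show "\<forall>\<^sub>F n in sequentially. \<bar>L2_norm M (f n) - L2_norm M g\<bar> \<le> L2_dist M (f n) g"
    using L2_norm_diff_le[OF assms(1,2)] by simp
qed simp

lemma L2_AE_subseq:
  assumes "\<And>n. square_integrable M (f n)" "square_integrable M g" "(\<lambda>n. L2_dist M (f n) g) \<longlonglongrightarrow> 0"
  obtains r :: "nat \<Rightarrow> nat" where "strict_mono r" "AE x in M. (\<lambda>n. f (r n) x) \<longlonglongrightarrow> g x"
proof -
  have "(\<lambda>n. (L2_dist M (f n) g)\<^sup>2) \<longlonglongrightarrow> 0\<^sup>2" by (intro tendsto_power assms)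
  then have "(\<lambda>n. LINT x|M. norm ((cmod (f n x - g x))\<^sup>2)) \<longlonglongrightarrow> 0" by (simp add: L2_norm_power2)
  from tendsto_L1_AE_subseq[OF square_integrable_power2[OF square_integrable_diff[OF assms(1,2)]] this]
  obtain r :: "nat \<Rightarrow> nat" where r: "strict_mono r" "AE x in M. (\<lambda>n. (cmod (f (r n) x - g x))\<^sup>2) \<longlonglongrightarrow> 0" by blast
  from r(2) have "AE x in M. (\<lambda>n. f (r n) x) \<longlonglongrightarrow> g x"
  proof eventually_elim
    case (elim x)
    then have "(\<lambda>n. sqrt ((cmod (f (r n) x - g x))\<^sup>2)) \<longlonglongrightarrow> sqrt 0" by (rule tendsto_real_sqrt)
    then have "(\<lambda>n. cmod (f (r n) x - g x)) \<longlonglongrightarrow> 0" by simp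
    then show ?case by (rule LIM_zero_cancel[OF tendsto_norm_zero_cancel])
  qed
  with r(1) show thesis by (rule that)
qed

lemma L2_Fatou:
  assumes f: "\<And>n. square_integrable M (f n)" and bound: "\<forall>\<^sub>F n in sequentially. L2_norm M (f n) \<le> c"
  shows "(\<integral>\<^sup>+x. liminf (\<lambda>n. ennreal ((cmod (f n x))\<^sup>2)) \<partial>M) \<le> ennreal (c\<^sup>2)"
proof -
  note [measurable] = square_integrable_measurable[OF f]
  have "(\<integral>\<^sup>+x. liminf (\<lambda>n. ennreal ((cmod (f n x))\<^sup>2)) \<partial>M) \<le> liminf (\<lambda>n. \<integral>\<^sup>+x. ennreal ((cmod (f n x))\<^sup>2) \<partial>M)"
    by (intro nn_integral_liminf) measurable
  also have "\<dots> \<le> ennreal (c\<^sup>2)"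
  proof (rule Liminf_le)
    show "\<forall>\<^sub>F n in sequentially. (\<integral>\<^sup>+x. ennreal ((cmod (f n x))\<^sup>2) \<partial>M) \<le> ennreal (c\<^sup>2)"
      using bound by eventually_elim (simp add: nn_integral_power2[OF f] power_mono ennreal_leI)
  qed simp
  finally show ?thesis .
qed

lemma L2_AE_frequently_small:
  assumes f: "\<And>i n. square_integrable M (f i n)" and bound: "\<And>i n. L2_norm M (f i n) \<le> c i"
    and c: "c \<longlonglongrightarrow> 0" and \<delta>: "0 < \<delta>"
  shows "AE x in M. \<exists>i. \<exists>\<^sub>F n in sequentially. cmod (f i n x) < \<delta>"
proof -
  note [measurable] = square_integrable_measurable[OF f]
  let ?F = "\<lambda>i x. liminf (\<lambda>n. ennreal ((cmod (f i n x))\<^sup>2))"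
  have "(\<integral>\<^sup>+x. (INF i. ?F i x) \<partial>M) \<le> ennreal ((c i)\<^sup>2)" for i
  proof -
    have "(\<integral>\<^sup>+x. (INF i. ?F i x) \<partial>M) \<le> (\<integral>\<^sup>+x. ?F i x \<partial>M)" by (intro nn_integral_mono INF_lower) simp
    also have "\<dots> \<le> ennreal ((c i)\<^sup>2)" by (intro L2_Fatou f) (simp add: bound)
    finally show ?thesis .
  qed
  moreover have "(\<lambda>i. ennreal ((c i)\<^sup>2)) \<longlonglongrightarrow> ennreal (0\<^sup>2)" by (intro tendsto_ennrealI tendsto_power c)
  ultimately have "(\<integral>\<^sup>+x. (INF i. ?F i x) \<partial>M) \<le> ennreal (0\<^sup>2)"
    by (intro LIMSEQ_le_const) auto
  then have "AE x in M. (INF i. ?F i x) = 0" by (subst nn_integral_0_iff_AE[symmetric]) auto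
  then show ?thesis
  proof eventually_elim
    case (elim x)
    then have "(INF i. ?F i x) < ennreal (\<delta>\<^sup>2)" using \<delta> by simp
    then obtain i where i: "?F i x < ennreal (\<delta>\<^sup>2)" by (auto simp: INF_less_iff)
    have "\<exists>\<^sub>F n in sequentially. cmod (f i n x) < \<delta>"
    proof (rule ccontr)
      assume "\<not> ?thesis"
      then have "\<forall>\<^sub>F n in sequentially. \<delta> \<le> cmod (f i n x)" by (simp add: not_frequently not_less)
      then have "\<forall>\<^sub>F n in sequentially. ennreal (\<delta>\<^sup>2) \<le> ennreal ((cmod (f i n x))\<^sup>2)"
        by eventually_elim (use \<delta> in \<open>intro ennreal_leI power_mono, auto\<close>)
      from Liminf_bounded[OF this] i show False by simp
    qed
    then show ?case by blast
  qed
qed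

lemma L2_norm_limit_le:
  assumes f: "\<And>n. square_integrable M (f n)" and g [measurable]: "g \<in> borel_measurable M"
    and lim: "AE x in M. (\<lambda>n. f n x) \<longlonglongrightarrow> g x"
    and c: "0 \<le> c" "\<forall>\<^sub>F n in sequentially. L2_norm M (f n) \<le> c"
  shows "square_integrable M g" "L2_norm M g \<le> c"
proof -
  have "(\<integral>\<^sup>+x. ennreal ((cmod (g x))\<^sup>2) \<partial>M) = (\<integral>\<^sup>+x. liminf (\<lambda>n. ennreal ((cmod (f n x))\<^sup>2)) \<partial>M)"
  proof (rule nn_integral_cong_AE)
    show "AE x in M. ennreal ((cmod (g x))\<^sup>2) = liminf (\<lambda>n. ennreal ((cmod (f n x))\<^sup>2))"
      using lim
    proof eventually_elim
      case (elim x)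
      then have "(\<lambda>n. ennreal ((cmod (f n x))\<^sup>2)) \<longlonglongrightarrow> ennreal ((cmod (g x))\<^sup>2)"
        by (intro tendsto_ennrealI tendsto_intros)
      then show ?case by (rule lim_imp_Liminf[OF trivial_limit_sequentially, symmetric])
    qed
  qed
  also have "\<dots> \<le> ennreal (c\<^sup>2)" by (rule L2_Fatou[OF f c(2)])
  finally have le: "(\<integral>\<^sup>+x. ennreal ((cmod (g x))\<^sup>2) \<partial>M) \<le> ennreal (c\<^sup>2)" .
  also have "\<dots> < \<infinity>" by simp
  finally have "integrable M (\<lambda>x. (cmod (g x))\<^sup>2)" by (intro integrableI_bounded) auto
  then show g: "square_integrable M g" by (simp add: square_integrable_def)
  show "L2_norm M g \<le> c"
    by (rule power2_le_imp_le) (use le nn_integral_power2[OF g] c(1) in simp_all)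
qed

lemma summable_if_summable_geometric_power2:
  fixes d :: "nat \<Rightarrow> complex"
  assumes "summable (\<lambda>k. 2 ^ k * (cmod (d k))\<^sup>2)"
  shows "summable d"
proof -
  have "Bseq (\<lambda>k. 2 ^ k * (cmod (d k))\<^sup>2)"
    using assms by (intro convergent_imp_Bseq) (auto intro: convergentI summable_LIMSEQ_zero)
  then obtain B where B: "B > 0" "\<And>k. 2 ^ k * (cmod (d k))\<^sup>2 \<le> B"
    unfolding Bseq_def by (metis abs_le_D1 real_norm_def)
  show ?thesis
  proof (rule summable_comparison_test)
    have "cmod (d k) \<le> sqrt (B * (1/2) ^ k)" for k
      using B(2)[of k] by (intro real_le_rsqrt) (simp add: field_simps power_one_over)
    then show "\<exists>N. \<forall>k\<ge>N. norm (d k) \<le> sqrt B * (sqrt (1/2)) ^ k"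
      by (simp add: real_sqrt_mult real_sqrt_power)
    show "summable (\<lambda>k. sqrt B * (sqrt (1/2)) ^ k)"
      by (intro summable_mult summable_geometric) (simp add: real_sqrt_lt_1_iff)
  qed
qed

lemma L2_rapidly_Cauchy_AE_convergent:
  assumes f: "\<And>k. square_integrable M (f k)" and rapid: "\<And>k. L2_dist M (f (Suc k)) (f k) \<le> (1/2) ^ k"
  shows "AE x in M. convergent (\<lambda>k. f k x)"
proof -
  define d where "d k x = f (Suc k) x - f k x" for k x
  have d: "square_integrable M (d k)" for k unfolding d_def[abs_def] by (intro square_integrable_diff f)
  note [measurable] = square_integrable_measurable[OF d]
  have "(\<integral>\<^sup>+x. ennreal (2 ^ k * (cmod (d k x))\<^sup>2) \<partial>M) \<le> ennreal ((1/2) ^ k)" for k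
  proof -
    have "(\<integral>\<^sup>+x. ennreal (2 ^ k * (cmod (d k x))\<^sup>2) \<partial>M) = ennreal (2 ^ k * (L2_norm M (d k))\<^sup>2)"
      by (simp add: ennreal_mult nn_integral_cmult nn_integral_power2[OF d])
    also have "\<dots> \<le> ennreal (2 ^ k * ((1/2) ^ k)\<^sup>2)"
      using rapid[of k] by (intro ennreal_leI mult_left_mono power_mono) (simp_all add: d_def[abs_def])
    also have "2 ^ k * ((1/2) ^ k)\<^sup>2 = (1/2 :: real) ^ k"
      by (simp add: power2_eq_square power_mult_distrib[symmetric] mult.assoc[symmetric])
    finally show ?thesis .
  qed
  then have "(\<Sum>k. \<integral>\<^sup>+x. ennreal (2 ^ k * (cmod (d k x))\<^sup>2) \<partial>M) \<le> (\<Sum>k. ennreal ((1/2) ^ k))"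
    by (intro suminf_le) auto
  also have "\<dots> = ennreal (\<Sum>k. (1/2) ^ k)" by (intro suminf_ennreal2) (auto simp: summable_geometric)
  finally have "(\<integral>\<^sup>+x. (\<Sum>k. ennreal (2 ^ k * (cmod (d k x))\<^sup>2)) \<partial>M) \<noteq> \<infinity>"
    by (subst nn_integral_suminf) (auto simp: top_unique)
  then have "AE x in M. (\<Sum>k. ennreal (2 ^ k * (cmod (d k x))\<^sup>2)) \<noteq> \<infinity>"
    by (intro nn_integral_noteq_infinite) measurable
  then show ?thesis
  proof eventually_elim
    case (elim x)
    then have "summable (\<lambda>k. 2 ^ k * (cmod (d k x))\<^sup>2)"
      by (intro summable_suminf_not_top) auto
    then have "summable (\<lambda>k. d k x)" by (rule summable_if_summable_geometric_power2)
    then have "convergent (\<lambda>n. (\<Sum>k<n. d k x) + f 0 x)"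
      by (intro convergent_add convergent_const) (simp add: summable_iff_convergent)
    moreover have "(\<Sum>k<n. d k x) = f n x - f 0 x" for n
      unfolding d_def by (rule sum_lessThan_telescope)
    ultimately show ?case by simp
  qed
qed

lemma L2_complete:
  fixes f :: "nat \<Rightarrow> 'x \<Rightarrow> complex"
  assumes f: "\<And>n. square_integrable M (f n)"
    and Cauchy: "\<And>e. e > 0 \<Longrightarrow> \<exists>N. \<forall>m\<ge>N. \<forall>k\<ge>N. L2_dist M (f m) (f k) < e"
  shows "\<exists>g. square_integrable M g \<and> (\<lambda>n. L2_dist M (f n) g) \<longlonglongrightarrow> 0"
proof -
  note [measurable] = square_integrable_measurable[OF f]
  obtain N where N: "\<And>i m k. m \<ge> N i \<Longrightarrow> k \<ge> N i \<Longrightarrow> L2_dist M (f m) (f k) < (1/2) ^ i"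
    using Cauchy[of "(1/2) ^ _"] by (metis half_gt_zero_iff zero_less_one zero_less_power)
  define r where "r k = (\<Sum>i\<le>k. N i)" for k
  have r_ge: "N i \<le> r k" if "i \<le> k" for i k using that by (simp add: r_def member_le_sum)
  have "AE x in M. convergent (\<lambda>k. f (r k) x)"
  proof (rule L2_rapidly_Cauchy_AE_convergent[OF f])
    show "L2_dist M (f (r (Suc k))) (f (r k)) \<le> (1/2) ^ k" for k
      using N[of k "r (Suc k)" "r k"] r_ge[of k k] r_ge[of k "Suc k"] by simp
  qed
  then have lim: "AE x in M. (\<lambda>k. f (r k) x) \<longlonglongrightarrow> lim (\<lambda>k. f (r k) x)"
    by (simp add: convergent_LIMSEQ_iff)
  define g where "g x = lim (\<lambda>k. f (r k) x)" for x
  have [measurable]: "g \<in> borel_measurable M" unfolding g_def[abs_def] by measurable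
  have near: "square_integrable M (\<lambda>x. f m x - g x) \<and> L2_dist M (f m) g \<le> (1/2) ^ i" if m: "m \<ge> N i" for m i
  proof -
    have "AE x in M. (\<lambda>k. f m x - f (r k) x) \<longlonglongrightarrow> f m x - g x"
      using lim by eventually_elim (auto simp: g_def intro: tendsto_intros)
    moreover have "\<forall>\<^sub>F k in sequentially. L2_dist M (f m) (f (r k)) \<le> (1/2) ^ i"
      using eventually_ge_at_top[of i] by eventually_elim (rule less_imp_le[OF N[OF m r_ge]])
    ultimately show ?thesis
      using L2_norm_limit_le[of M "\<lambda>k x. f m x - f (r k) x" "\<lambda>x. f m x - g x" "(1/2) ^ i"]
      by (simp add: square_integrable_diff f)
  qed
  have "square_integrable M (\<lambda>x. f (N 0) x - g x)" using near by blast
  from square_integrable_diff[OF f this, of "N 0"] have "square_integrable M g" by simp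
  moreover have "(\<lambda>n. L2_dist M (f n) g) \<longlonglongrightarrow> 0"
  proof (rule LIMSEQ_I)
    fix e :: real assume "e > 0"
    then obtain i where "(1/2 :: real) ^ i < e" using real_arch_pow_inv[of e "1/2"] by auto
    then show "\<exists>no. \<forall>n\<ge>no. norm (L2_dist M (f n) g - 0) < e"
      using near[of i] by (intro exI[of _ "N i"]) force
  qed
  ultimately show ?thesis by blast
qed

section \<open>Representations on square integrable functions\<close>

locale L2_isometry = hilbert_space sc ip
  for sc :: "complex \<Rightarrow> 'h::ab_group_add \<Rightarrow> 'h" and ip :: "'h \<Rightarrow> 'h \<Rightarrow> complex" +
  fixes M :: "'x measure" and \<gamma> :: "'h \<Rightarrow> 'x \<Rightarrow> complex"
  assumes square_integrable_\<gamma>: "square_integrable M (\<gamma> h)"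
    and L2_inner_\<gamma>: "L2_inner M (\<gamma> h) (\<gamma> k) = ip h k"
begin

lemma measurable_\<gamma> [measurable]: "\<gamma> h \<in> borel_measurable M"
  by (rule square_integrable_measurable[OF square_integrable_\<gamma>])

lemma L2_norm_\<gamma>: "L2_norm M (\<gamma> h) = \<parallel>h\<parallel>"
proof -
  have "complex_of_real ((L2_norm M (\<gamma> h))\<^sup>2) = complex_of_real (\<parallel>h\<parallel>\<^sup>2)"
    by (simp only: L2_inner_\<gamma> flip: L2_inner_self ip_self)
  then show ?thesis by (simp del: of_real_power)
qed

lemma \<gamma>_linear: "AE x in M. \<gamma> (sc a h + k) x = a * \<gamma> h x + \<gamma> k x"
proof -
  let ?d = "\<lambda>x. \<gamma> (sc a h + k) x - (a * \<gamma> h x + \<gamma> k x)"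
  have sum: "square_integrable M (\<lambda>x. a * \<gamma> h x + \<gamma> k x)"
    by (intro square_integrable_add square_integrable_cmult square_integrable_\<gamma>)
  have d: "square_integrable M ?d" by (intro square_integrable_diff square_integrable_\<gamma> sum)
  have "L2_inner M ?d (\<gamma> y) = 0" for y
    by (simp add: L2_inner_diff_left[OF square_integrable_\<gamma> sum] L2_inner_linear_left square_integrable_\<gamma>
        L2_inner_\<gamma> ip_simps)
  then have orth: "L2_inner M (\<gamma> y) ?d = 0" for y using L2_inner_commute[of M "\<gamma> y" ?d] by simp
  have "L2_inner M ?d ?d = 0"
    by (simp only: L2_inner_diff_left[OF square_integrable_\<gamma> sum d] L2_inner_linear_left[OF square_integrable_\<gamma> square_integrable_\<gamma> d] orth)
      simp
  then have "L2_norm M ?d = 0" by (simp add: L2_inner_self)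
  from L2_norm_eq_0_AE[OF d this] show ?thesis by eventually_elim simp
qed

lemma \<gamma>_diff: "AE x in M. \<gamma> (h - k) x = \<gamma> h x - \<gamma> k x"
  using \<gamma>_linear[of "-1" k h] by simp

lemma \<gamma>_0: "AE x in M. \<gamma> 0 x = 0"
  using L2_norm_eq_0_AE[OF square_integrable_\<gamma>, of 0] by (simp add: L2_norm_\<gamma>)

lemma L2_dist_\<gamma>: "L2_dist M (\<gamma> h) (\<gamma> k) = \<parallel>h - k\<parallel>"
  using L2_norm_cong_AE[OF _ _ \<gamma>_diff[of h k]] L2_norm_\<gamma>[of "h - k"] by simp

lemma \<gamma>_AE_subseq:
  assumes "hlim X h"
  obtains r :: "nat \<Rightarrow> nat" where "strict_mono r" "AE x in M. (\<lambda>n. \<gamma> (X (r n)) x) \<longlonglongrightarrow> \<gamma> h x"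
  using L2_AE_subseq[OF square_integrable_\<gamma> square_integrable_\<gamma>, of X h] assms
  by (auto simp: hlim_iff L2_dist_\<gamma>)

lemma \<gamma>_AE_limit:
  assumes X: "hlim X h" and f: "AE x in M. (\<lambda>n. \<gamma> (X n) x) \<longlonglongrightarrow> f x"
  shows "AE x in M. \<gamma> h x = f x"
proof -
  obtain r :: "nat \<Rightarrow> nat" where r: "strict_mono r" "AE x in M. (\<lambda>n. \<gamma> (X (r n)) x) \<longlonglongrightarrow> \<gamma> h x"
    using \<gamma>_AE_subseq[OF X] .
  from r(2) f show ?thesis
  proof eventually_elim
    case (elim x)
    have "(\<lambda>n. \<gamma> (X (r n)) x) \<longlonglongrightarrow> f x"
      using LIMSEQ_subseq_LIMSEQ[OF elim(2) r(1)] by (simp add: comp_def)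
    with elim(1) show ?case by (rule LIMSEQ_unique)
  qed
qed

definition acts_as :: "('h \<Rightarrow> 'h) \<Rightarrow> ('x \<Rightarrow> complex) \<Rightarrow> bool" where
  "acts_as A Z \<longleftrightarrow> (\<forall>h. AE x in M. \<gamma> (A h) x = Z x * \<gamma> h x)"

lemma acts_asD: "acts_as A Z \<Longrightarrow> AE x in M. \<gamma> (A h) x = Z x * \<gamma> h x"
  by (simp add: acts_as_def)

lemma acts_as_id: "acts_as (\<lambda>h. h) (\<lambda>x. 1)"
  by (simp add: acts_as_def)

lemma acts_as_comp:
  assumes "acts_as A Z" "acts_as B W"
  shows "acts_as (\<lambda>h. A (B h)) (\<lambda>x. Z x * W x)"
  unfolding acts_as_def
proof
  fix h
  from acts_asD[OF assms(1), of "B h"] acts_asD[OF assms(2), of h]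
  show "AE x in M. \<gamma> (A (B h)) x = Z x * W x * \<gamma> h x" by eventually_elim simp
qed

lemma acts_as_funpow: "acts_as A Z \<Longrightarrow> acts_as (A ^^ n) (\<lambda>x. Z x ^ n)"
proof (induction n)
  case (Suc n)
  from acts_as_comp[OF Suc.prems Suc.IH[OF Suc.prems]] show ?case by (simp add: comp_def)
qed (use acts_as_id in \<open>simp add: id_def\<close>)

lemma acts_as_linear:
  assumes "acts_as A Z" "acts_as B W"
  shows "acts_as (\<lambda>h. sc a (A h) + B h) (\<lambda>x. a * Z x + W x)"
  unfolding acts_as_def
proof
  fix h
  from acts_asD[OF assms(1), of h] acts_asD[OF assms(2), of h] \<gamma>_linear[of a "A h" "B h"]
  show "AE x in M. \<gamma> (sc a (A h) + B h) x = (a * Z x + W x) * \<gamma> h x"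
    by eventually_elim (simp add: algebra_simps)
qed

lemma acts_as_zero: "acts_as (\<lambda>h. 0) (\<lambda>x. 0)"
  using \<gamma>_0 by (simp add: acts_as_def)

lemma acts_as_scale: "acts_as A Z \<Longrightarrow> acts_as (\<lambda>h. sc a (A h)) (\<lambda>x. a * Z x)"
  using acts_as_linear[OF _ acts_as_zero] by simp

lemma acts_as_sum: "(\<And>i. i \<in> I \<Longrightarrow> acts_as (A i) (Z i)) \<Longrightarrow> acts_as (\<lambda>h. \<Sum>i\<in>I. A i h) (\<lambda>x. \<Sum>i\<in>I. Z i x)"
proof (induction I rule: infinite_finite_induct)
  case (insert i I)
  then have "acts_as (\<lambda>h. sc 1 (A i h) + (\<Sum>i\<in>I. A i h)) (\<lambda>x. 1 * Z i x + (\<Sum>i\<in>I. Z i x))"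
    by (intro acts_as_linear) auto
  with insert.hyps show ?case by simp
qed (simp_all add: acts_as_zero)

lemma acts_as_limit:
  assumes A: "\<And>n. acts_as (A n) (Z n)" and B: "\<And>h. hlim (\<lambda>n. A n h) (B h)"
    and W: "AE x in M. (\<lambda>n. Z n x) \<longlonglongrightarrow> W x"
  shows "acts_as B W"
  unfolding acts_as_def
proof
  fix h
  have "AE x in M. \<forall>n. \<gamma> (A n h) x = Z n x * \<gamma> h x"
    unfolding AE_all_countable using acts_asD[OF A] by blast
  with W have "AE x in M. (\<lambda>n. \<gamma> (A n h) x) \<longlonglongrightarrow> W x * \<gamma> h x"
    by eventually_elim (auto intro: tendsto_mult_right)
  then show "AE x in M. \<gamma> (B h) x = W x * \<gamma> h x" by (rule \<gamma>_AE_limit[OF B])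
qed

lemma closed_subspace_multiplied:
  assumes A: "bounded_op A"
  shows "closed_subspace {h. AE x in M. \<gamma> (A h) x = Z x * \<gamma> h x}" (is "closed_subspace ?K")
proof (rule closed_subspaceI)
  have linear: "sc a h + k \<in> ?K" if "h \<in> ?K" "k \<in> ?K" for a h k
    using that[simplified] \<gamma>_linear[of a h k] \<gamma>_linear[of a "A h" "A k"]
    by (simp add: bounded_op_map_add[OF A] bounded_op_map_scale[OF A], eventually_elim) (simp add: algebra_simps)
  show "0 \<in> ?K" using \<gamma>_0 by (auto simp: bounded_op_map_0[OF A])
  then show "sc a h \<in> ?K" if "h \<in> ?K" for a h using linear[OF that, of 0 a] by simp
  show "h + k \<in> ?K" if "h \<in> ?K" "k \<in> ?K" for h k using linear[OF that, of 1] by simp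
  fix X h assume X: "\<And>n. X n \<in> ?K" "hlim X h"
  obtain r :: "nat \<Rightarrow> nat" where r: "strict_mono r" "AE x in M. (\<lambda>n. \<gamma> (X (r n)) x) \<longlonglongrightarrow> \<gamma> h x"
    using \<gamma>_AE_subseq[OF X(2)] .
  have "AE x in M. \<forall>n. \<gamma> (A (X (r n))) x = Z x * \<gamma> (X (r n)) x"
    unfolding AE_all_countable using X(1) by simp
  with r(2) have "AE x in M. (\<lambda>n. \<gamma> (A (X (r n))) x) \<longlonglongrightarrow> Z x * \<gamma> h x"
    by eventually_elim (auto intro: tendsto_mult_left)
  moreover have "hlim (\<lambda>n. X (r n)) h"
    using LIMSEQ_subseq_LIMSEQ[OF X(2)[unfolded hlim_iff] r(1)] by (simp add: hlim_iff comp_def)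
  ultimately show "h \<in> ?K" using \<gamma>_AE_limit[OF hlim_bounded_op[OF A]] by simp
qed

end

locale L2_representation = hilbert_space sc ip
  for sc :: "complex \<Rightarrow> 'h::ab_group_add \<Rightarrow> 'h" and ip :: "'h \<Rightarrow> 'h \<Rightarrow> complex" +
  fixes M :: "'x measure" and \<gamma> :: "'h \<Rightarrow> 'x \<Rightarrow> complex"
  assumes semifinite: "semifinite M" and unitary: "unitary_to_L2 ip M \<gamma>"
begin

sublocale L2_isometry sc ip M \<gamma>
  using unitary by unfold_locales (simp_all add: unitary_to_L2_def)

lemma \<gamma>_surj: "square_integrable M f \<Longrightarrow> \<exists>h. AE x in M. \<gamma> h x = f x"
  using unitary by (simp add: unitary_to_L2_def)

lemma AE_if_AE_finite:
  assumes Q: "{x \<in> space M. Q x} \<in> sets M"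
    and finite: "\<And>B h. B \<in> sets M \<Longrightarrow> AE x in M. \<gamma> h x = indicator B x \<Longrightarrow> AE x in M. x \<in> B \<longrightarrow> Q x"
  shows "AE x in M. Q x"
proof (rule semifinite_AE_I[OF semifinite Q])
  fix B assume B: "B \<in> sets M" "emeasure M B < \<infinity>"
  have "(\<lambda>x. (cmod (indicator B x))\<^sup>2) = (indicator B :: _ \<Rightarrow> real)" by (auto simp: indicator_def)
  then have "square_integrable M (indicator B)" using B by (simp add: square_integrable_def)
  then obtain h where "AE x in M. \<gamma> h x = indicator B x" using \<gamma>_surj by blast
  then show "AE x in M. x \<in> B \<longrightarrow> Q x" by (rule finite[OF B(1)])
qed

lemma acts_as_unique:
  assumes [measurable]: "Z \<in> borel_measurable M" "W \<in> borel_measurable M"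
    and A: "acts_as A Z" "acts_as A W"
  shows "AE x in M. Z x = W x"
proof (rule AE_if_AE_finite)
  show "{x \<in> space M. Z x = W x} \<in> sets M" by measurable
  fix B h assume "AE x in M. \<gamma> h x = indicator B x"
  with acts_asD[OF A(1), of h] acts_asD[OF A(2), of h] show "AE x in M. x \<in> B \<longrightarrow> Z x = W x"
    by eventually_elim (auto simp: indicator_def)
qed

text \<open>Fatou's lemma bounds the integral of \<open>liminf \<bar>Z\<bar>\<^sup>2\<^sup>n\<close> over sets of finite measure.\<close>

lemma cmod_le_1_if_acts_as_contraction:
  assumes Z [measurable]: "Z \<in> borel_measurable M" and A: "contraction sc ip A" "acts_as A Z"
  shows "AE x in M. cmod (Z x) \<le> 1"
proof (rule AE_if_AE_finite)
  show "{x \<in> space M. cmod (Z x) \<le> 1} \<in> sets M" by measurable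
  fix B h assume h: "AE x in M. \<gamma> h x = indicator B x"
  have "\<parallel>(A ^^ n) h\<parallel> \<le> \<parallel>h\<parallel>" for n
    by (induction n) (auto intro: order_trans[OF contraction_le[OF A(1)]])
  then have "(\<integral>\<^sup>+x. liminf (\<lambda>n. ennreal ((cmod (\<gamma> ((A ^^ n) h) x))\<^sup>2)) \<partial>M) \<le> ennreal (\<parallel>h\<parallel>\<^sup>2)"
    by (intro L2_Fatou square_integrable_\<gamma>) (simp add: L2_norm_\<gamma>)
  also have "\<dots> < \<infinity>" by simp
  finally have "AE x in M. liminf (\<lambda>n. ennreal ((cmod (\<gamma> ((A ^^ n) h) x))\<^sup>2)) \<noteq> \<infinity>"
    by (intro nn_integral_noteq_infinite) auto
  moreover have "AE x in M. \<forall>n. \<gamma> ((A ^^ n) h) x = Z x ^ n * \<gamma> h x"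
    unfolding AE_all_countable using acts_asD[OF acts_as_funpow[OF A(2)]] by blast
  ultimately show "AE x in M. x \<in> B \<longrightarrow> cmod (Z x) \<le> 1"
    using h
  proof eventually_elim
    case (elim x)
    show ?case
    proof (intro impI leI notI)
      assume x: "x \<in> B" and "1 < cmod (Z x)"
      then have "filterlim (\<lambda>n. (cmod (Z x ^ n))\<^sup>2) at_top sequentially"
        by (intro filterlim_pow_at_top filterlim_at_infinity_imp_norm_at_top filterlim_realpow_sequentially_gt1) auto
      then have "(\<lambda>n. ennreal ((cmod (\<gamma> ((A ^^ n) h) x))\<^sup>2)) \<longlonglongrightarrow> \<infinity>"
        using elim(2,3) x by (simp add: ennreal_tendsto_top_eq_at_top)
      then show False using elim(1) lim_imp_Liminf[OF trivial_limit_sequentially] by blast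
    qed
  qed
qed

end

section \<open>The multiplication model of a family of commuting projections\<close>

context commuting_projections
begin

definition spectral_measure :: "'h \<Rightarrow> (nat \<Rightarrow> complex) measure" where
  "spectral_measure v = (SOME \<mu>. sets \<mu> = sets cylinder_algebra \<and>
     (\<forall>ks. emeasure \<mu> (cylinder ks) = ennreal (\<parallel>foldr P ks v\<parallel>\<^sup>2)))"

lemma sets_spectral_measure: "sets (spectral_measure v) = sets cylinder_algebra"
  and emeasure_spectral_measure: "emeasure (spectral_measure v) (cylinder ks) = ennreal (\<parallel>foldr P ks v\<parallel>\<^sup>2)"
  using someI_ex[OF spectral_measure_exists[of v]] unfolding spectral_measure_def by blast+

end

locale cyclic_decomposition = commuting_projections sc ip P
  for sc :: "complex \<Rightarrow> 'h::ab_group_add \<Rightarrow> 'h" and ip :: "'h \<Rightarrow> 'h \<Rightarrow> complex" and P :: "nat \<Rightarrow> 'h \<Rightarrow> 'h" +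
  fixes S :: "'h set"
  assumes cyclic_orthogonal: "v \<in> S \<Longrightarrow> w \<in> S \<Longrightarrow> v \<noteq> w \<Longrightarrow> ip (foldr P ks v) w = 0"
    and cyclic_total: "(\<And>v ks. v \<in> S \<Longrightarrow> ip x (foldr P ks v) = 0) \<Longrightarrow> x = 0"

lemma (in commuting_projections) cyclic_decomposition_exists:
  obtains S where "cyclic_decomposition sc ip P S"
proof -
  define \<C> where "\<C> = {S. \<forall>v\<in>S. \<forall>w\<in>S. v \<noteq> w \<longrightarrow> (\<forall>ks. ip (foldr P ks v) w = 0)}"
  have "\<exists>S\<in>\<C>. \<forall>X\<in>\<C>. S \<subseteq> X \<longrightarrow> X = S"
  proof (rule subset_Zorn_nonempty)
    show "\<C> \<noteq> {}" unfolding \<C>_def by blast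
    fix \<K> assume K: "\<K> \<noteq> {}" "subset.chain \<C> \<K>"
    show "\<Union>\<K> \<in> \<C>" unfolding \<C>_def
    proof (intro CollectI ballI impI allI)
      fix v w ks assume "v \<in> \<Union>\<K>" "w \<in> \<Union>\<K>" and "v \<noteq> w"
      then obtain A B where A: "A \<in> \<K>" "v \<in> A" and B: "B \<in> \<K>" "w \<in> B" by blast
      have "A \<subseteq> B \<or> B \<subseteq> A" using K(2) A(1) B(1) unfolding subset_chain_def by blast
      then obtain C where "C \<in> \<K>" "v \<in> C" "w \<in> C" using A B by blast
      moreover have "\<K> \<subseteq> \<C>" using K(2) unfolding subset_chain_def by blast
      ultimately show "ip (foldr P ks v) w = 0" using \<open>v \<noteq> w\<close> unfolding \<C>_def by blast
    qed
  qed
  then obtain S where S: "S \<in> \<C>" and maximal: "\<And>X. X \<in> \<C> \<Longrightarrow> S \<subseteq> X \<Longrightarrow> X = S" by blast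
  have "x = 0" if x: "\<And>v ks. v \<in> S \<Longrightarrow> ip x (foldr P ks v) = 0" for x
  proof -
    have "ip (foldr P ks x) v = 0" "ip (foldr P ks v) x = 0" if "v \<in> S" for v ks
      using x[OF that, of ks] ip_eq_0_commute[of x] by (simp_all add: ip_foldr_left)
    then have "insert x S \<in> \<C>" using S unfolding \<C>_def by auto
    from maximal[OF this] have "x \<in> S" by blast
    from x[OF this, of "[]"] show "x = 0" using ip_self_eq_0D by simp
  qed
  moreover have "ip (foldr P ks v) w = 0" if "v \<in> S" "w \<in> S" "v \<noteq> w" for v w ks
    using S that unfolding \<C>_def by blast
  ultimately show thesis by (intro that[of S]) (unfold_locales, auto)
qed

context cyclic_decomposition
begin

lemma closed_subspace_eq_UNIV_if_generators:
  assumes K: "closed_subspace K" and generators: "\<And>v ks. v \<in> S \<Longrightarrow> foldr P ks v \<in> K"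
  shows "K = UNIV"
  by (rule closed_subspace_eq_UNIV[OF K]) (blast intro: cyclic_total perpD generators)

definition model_measure :: "('h \<times> (nat \<Rightarrow> complex)) measure" (\<open>\<mu>\<close>) where
  "\<mu> = slice_sum S cylinder_algebra spectral_measure"

lemmas slice_sum_facts = space_cylinder_algebra sets_spectral_measure

lemma space_model_measure: "space \<mu> = UNIV"
  by (simp add: model_measure_def space_slice_sum)

lemma sets_model_measure: "A \<in> sets \<mu> \<longleftrightarrow> (\<forall>v. Pair v -` A \<in> sets cylinder_algebra)"
  by (simp add: model_measure_def sets_slice_sum)

lemma sets_model_slice: "A \<in> sets cylinder_algebra \<Longrightarrow> {v} \<times> A \<in> sets \<mu>"
  unfolding model_measure_def by (rule sets_slice[OF slice_sum_facts])

lemma emeasure_slice_cylinder: "v \<in> S \<Longrightarrow> emeasure \<mu> ({v} \<times> cylinder ks) = ennreal (\<parallel>foldr P ks v\<parallel>\<^sup>2)"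
  unfolding model_measure_def by (simp add: emeasure_slice[OF slice_sum_facts] emeasure_spectral_measure)

lemma semifinite_model_measure: "semifinite \<mu>"
  unfolding model_measure_def
  by (rule semifinite_slice_sum[OF slice_sum_facts])
    (simp add: emeasure_spectral_measure flip: cylinder_Nil)

lemma AE_model_measureI:
  assumes "{x \<in> space \<mu>. Q x} \<in> sets \<mu>" "\<And>v. v \<in> S \<Longrightarrow> AE x in \<mu>. fst x = v \<longrightarrow> Q x"
  shows "AE x in \<mu>. Q x"
  unfolding model_measure_def
  by (rule AE_slice_sumI[OF slice_sum_facts])
    (use assms[unfolded model_measure_def space_slice_sum] in simp_all)

definition slice_ind :: "'h \<Rightarrow> nat list \<Rightarrow> 'h \<times> (nat \<Rightarrow> complex) \<Rightarrow> complex" where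
  "slice_ind v ks = indicator ({v} \<times> cylinder ks)"

lemma square_integrable_slice_ind:
  assumes v: "v \<in> S"
  shows "square_integrable \<mu> (slice_ind v ks)"
proof -
  have "(\<lambda>x. (cmod (slice_ind v ks x))\<^sup>2) = (indicator ({v} \<times> cylinder ks) :: _ \<Rightarrow> real)"
    by (auto simp: slice_ind_def indicator_def)
  then show ?thesis
    using sets_model_slice[OF sets_cylinder, of v ks]
    by (simp add: square_integrable_def slice_ind_def emeasure_slice_cylinder[OF v])
qed

lemma L2_inner_slice_ind:
  assumes v: "v \<in> S" and w: "w \<in> S"
  shows "L2_inner \<mu> (slice_ind v ks) (slice_ind w ls) = ip (foldr P ks v) (foldr P ls w)"
proof (cases "v = w")
  case True
  have "slice_ind v ks x * cnj (slice_ind w ls x) = of_real (indicator ({v} \<times> cylinder (ks @ ls)) x)" for x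
    using True by (auto simp: slice_ind_def indicator_def cylinder_append)
  then have "L2_inner \<mu> (slice_ind v ks) (slice_ind w ls) = of_real (measure \<mu> ({v} \<times> cylinder (ks @ ls)))"
    unfolding L2_inner_def by (simp only: integral_complex_of_real) (simp add: space_model_measure)
  also have "\<dots> = ip (foldr P ks v) (foldr P ls w)"
    using True by (simp add: measure_def emeasure_slice_cylinder[OF w] ip_foldr_foldr)
  finally show ?thesis .
next
  case False
  then have disjoint: "slice_ind v ks x * cnj (slice_ind w ls x) = 0" for x
    by (auto simp: slice_ind_def indicator_def)
  have "L2_inner \<mu> (slice_ind v ks) (slice_ind w ls) = 0" unfolding L2_inner_def disjoint by simp
  moreover have "ip (foldr P ks v) (foldr P ls w) = ip (foldr P (ls @ ks) v) w"
    by (simp add: ip_foldr_left)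
  ultimately show ?thesis using cyclic_orthogonal[OF v w False, of "ls @ ks"] by simp
qed

inductive elementary :: "'h \<Rightarrow> ('h \<times> (nat \<Rightarrow> complex) \<Rightarrow> complex) \<Rightarrow> bool" where
  zero: "elementary 0 (\<lambda>x. 0)"
| add: "elementary h f \<Longrightarrow> v \<in> S \<Longrightarrow>
    elementary (sc a (foldr P ks v) + h) (\<lambda>x. a * slice_ind v ks x + f x)"

lemma square_integrable_elementary: "elementary h f \<Longrightarrow> square_integrable \<mu> f"
  by (induction rule: elementary.induct)
    (simp_all add: square_integrable_zero square_integrable_add square_integrable_cmult square_integrable_slice_ind)

lemma elementary_generator: "v \<in> S \<Longrightarrow> elementary (foldr P ks v) (slice_ind v ks)"
  using elementary.add[OF elementary.zero, of v 1 ks] by simp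

lemma elementary_linear: "elementary h f \<Longrightarrow> elementary k g \<Longrightarrow> elementary (sc a h + k) (\<lambda>x. a * f x + g x)"
proof (induction rule: elementary.induct)
  case (add h f v b ks)
  then show ?case
    using elementary.add[of "sc a h + k" "\<lambda>x. a * f x + g x" v "a * b" ks]
    by (simp add: scale_right_distrib distrib_left mult.assoc add.assoc)
qed simp

lemma L2_inner_elementary_slice_ind:
  assumes "elementary h f" "v \<in> S"
  shows "L2_inner \<mu> f (slice_ind v ks) = ip h (foldr P ks v)"
  using assms
proof (induction rule: elementary.induct)
  case (add h f w a ls)
  then show ?case
    by (simp add: L2_inner_linear_left square_integrable_slice_ind square_integrable_elementary L2_inner_slice_ind ip_simps)
qed (simp add: L2_inner_def)

lemma L2_inner_elementary:
  assumes "elementary h f" "elementary k g"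
  shows "L2_inner \<mu> f g = ip h k"
  using assms
proof (induction rule: elementary.induct)
  case (add h f v a ks)
  have "L2_inner \<mu> (slice_ind v ks) g = ip (foldr P ks v) k"
    using arg_cong[OF L2_inner_elementary_slice_ind[OF add.prems add.hyps(2)], of cnj]
    by (simp flip: L2_inner_commute ip_commute)
  then show ?case
    using add by (simp add: L2_inner_linear_left square_integrable_slice_ind square_integrable_elementary ip_simps)
qed (simp add: L2_inner_def)

lemma L2_norm_elementary:
  assumes "elementary h f"
  shows "L2_norm \<mu> f = \<parallel>h\<parallel>"
proof -
  have "complex_of_real ((L2_norm \<mu> f)\<^sup>2) = of_real (\<parallel>h\<parallel>\<^sup>2)"
    using L2_inner_elementary[OF assms assms] by (simp only: L2_inner_self ip_self)
  then show ?thesis by (simp del: of_real_power)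
qed

definition represents :: "'h \<Rightarrow> ('h \<times> (nat \<Rightarrow> complex) \<Rightarrow> complex) \<Rightarrow> bool" where
  "represents h f \<longleftrightarrow> square_integrable \<mu> f \<and>
     (\<exists>X g. (\<forall>n. elementary (X n) (g n)) \<and> hlim X h \<and> (\<lambda>n. L2_dist \<mu> (g n) f) \<longlonglongrightarrow> 0)"

lemma representsE:
  assumes "represents h f"
  obtains X g where "\<And>n. elementary (X n) (g n)" "hlim X h" "(\<lambda>n. L2_dist \<mu> (g n) f) \<longlonglongrightarrow> 0"
  using assms unfolding represents_def by blast

lemma square_integrable_represents: "represents h f \<Longrightarrow> square_integrable \<mu> f"
  by (simp add: represents_def)

lemma represents_elementary: "elementary h f \<Longrightarrow> represents h f"
  unfolding represents_def
  by (auto simp: square_integrable_elementary intro!: exI[of _ "\<lambda>_. h"] exI[of _ "\<lambda>_. f"])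

lemma represents_linear:
  assumes f: "represents h f" and g: "represents k g"
  shows "represents (sc a h + k) (\<lambda>x. a * f x + g x)"
proof -
  note sqi = square_integrable_represents[OF f] square_integrable_represents[OF g]
  obtain X u where X: "\<And>n. elementary (X n) (u n)" "hlim X h" "(\<lambda>n. L2_dist \<mu> (u n) f) \<longlonglongrightarrow> 0"
    using f by (rule representsE) blast
  obtain Y v where Y: "\<And>n. elementary (Y n) (v n)" "hlim Y k" "(\<lambda>n. L2_dist \<mu> (v n) g) \<longlonglongrightarrow> 0"
    using g by (rule representsE) blast
  have "(\<lambda>n. L2_norm \<mu> (\<lambda>x. (a * u n x + v n x) - (a * f x + g x))) \<longlonglongrightarrow> 0"
  proof (rule tendsto_sandwich[OF _ _ tendsto_const])
    have "L2_norm \<mu> (\<lambda>x. a * (u n x - f x) + (v n x - g x)) \<le> cmod a * L2_dist \<mu> (u n) f + L2_dist \<mu> (v n) g" for n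
      using L2_norm_triangle_ineq[of \<mu> "\<lambda>x. a * (u n x - f x)" "\<lambda>x. v n x - g x"]
      by (simp add: sqi square_integrable_elementary[OF X(1)] square_integrable_elementary[OF Y(1)]
          square_integrable_cmult square_integrable_diff L2_norm_cmult)
    then show "\<forall>\<^sub>F n in sequentially. L2_norm \<mu> (\<lambda>x. (a * u n x + v n x) - (a * f x + g x))
        \<le> cmod a * L2_dist \<mu> (u n) f + L2_dist \<mu> (v n) g"
      by (simp add: algebra_simps)
    show "(\<lambda>n. cmod a * L2_dist \<mu> (u n) f + L2_dist \<mu> (v n) g) \<longlonglongrightarrow> 0"
      using tendsto_add[OF tendsto_mult_right_zero[OF X(3)] Y(3)] by simp
  qed simp
  moreover have "hlim (\<lambda>n. sc a (X n) + Y n) (sc a h + k)" by (intro hlim_add hlim_scale X Y)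
  ultimately show ?thesis
    unfolding represents_def using sqi elementary_linear[OF X(1) Y(1)]
    by (auto intro!: square_integrable_add square_integrable_cmult exI[of _ "\<lambda>n. sc a (X n) + Y n"]
        exI[of _ "\<lambda>n x. a * u n x + v n x"])
qed

lemma represents_add: "represents h f \<Longrightarrow> represents k g \<Longrightarrow> represents (h + k) (\<lambda>x. f x + g x)"
  using represents_linear[of h f k g 1] by simp

lemma represents_scale: "represents h f \<Longrightarrow> represents (sc a h) (\<lambda>x. a * f x)"
  using represents_linear[OF _ represents_elementary[OF elementary.zero], of h f a] by simp

lemma represents_diff: "represents h f \<Longrightarrow> represents k g \<Longrightarrow> represents (h - k) (\<lambda>x. f x - g x)"
  using represents_linear[of k g h f "-1"] by simp

lemma L2_norm_represents:
  assumes "represents h f"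
  shows "L2_norm \<mu> f = \<parallel>h\<parallel>"
proof -
  obtain X g where X: "\<And>n. elementary (X n) (g n)" "hlim X h" "(\<lambda>n. L2_dist \<mu> (g n) f) \<longlonglongrightarrow> 0"
    using assms by (rule representsE) blast
  have "(\<lambda>n. \<parallel>X n\<parallel>) \<longlonglongrightarrow> L2_norm \<mu> f"
    using L2_norm_tendsto[OF square_integrable_elementary[OF X(1)] square_integrable_represents[OF assms] X(3)]
    by (simp add: L2_norm_elementary[OF X(1)])
  then show ?thesis using hlim_hnorm[OF X(2)] by (rule LIMSEQ_unique)
qed

lemma L2_inner_represents:
  assumes f: "represents h f" and g: "represents k g"
  shows "L2_inner \<mu> f g = ip h k"
proof -
  have Re: "Re (L2_inner \<mu> f g) = Re (ip h k)" if "represents h f" for h f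
    using L2_norm_add_power2[OF square_integrable_represents[OF that] square_integrable_represents[OF g]]
    unfolding L2_norm_represents[OF represents_add[OF that g]] L2_norm_represents[OF that] L2_norm_represents[OF g]
    by (simp add: hnorm_add_power2)
  have "L2_inner \<mu> (\<lambda>x. \<i> * f x) g = \<i> * L2_inner \<mu> f g"
    unfolding L2_inner_def by (simp add: mult.assoc)
  then have "Im (L2_inner \<mu> f g) = Im (ip h k)"
    using Re[OF represents_scale[OF f, of \<i>]] by (simp add: ip_scale_left)
  then show ?thesis using Re[OF f] by (simp add: complex_eq_iff)
qed

lemma represents_unique_AE:
  assumes "represents h f" "represents h g"
  shows "AE x in \<mu>. f x = g x"
proof -
  have "represents 0 (\<lambda>x. f x - g x)" using represents_diff[OF assms] by simp
  from L2_norm_eq_0_AE[OF square_integrable_represents[OF this]] L2_norm_represents[OF this] show ?thesis by simp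
qed

lemma represents_limit:
  assumes R: "\<And>n. represents (X n) (g n)" and X: "hlim X h"
    and f: "square_integrable \<mu> f" and g: "(\<lambda>n. L2_dist \<mu> (g n) f) \<longlonglongrightarrow> 0"
  shows "represents h f"
proof -
  define e :: "nat \<Rightarrow> real" where "e n = 1 / real (Suc n)" for n
  have e: "e \<longlonglongrightarrow> 0" unfolding e_def by (rule LIMSEQ_Suc[OF lim_1_over_n])
  have "\<exists>k u. elementary k u \<and> \<parallel>k - X n\<parallel> \<le> e n \<and> L2_dist \<mu> u (g n) \<le> e n" for n
  proof -
    obtain Y u where Y: "\<And>i. elementary (Y i) (u i)" "hlim Y (X n)" "(\<lambda>i. L2_dist \<mu> (u i) (g n)) \<longlonglongrightarrow> 0"
      using R by (rule representsE) blast
    have "e n > 0" by (simp add: e_def)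
    then have "\<forall>\<^sub>F i in sequentially. \<parallel>Y i - X n\<parallel> < e n \<and> L2_dist \<mu> (u i) (g n) < e n"
      using Y(2,3) unfolding hlim_iff by (intro eventually_conj order_tendstoD(2)[of _ 0])
    then obtain i where "\<parallel>Y i - X n\<parallel> < e n" "L2_dist \<mu> (u i) (g n) < e n"
      by (auto simp: eventually_sequentially)
    then show ?thesis using Y(1)[of i] less_imp_le by blast
  qed
  then obtain k u where k: "\<And>n. elementary (k n) (u n)" "\<And>n. \<parallel>k n - X n\<parallel> \<le> e n"
    "\<And>n. L2_dist \<mu> (u n) (g n) \<le> e n" by metis
  have "hlim k h"
  proof (rule hlim_sandwich)
    show "\<parallel>k n - h\<parallel> \<le> e n + \<parallel>X n - h\<parallel>" for n
      using metric.triangle[of "k n" "X n" h] k(2)[of n] by simp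
    show "(\<lambda>n. e n + \<parallel>X n - h\<parallel>) \<longlonglongrightarrow> 0" using tendsto_add[OF e X[unfolded hlim_iff]] by simp
  qed
  moreover have "(\<lambda>n. L2_dist \<mu> (u n) f) \<longlonglongrightarrow> 0"
  proof (rule tendsto_sandwich[OF _ _ tendsto_const])
    have "L2_dist \<mu> (u n) f \<le> e n + L2_dist \<mu> (g n) f" for n
      using L2_dist_triangle[OF square_integrable_elementary[OF k(1)] square_integrable_represents[OF R] f, of n n] k(3)[of n]
      by simp
    then show "\<forall>\<^sub>F n in sequentially. L2_dist \<mu> (u n) f \<le> e n + L2_dist \<mu> (g n) f" by simp
    show "(\<lambda>n. e n + L2_dist \<mu> (g n) f) \<longlonglongrightarrow> 0" using tendsto_add[OF e g] by simp
  qed simp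
  ultimately show ?thesis unfolding represents_def using f k(1) by blast
qed

lemma represents_total: "\<exists>f. represents h f"
proof -
  have "closed_subspace {h. \<exists>f. represents h f}"
  proof (rule closed_subspaceI)
    fix X L assume X: "\<And>n. X n \<in> {h. \<exists>f. represents h f}" and lim: "hlim X L"
    then obtain g where g: "\<And>n. represents (X n) (g n)" by simp metis
    have dist: "L2_dist \<mu> (g m) (g k) = \<parallel>X m - X k\<parallel>" for m k
      by (rule L2_norm_represents[OF represents_diff[OF g g]])
    have "metric.MCauchy X" by (rule metric.convergent_imp_MCauchy[OF _ lim]) simp
    then have "\<exists>N. \<forall>m\<ge>N. \<forall>k\<ge>N. L2_dist \<mu> (g m) (g k) < e" if "e > 0" for e
      using that by (simp add: dist metric.MCauchy_def)
    from L2_complete[OF square_integrable_represents[OF g] this]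
    obtain f where "square_integrable \<mu> f" "(\<lambda>n. L2_dist \<mu> (g n) f) \<longlonglongrightarrow> 0" by blast
    from represents_limit[OF g lim this] show "L \<in> {h. \<exists>f. represents h f}" by blast
  qed (use represents_add represents_scale represents_elementary[OF elementary.zero] in blast)+
  then have "{h. \<exists>f. represents h f} = UNIV"
    by (rule closed_subspace_eq_UNIV_if_generators) (blast intro: represents_elementary elementary_generator)
  then show ?thesis by blast
qed

definition model_unitary :: "'h \<Rightarrow> 'h \<times> (nat \<Rightarrow> complex) \<Rightarrow> complex" (\<open>\<gamma>\<close>) where
  "\<gamma> h = (SOME f. represents h f)"

lemma represents_\<gamma>: "represents h (\<gamma> h)"
  unfolding model_unitary_def using represents_total by (rule someI_ex)

sublocale L2_isometry sc ip \<mu> \<gamma>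
  by unfold_locales (simp_all add: square_integrable_represents[OF represents_\<gamma>] L2_inner_represents[OF represents_\<gamma> represents_\<gamma>])

lemma \<gamma>_generator: "v \<in> S \<Longrightarrow> AE x in \<mu>. \<gamma> (foldr P ks v) x = slice_ind v ks x"
  by (rule represents_unique_AE[OF represents_\<gamma> represents_elementary[OF elementary_generator]])

lemma slice_ind_mult: "f x * cnj (slice_ind v ks x) = indicator ({v} \<times> cylinder ks) x *\<^sub>R f x"
  by (auto simp: slice_ind_def indicator_def)

lemma set_integrable_slice:
  assumes "square_integrable \<mu> f" "v \<in> S" "A \<in> sets cylinder_algebra"
  shows "set_integrable \<mu> ({v} \<times> A) f"
proof -
  have "set_integrable \<mu> ({v} \<times> UNIV) f"
    using integrable_L2_inner[OF assms(1) square_integrable_slice_ind[OF assms(2), of "[]"]]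
    by (simp add: slice_ind_mult set_integrable_def cylinder_Nil)
  then show ?thesis by (rule set_integrable_subset[OF _ sets_model_slice[OF assms(3)]]) auto
qed

lemma set_integral_slice_eq_0:
  assumes f: "square_integrable \<mu> f" and v: "v \<in> S"
    and orth: "\<And>ks. L2_inner \<mu> f (slice_ind v ks) = 0" and A: "A \<in> sets cylinder_algebra"
  shows "(LINT x:{v} \<times> A|\<mu>. f x) = 0"
proof -
  have cylinder: "(LINT x:{v} \<times> cylinder ks|\<mu>. f x) = 0" for ks
    using orth[of ks] by (simp add: L2_inner_def slice_ind_mult set_lebesgue_integral_def)
  note integrable = set_integrable_slice[OF f v]
  have "range cylinder \<subseteq> Pow (UNIV :: (nat \<Rightarrow> complex) set)" by simp
  from Int_stable_cylinders this A[unfolded sets_cylinder_algebra] show ?thesis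
  proof (induction rule: sigma_sets_induct_disjoint)
    case (basic B)
    then show ?case using cylinder by auto
  next
    case empty
    show ?case by (simp add: set_lebesgue_integral_def)
  next
    case (compl B)
    then have B: "B \<in> sets cylinder_algebra" "UNIV - B \<in> sets cylinder_algebra"
      by (simp_all add: sets_cylinder_algebra sigma_sets.Compl)
    have "(LINT x:{v} \<times> B \<union> {v} \<times> (UNIV - B)|\<mu>. f x) = (LINT x:{v} \<times> B|\<mu>. f x) + (LINT x:{v} \<times> (UNIV - B)|\<mu>. f x)"
      by (intro set_integral_Un integrable B) auto
    moreover have "{v} \<times> B \<union> {v} \<times> (UNIV - B) = {v} \<times> cylinder []" by (auto simp: cylinder_Nil)
    ultimately show ?case using compl cylinder by simp
  next
    case (union B)
    then have B: "B i \<in> sets cylinder_algebra" for i by (auto simp: sets_cylinder_algebra)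
    have "{v} \<times> (\<Union>i. B i) = (\<Union>i. {v} \<times> B i)" by auto
    moreover have "(LINT x:(\<Union>i. {v} \<times> B i)|\<mu>. f x) = (\<Sum>i. LINT x:{v} \<times> B i|\<mu>. f x)"
    proof (rule lebesgue_integral_countable_add[OF sets_model_slice[OF B]])
      show "({v} \<times> B i) \<inter> ({v} \<times> B j) = {}" if "i \<noteq> j" for i j
        using union(1) that by (auto simp: disjoint_family_on_def)
      have "set_integrable \<mu> ({v} \<times> (\<Union>i. B i)) f" by (intro integrable sets.countable_UN) (use B in auto)
      then show "set_integrable \<mu> (\<Union>i. {v} \<times> B i) f" by (simp add: \<open>{v} \<times> (\<Union>i. B i) = (\<Union>i. {v} \<times> B i)\<close>)
    qed
    ultimately show ?case by (simp add: union)
  qed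
qed

lemma AE_eq_0_on_slice:
  assumes f: "square_integrable \<mu> f" and v: "v \<in> S" and orth: "\<And>ks. L2_inner \<mu> f (slice_ind v ks) = 0"
  shows "AE x in \<mu>. fst x = v \<longrightarrow> f x = 0"
proof -
  let ?F = "\<lambda>x. indicator ({v} \<times> UNIV) x *\<^sub>R f x"
  have "AE x in \<mu>. ?F x = 0"
  proof (rule density_unique_complex)
    show "integrable \<mu> ?F"
      using set_integrable_slice[OF f v sets.top] by (simp add: set_integrable_def)
    fix A assume "A \<in> sets \<mu>"
    then have "Pair v -` A \<in> sets cylinder_algebra" by (simp add: sets_model_measure)
    from set_integral_slice_eq_0[OF f v orth this] have "(LINT x:A|\<mu>. ?F x) = 0"
      by (rule back_subst[of "\<lambda>I. I = 0"])
        (auto simp: set_lebesgue_integral_def indicator_def intro!: Bochner_Integration.integral_cong)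
    then show "(LINT x:A|\<mu>. ?F x) = (LINT x:A|\<mu>. 0)" by (simp add: set_lebesgue_integral_def)
  qed simp
  then show ?thesis by eventually_elim (auto simp: indicator_def mem_Times_iff)
qed

sublocale L2_representation sc ip \<mu> \<gamma>
proof unfold_locales
  have "\<exists>h. AE x in \<mu>. \<gamma> h x = f x" if f: "square_integrable \<mu> f" for f
  proof -
    note sqi = square_integrable_\<gamma>
    note [measurable] = square_integrable_measurable[OF f]
    have "L2_inner \<mu> (\<gamma> (sc a x + y)) f = a * L2_inner \<mu> (\<gamma> x) f + L2_inner \<mu> (\<gamma> y) f" for a x y
      using L2_inner_cong_AE[OF sqi _ f \<gamma>_linear[of a x y]]
      by (simp add: square_integrable_add square_integrable_cmult sqi L2_inner_linear_left[OF sqi sqi f])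
    moreover have "cmod (L2_inner \<mu> (\<gamma> x) f) \<le> L2_norm \<mu> f * \<parallel>x\<parallel>" for x
      using L2_cauchy_schwarz[OF sqi f, of x] by (simp add: L2_norm_\<gamma> mult.commute)
    ultimately obtain k where k: "\<And>h. L2_inner \<mu> (\<gamma> h) f = ip h k"
      using riesz_representation[of "\<lambda>h. L2_inner \<mu> (\<gamma> h) f" "L2_norm \<mu> f"] by blast
    have "AE x in \<mu>. \<gamma> k x - f x = 0"
    proof (rule AE_model_measureI)
      show "{x \<in> space \<mu>. \<gamma> k x - f x = 0} \<in> sets \<mu>" by measurable
      fix v assume v: "v \<in> S"
      show "AE x in \<mu>. fst x = v \<longrightarrow> \<gamma> k x - f x = 0"
      proof (rule AE_eq_0_on_slice[OF square_integrable_diff[OF sqi f] v])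
        fix ks
        note ind = square_integrable_slice_ind[OF v, of ks]
        have "L2_inner \<mu> (slice_ind v ks) g = L2_inner \<mu> (\<gamma> (foldr P ks v)) g" if "square_integrable \<mu> g" for g
          using L2_inner_cong_AE[OF sqi ind that \<gamma>_generator[OF v]] by simp
        then have "L2_inner \<mu> (slice_ind v ks) f = L2_inner \<mu> (slice_ind v ks) (\<gamma> k)"
          using f sqi by (simp add: k L2_inner_\<gamma>)
        then have "L2_inner \<mu> f (slice_ind v ks) = L2_inner \<mu> (\<gamma> k) (slice_ind v ks)"
          by (simp add: L2_inner_commute[of _ _ "slice_ind v ks"])
        then show "L2_inner \<mu> (\<lambda>x. \<gamma> k x - f x) (slice_ind v ks) = 0"
          by (simp add: L2_inner_diff_left[OF sqi f ind])
      qed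
    qed
    then show ?thesis by (intro exI[of _ k]) simp
  qed
  then show "unitary_to_L2 ip \<mu> \<gamma>"
    by (simp add: unitary_to_L2_def square_integrable_\<gamma> L2_inner_\<gamma>)
qed (rule semifinite_model_measure)

definition cylinder_ind :: "nat list \<Rightarrow> 'h \<times> (nat \<Rightarrow> complex) \<Rightarrow> complex" where
  "cylinder_ind ks = indicator (UNIV \<times> cylinder ks)"

lemma measurable_cylinder_ind [measurable]: "cylinder_ind ks \<in> borel_measurable \<mu>"
proof -
  have "Pair v -` (UNIV \<times> cylinder ks) = cylinder ks" for v :: 'h by auto
  then have "UNIV \<times> cylinder ks \<in> sets \<mu>" by (simp add: sets_model_measure)
  then show ?thesis by (simp add: cylinder_ind_def)
qed

lemma acts_as_foldr: "acts_as (foldr P ks) (cylinder_ind ks)"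
proof -
  let ?K = "{h. AE x in \<mu>. \<gamma> (foldr P ks h) x = cylinder_ind ks x * \<gamma> h x}"
  have "foldr P ls v \<in> ?K" if v: "v \<in> S" for v ls
    using \<gamma>_generator[OF v, of "ks @ ls"] \<gamma>_generator[OF v, of ls]
    by (simp, eventually_elim) (auto simp: slice_ind_def cylinder_ind_def cylinder_append indicator_def)
  then have "?K = UNIV"
    by (rule closed_subspace_eq_UNIV_if_generators[OF closed_subspace_multiplied[OF bounded_op_foldr]])
  then show ?thesis by (auto simp: acts_as_def)
qed

text \<open>On the slice of \<open>v\<close> the vector \<open>v\<close> is represented by the constant 1, so the symbol of an operator
  preserving the cyclic subspaces can be read off from its values on \<open>S\<close>.\<close>

definition symbol :: "('h \<Rightarrow> 'h) \<Rightarrow> 'h \<times> (nat \<Rightarrow> complex) \<Rightarrow> complex" where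
  "symbol N x = \<gamma> (N (fst x)) x"

lemma measurable_symbol [measurable]: "symbol N \<in> borel_measurable \<mu>"
proof (rule measurableI)
  fix B :: "complex set" assume "B \<in> sets borel"
  then have "\<gamma> h -` B \<in> sets \<mu>" for h
    using measurable_sets[OF measurable_\<gamma>, of B h] by (simp add: space_model_measure)
  then have "Pair v -` (symbol N -` B) \<in> sets cylinder_algebra" for v
    by (simp add: sets_model_measure symbol_def vimage_def)
  then show "symbol N -` B \<inter> space \<mu> \<in> sets \<mu>"
    by (simp add: sets_model_measure space_model_measure)
qed simp

lemma acts_as_symbol:
  assumes N: "bounded_op N" and comm: "\<And>k. commuting N (P k)"
    and orth: "\<And>v w ks. v \<in> S \<Longrightarrow> w \<in> S \<Longrightarrow> v \<noteq> w \<Longrightarrow> ip (N v) (foldr P ks w) = 0"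
  shows "acts_as N (symbol N)"
proof -
  let ?K = "{h. AE x in \<mu>. \<gamma> (N h) x = symbol N x * \<gamma> h x}"
  have "foldr P ks v \<in> ?K" if v: "v \<in> S" for v ks
  proof -
    have slices: "AE x in \<mu>. cylinder_ind ks x * \<gamma> (N v) x = symbol N x * slice_ind v ks x"
    proof (rule AE_model_measureI)
      note [measurable] = square_integrable_measurable[OF square_integrable_slice_ind[OF v]]
      show "{x \<in> space \<mu>. cylinder_ind ks x * \<gamma> (N v) x = symbol N x * slice_ind v ks x} \<in> sets \<mu>" by measurable
      fix w assume w: "w \<in> S"
      show "AE x in \<mu>. fst x = w \<longrightarrow> cylinder_ind ks x * \<gamma> (N v) x = symbol N x * slice_ind v ks x"
      proof (cases "w = v")
        case True
        then show ?thesis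
          by (intro AE_I2) (auto simp: symbol_def slice_ind_def cylinder_ind_def indicator_def mem_Times_iff)
      next
        case False
        have "L2_inner \<mu> (\<gamma> (N v)) (slice_ind w ls) = 0" for ls
          using L2_inner_represents[OF represents_\<gamma> represents_elementary[OF elementary_generator[OF w]]]
            orth[OF v w] False by simp
        from AE_eq_0_on_slice[OF square_integrable_\<gamma> w this] show ?thesis
          by eventually_elim (use False in \<open>auto simp: slice_ind_def\<close>)
      qed
    qed
    have N_foldr: "N (foldr P ks v) = foldr P ks (N v)" by (rule commutingD[OF commuting_foldr[OF comm]])
    from slices acts_asD[OF acts_as_foldr, of ks "N v"] \<gamma>_generator[OF v, of ks]
    have "AE x in \<mu>. \<gamma> (N (foldr P ks v)) x = symbol N x * \<gamma> (foldr P ks v) x"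
      unfolding N_foldr by eventually_elim simp
    then show ?thesis by simp
  qed
  then have "?K = UNIV"
    by (rule closed_subspace_eq_UNIV_if_generators[OF closed_subspace_multiplied[OF N]])
  then show ?thesis by (auto simp: acts_as_def)
qed

lemma bicommutant_preserves_orthogonality:
  assumes N: "\<And>E. contraction sc ip E \<Longrightarrow> is_adjoint ip E E \<Longrightarrow> (\<And>k. commuting (P k) E) \<Longrightarrow> commuting E N"
    and v: "v \<in> S" and w: "w \<in> S" and "v \<noteq> w"
  shows "ip (N v) (foldr P ks w) = 0"
proof -
  define W where "W = perp {foldr P ks v |ks. True}"
  have P_W: "P k y \<in> W" if "y \<in> W" for k y
  proof -
    have "ip (P k y) (foldr P ks v) = ip y (foldr P (k # ks) v)" for ks by (simp add: ip_P_left)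
    moreover have "ip y (foldr P (k # ks) v) = 0" for ks
      using that unfolding W_def by (rule perpD) blast
    ultimately show ?thesis by (auto simp: W_def perp_def)
  qed
  have adj_P: "adj (P k) = P k" for k by (rule adj_eqI[OF bounded_op_P is_adjoint_P])
  have P_perp_W: "P k y \<in> perp W" if "y \<in> perp W" for k y
    by (rule perp_invariant[OF bounded_op_P _ that]) (simp add: adj_P P_W)
  define E where "E = proj (perp W)"
  have "commuting (P k) E" for k
    unfolding E_def
    by (rule commuting_sym[OF commuting_proj[OF closed_subspace_perp bounded_op_P]]) (simp_all add: P_perp_W adj_P)
  then have "commuting E N"
    unfolding E_def by (intro N contraction_proj is_adjoint_proj closed_subspace_perp)
  moreover have "v \<in> perp W"
  proof -
    have "ip y (foldr P [] v) = 0" if "y \<in> W" for y using that unfolding W_def by (rule perpD) blast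
    then show ?thesis using ip_eq_0_commute[of v] by (auto simp: perp_def)
  qed
  ultimately have "N v \<in> perp W"
    using commutingD[of E N v] proj_in[OF closed_subspace_perp, of W "N v"] proj_self[OF closed_subspace_perp, of v W]
    by (simp add: E_def)
  moreover have "foldr P ks w \<in> W"
  proof -
    have "ip (foldr P ks w) (foldr P ls v) = ip (foldr P (ls @ ks) w) v" for ls by (simp add: ip_foldr_left)
    then show ?thesis using cyclic_orthogonal[OF w v, of "_ @ ks"] \<open>v \<noteq> w\<close> by (auto simp: W_def perp_def)
  qed
  ultimately show ?thesis by (rule perpD)
qed

end

theorem (in hilbert_space) joint_spectral_theorem:
  fixes N :: "'i \<Rightarrow> 'h \<Rightarrow> 'h" and I :: "'i set"
  assumes "countable I" and N: "\<And>i. i \<in> I \<Longrightarrow> contraction sc ip (N i)" "\<And>i. i \<in> I \<Longrightarrow> normal_op ip (N i)"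
    and "\<And>i j. i \<in> I \<Longrightarrow> j \<in> I \<Longrightarrow> commuting (N i) (N j)"
  obtains M :: "('h \<times> (nat \<Rightarrow> complex)) measure" and \<gamma>
  where "L2_representation sc ip M \<gamma>"
    and "\<And>i. i \<in> I \<Longrightarrow> \<exists>Z\<in>borel_measurable M. L2_isometry.acts_as M \<gamma> (N i) Z"
proof -
  obtain P where "commuting_projections sc ip P" and comm: "\<And>i k. i \<in> I \<Longrightarrow> commuting (N i) (P k)"
    and bicommutant: "\<And>i E. i \<in> I \<Longrightarrow> contraction sc ip E \<Longrightarrow> is_adjoint ip E E \<Longrightarrow>
      (\<And>k. commuting (P k) E) \<Longrightarrow> commuting E (N i)"
    using spectral_projections_exist[where N = N and I = I, OF assms] by blast
  then interpret commuting_projections sc ip P by blast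
  obtain S where "cyclic_decomposition sc ip P S" by (rule cyclic_decomposition_exists)
  then interpret cyclic_decomposition sc ip P S .
  show thesis
  proof (rule that[of model_measure model_unitary])
    show "L2_representation sc ip model_measure model_unitary" by unfold_locales
    show "\<exists>Z\<in>borel_measurable model_measure. acts_as (N i) Z" if i: "i \<in> I" for i
    proof -
      have "acts_as (N i) (symbol (N i))"
        by (rule acts_as_symbol[OF bounded_op_contraction[OF N(1)[OF i]] comm[OF i]])
          (rule bicommutant_preserves_orthogonality[OF bicommutant[OF i]])
      then show ?thesis using measurable_symbol by blast
    qed
  qed
qed

section \<open>Square root sequences\<close>

lemma power_root_sequence:
  fixes z :: "nat \<Rightarrow> 'a::monoid_mult"
  assumes "\<And>m. (z (Suc m))\<^sup>2 = z m"
  shows "z (m + j) ^ (2 ^ j) = z m"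
proof (induction j)
  case (Suc j)
  have "z (m + Suc j) ^ (2 ^ Suc j) = ((z (Suc (m + j)))\<^sup>2) ^ (2 ^ j)" by (simp add: power_mult)
  with Suc show ?case by (simp add: assms)
qed simp

lemma exp_difference_quotient:
  fixes g :: complex
  shows "(\<lambda>m. 2 ^ m * (exp (g / 2 ^ m) - 1)) \<longlonglongrightarrow> g"
proof -
  have "DERIV exp (0::complex) :> 1" using DERIV_exp[of 0] by simp
  then obtain q :: "complex \<Rightarrow> complex" where q: "\<And>x. exp x - exp 0 = q x * (x - 0)" "isCont q 0" "q 0 = 1"
    unfolding CARAT_DERIV by blast
  have "(\<lambda>m. g / 2 ^ m) \<longlonglongrightarrow> 0" using tendsto_mult[OF tendsto_const LIMSEQ_power_zero[of "1 / 2 :: complex"]]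
    by (simp add: power_one_over norm_divide)
  then have "(\<lambda>m. q (g / 2 ^ m) * g) \<longlonglongrightarrow> q 0 * g"
    by (intro tendsto_intros isCont_tendsto_compose[OF q(2)])
  moreover have "q (g / 2 ^ m) * g = 2 ^ m * (exp (g / 2 ^ m) - 1)" for m
    using q(1)[of "g / 2 ^ m"] by simp
  ultimately show ?thesis by (simp add: q(3))
qed

lemma Ln_difference_quotient:
  assumes s: "strict_mono s" and lim: "(\<lambda>i. 2 ^ s i * (w i - 1)) \<longlonglongrightarrow> g"
  shows "w \<longlonglongrightarrow> 1" "(\<lambda>i. 2 ^ s i * Ln (w i)) \<longlonglongrightarrow> g"
proof -
  have "(\<lambda>i. (1 / 2 :: complex) ^ s i) \<longlonglongrightarrow> 0"
    using LIMSEQ_subseq_LIMSEQ[OF LIMSEQ_power_zero[of "1 / 2 :: complex"] s] by (simp add: comp_def norm_divide)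
  from tendsto_mult[OF this lim] have "(\<lambda>i. w i - 1) \<longlonglongrightarrow> 0" by (simp add: power_one_over)
  then show w: "w \<longlonglongrightarrow> 1" by (rule LIM_zero_cancel)
  have "DERIV Ln 1 :> 1" using has_field_derivative_Ln[of 1] by simp
  then obtain q where q: "\<And>x. Ln x - Ln 1 = q x * (x - 1)" "isCont q 1" "q 1 = 1" unfolding CARAT_DERIV by blast
  have "(\<lambda>i. q (w i) * (2 ^ s i * (w i - 1))) \<longlonglongrightarrow> q 1 * g"
    by (intro tendsto_mult lim isCont_tendsto_compose[OF q(2) w])
  moreover have "q (w i) * (2 ^ s i * (w i - 1)) = 2 ^ s i * Ln (w i)" for i using q(1)[of "w i"] by simp
  ultimately show "(\<lambda>i. 2 ^ s i * Ln (w i)) \<longlonglongrightarrow> g" by (simp add: q(3))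
qed

lemma root_sequence_eq_exp:
  fixes z :: "nat \<Rightarrow> complex"
  assumes sq: "\<And>m. (z (Suc m))\<^sup>2 = z m" and s: "strict_mono s"
    and lim: "(\<lambda>i. 2 ^ s i * (z (s i) - 1)) \<longlonglongrightarrow> g"
  shows "z m = exp (g / 2 ^ m)"
proof (rule LIMSEQ_unique)
  note Ln_lim = Ln_difference_quotient[OF s, of "\<lambda>i. z (s i)", OF lim]
  show "(\<lambda>i. exp (2 ^ s i * Ln (z (s i)) / 2 ^ m)) \<longlonglongrightarrow> exp (g / 2 ^ m)"
    by (intro tendsto_intros Ln_lim) simp
  have "\<forall>\<^sub>F i in sequentially. z (s i) \<noteq> 0" using Ln_lim(1) by (rule tendsto_imp_eventually_ne) simp
  moreover have "\<forall>\<^sub>F i in sequentially. i \<ge> m" by (rule eventually_ge_at_top)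
  ultimately have "\<forall>\<^sub>F i in sequentially. exp (2 ^ s i * Ln (z (s i)) / 2 ^ m) = z m"
  proof eventually_elim
    case (elim i)
    obtain j where j: "s i = m + j"
      using elim(2) strict_mono_imp_increasing[OF s, of i] le_Suc_ex order_trans by blast
    have "z m = z (s i) ^ (2 ^ j)" by (simp add: j power_root_sequence[where z = z, OF sq])
    also have "\<dots> = exp (of_nat (2 ^ j) * Ln (z (s i)))" using elim(1) by (simp add: exp_of_nat_mult del: of_nat_power)
    also have "of_nat (2 ^ j) * Ln (z (s i)) = 2 ^ s i * Ln (z (s i)) / 2 ^ m" by (simp add: j power_add)
    finally show ?case by simp
  qed
  then show "(\<lambda>i. exp (2 ^ s i * Ln (z (s i)) / 2 ^ m)) \<longlonglongrightarrow> z m"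
    by (rule tendsto_eventually)
qed

text \<open>Square roots leave a choice of branch at every step. The means decide it: by the geometric sum,
  \<open>z\<^sub>p - 1\<close> is \<open>2\<^sup>m (z\<^sub>p\<^sub>+\<^sub>m - 1)\<close> times the mean, so \<open>2\<^sup>m (z\<^sub>p\<^sub>+\<^sub>m - 1)\<close> stays bounded.\<close>

lemma root_sequence_exponential:
  fixes z :: "nat \<Rightarrow> complex"
  assumes sq: "\<And>m. (z (Suc m))\<^sup>2 = z m"
    and near: "\<exists>\<^sub>F m in sequentially. cmod ((\<Sum>k<2 ^ m. z (p + m) ^ k) / 2 ^ m - 1) < 1 / 2"
  shows "\<exists>g. \<forall>m. z m = exp (g / 2 ^ m)"
proof -
  define mean where "mean m = (\<Sum>k<2 ^ m. z (p + m) ^ k) / 2 ^ m" for m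
  define quot where "quot m = 2 ^ (p + m) * (z (p + m) - 1)" for m
  have geometric: "quot m * mean m = 2 ^ p * (z p - 1)" for m
    using power_diff_1_eq[of "z (p + m)" "2 ^ m"] power_root_sequence[where z = z, OF sq]
    by (simp add: quot_def mean_def power_add)
  have bounded: "cmod (quot m) \<le> 2 * cmod (2 ^ p * (z p - 1))" if "cmod (mean m - 1) < 1 / 2" for m
  proof -
    have "1 / 2 \<le> cmod (mean m)" using that norm_triangle_ineq3[of "mean m" 1] by simp
    then have "cmod (quot m) * (1 / 2) \<le> cmod (quot m) * cmod (mean m)" by (intro mult_left_mono) auto
    moreover have "cmod (quot m) * cmod (mean m) = cmod (2 ^ p * (z p - 1))" by (simp only: geometric flip: norm_mult)
    ultimately show ?thesis by linarith
  qed
  have "infinite {m. cmod (mean m - 1) < 1 / 2}"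
    using near by (simp add: mean_def frequently_cofinite flip: cofinite_eq_sequentially)
  from infinite_enumerate[OF this] obtain r :: "nat \<Rightarrow> nat"
    where r: "strict_mono r" "\<And>i. cmod (mean (r i) - 1) < 1 / 2" by auto
  have "\<forall>i. quot (r i) \<in> cball 0 (2 * cmod (2 ^ p * (z p - 1)))" using bounded r(2) by simp
  then obtain g s where s: "strict_mono s" and "((\<lambda>i. quot (r i)) \<circ> s) \<longlonglongrightarrow> g"
    by (rule seq_compactE[OF compact_imp_seq_compact[OF compact_cball]])
  then have "(\<lambda>i. 2 ^ (p + r (s i)) * (z (p + r (s i)) - 1)) \<longlonglongrightarrow> g" by (simp add: quot_def comp_def)
  moreover have "strict_mono (\<lambda>i. p + r (s i))" using r(1) s by (simp add: strict_mono_def)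
  ultimately show ?thesis using root_sequence_eq_exp[where z = z, OF sq] by blast
qed

section \<open>Contractive semigroups\<close>

lemma floor_dyadic_tendsto: "(\<lambda>i. real_of_int \<lfloor>t * 2 ^ i\<rfloor> / 2 ^ i) \<longlonglongrightarrow> t"
proof (rule tendsto_sandwich)
  have "t * 2 ^ i - 1 \<le> \<lfloor>t * 2 ^ i\<rfloor>" for i by linarith
  then have "(t * 2 ^ i - 1) / 2 ^ i \<le> \<lfloor>t * 2 ^ i\<rfloor> / 2 ^ i" for i by (rule divide_right_mono) simp
  then show "\<forall>\<^sub>F i in sequentially. t - 1 / 2 ^ i \<le> \<lfloor>t * 2 ^ i\<rfloor> / 2 ^ i" by (simp add: diff_divide_distrib)
  show "\<forall>\<^sub>F i in sequentially. \<lfloor>t * 2 ^ i\<rfloor> / 2 ^ i \<le> t" by (simp add: divide_le_eq)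
  have "(\<lambda>i. t - (1 / 2) ^ i) \<longlonglongrightarrow> t - 0" by (intro tendsto_intros LIMSEQ_power_zero) simp
  then show "(\<lambda>i. t - 1 / 2 ^ i) \<longlonglongrightarrow> t" by (simp add: power_one_over)
qed simp

context hilbert_space
begin

lemma semigroup_0: "contractive_semigroup sc ip T \<Longrightarrow> T 0 = id"
  and semigroup_add: "contractive_semigroup sc ip T \<Longrightarrow> 0 \<le> s \<Longrightarrow> 0 \<le> t \<Longrightarrow> T (s + t) = T s \<circ> T t"
  and semigroup_contraction: "contractive_semigroup sc ip T \<Longrightarrow> 0 \<le> t \<Longrightarrow> contraction sc ip (T t)"
  by (auto simp: contractive_semigroup_def)

lemma semigroup_of_nat_mult:
  assumes T: "contractive_semigroup sc ip T" and "0 \<le> s"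
  shows "T (of_nat k * s) = T s ^^ k"
proof (induction k)
  case (Suc k)
  have "T (of_nat (Suc k) * s) = T s \<circ> T (of_nat k * s)"
    using semigroup_add[OF T \<open>0 \<le> s\<close>, of "of_nat k * s"] \<open>0 \<le> s\<close> by (simp add: algebra_simps)
  with Suc show ?case by simp
qed (simp add: semigroup_0[OF T] id_def)

lemma semigroup_continuous_at_0:
  assumes "contractive_semigroup sc ip T"
  shows "continuous (at 0 within {0..}) (\<lambda>t. \<parallel>T t x - x\<parallel>)"
  using assms by (simp add: continuous_within at_within_Ici_at_right contractive_semigroup_def)

lemma semigroup_hlim:
  assumes T: "contractive_semigroup sc ip T" and s: "\<And>i. 0 \<le> s i" "\<And>i. s i \<le> t" "s \<longlonglongrightarrow> t"
  shows "hlim (\<lambda>i. T (s i) x) (T t x)"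
proof (rule hlim_sandwich)
  show "\<parallel>T (s i) x - T t x\<parallel> \<le> \<parallel>T (t - s i) x - x\<parallel>" for i
  proof -
    note contr = semigroup_contraction[OF T s(1)[of i]]
    have "T t x = T (s i) (T (t - s i) x)" using semigroup_add[OF T s(1)[of i], of "t - s i"] s(2)[of i] by simp
    then have "T t x - T (s i) x = T (s i) (T (t - s i) x - x)"
      by (simp add: bounded_op_map_diff[OF bounded_op_contraction[OF contr]])
    then show ?thesis using contraction_le[OF contr] by (simp add: hnorm_minus_commute[of "T (s i) x"])
  qed
  have "(\<lambda>i. t - s i) \<longlonglongrightarrow> t - t" by (intro tendsto_intros s)
  then show "(\<lambda>i. \<parallel>T (t - s i) x - x\<parallel>) \<longlonglongrightarrow> 0"
    using continuous_within_tendsto_compose'[OF semigroup_continuous_at_0[OF T], of "\<lambda>i. t - s i" sequentially x] s(2)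
    by (simp add: semigroup_0[OF T])
qed

definition cesaro_mean :: "('h \<Rightarrow> 'h) \<Rightarrow> nat \<Rightarrow> 'h \<Rightarrow> 'h" where
  "cesaro_mean A n x = sc (1 / of_nat n) (\<Sum>k<n. (A ^^ k) x)"

lemma hnorm_cesaro_mean_diff_le:
  assumes "0 < n" "\<And>k. k < n \<Longrightarrow> \<parallel>(A ^^ k) x - x\<parallel> \<le> e"
  shows "\<parallel>cesaro_mean A n x - x\<parallel> \<le> e"
proof -
  have "cesaro_mean A n x - x = sc (1 / of_nat n) (\<Sum>k<n. (A ^^ k) x - x)"
    using \<open>0 < n\<close> by (simp add: cesaro_mean_def sum_subtractf scale_right_diff_distrib sum_constant_scale)
  then have "\<parallel>cesaro_mean A n x - x\<parallel> \<le> (\<Sum>k<n. \<parallel>(A ^^ k) x - x\<parallel>) / n"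
    by (simp add: hnorm_scale norm_divide divide_right_mono hnorm_sum)
  also have "\<dots> \<le> (\<Sum>k<n. e) / n" using assms(2) by (intro divide_right_mono sum_mono) auto
  also have "\<dots> = e" using \<open>0 < n\<close> by simp
  finally show ?thesis .
qed

lemma semigroup_cesaro_mean_near:
  assumes T: "contractive_semigroup sc ip T" and "0 < e"
  shows "\<exists>p. \<forall>m. \<parallel>cesaro_mean (T (1 / 2 ^ (p + m))) (2 ^ m) x - x\<parallel> \<le> e"
proof -
  obtain d where d: "0 < d" "\<And>s. 0 \<le> s \<Longrightarrow> s < d \<Longrightarrow> \<parallel>T s x - x\<parallel> < e"
    using semigroup_continuous_at_0[OF T, of x] \<open>0 < e\<close>
    by (force simp: continuous_within_eps_delta semigroup_0[OF T] dist_real_def)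
  obtain p where p: "(1 / 2) ^ p < d" using real_arch_pow_inv[OF d(1), of "1 / 2"] by auto
  have "\<parallel>cesaro_mean (T (1 / 2 ^ (p + m))) (2 ^ m) x - x\<parallel> \<le> e" for m
  proof (rule hnorm_cesaro_mean_diff_le)
    fix k :: nat assume "k < 2 ^ m"
    then have "real k < real (2 ^ m)" by (rule of_nat_less_iff[THEN iffD2])
    then have "real k * (1 / 2 ^ (p + m)) \<le> 2 ^ m * (1 / 2 ^ (p + m))" by (intro mult_right_mono) auto
    also have "\<dots> = (1 / 2) ^ p" by (simp add: power_add power_one_over)
    finally have "\<parallel>T (real k * (1 / 2 ^ (p + m))) x - x\<parallel> < e" using p by (intro d(2)) auto
    then show "\<parallel>(T (1 / 2 ^ (p + m)) ^^ k) x - x\<parallel> \<le> e" by (simp add: semigroup_of_nat_mult[OF T, symmetric])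
  qed simp
  then show ?thesis by blast
qed

lemma semigroups_commuting_dyadic:
  assumes T: "contractive_semigroup sc ip T" and U: "contractive_semigroup sc ip U"
    and comm: "\<And>t. 0 \<le> t \<Longrightarrow> commuting (T t) (U t)"
  shows "commuting (T (1 / 2 ^ l)) (U (1 / 2 ^ m))"
proof -
  let ?s = "1 / 2 ^ (l + m) :: real"
  have "commuting (T ?s ^^ 2 ^ m) (U ?s ^^ 2 ^ l)"
    by (intro commuting_funpow commuting_sym[OF commuting_funpow] commuting_sym[OF comm]) simp
  moreover have "T ?s ^^ 2 ^ m = T (1 / 2 ^ l)"
    using semigroup_of_nat_mult[OF T, of ?s "2 ^ m"] by (simp add: power_add)
  moreover have "U ?s ^^ 2 ^ l = U (1 / 2 ^ m)"
    using semigroup_of_nat_mult[OF U, of ?s "2 ^ l"] by (simp add: power_add)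
  ultimately show ?thesis by simp
qed

end

definition cayley :: "complex \<Rightarrow> complex" where
  "cayley g = (g + 1) / (g - 1)"

lemma measurable_cayley [measurable]: "cayley \<in> borel_measurable borel"
  unfolding cayley_def[abs_def] by measurable

text \<open>This includes \<open>g = 1\<close>, where division by zero makes the value 0.\<close>

lemma cayley_neq_1: "cayley g \<noteq> 1"
  by (auto simp: cayley_def divide_eq_1_iff)

lemma cmod_cayley_le_1: "Re g \<le> 0 \<Longrightarrow> cmod (cayley g) \<le> 1"
proof -
  assume "Re g \<le> 0"
  then have "cmod (g + 1) \<le> cmod (g - 1)" by (simp add: cmod_def power2_eq_square algebra_simps)
  then show ?thesis by (simp add: cayley_def norm_divide divide_le_eq_1)
qed

lemma phi_cayley: "g \<noteq> 1 \<Longrightarrow> phi t (cayley g) = exp (of_real t * g)"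
proof -
  assume "g \<noteq> 1"
  then have "(cayley g + 1) / (cayley g - 1) = g" by (simp add: cayley_def field_simps)
  then show ?thesis by (simp add: phi_def)
qed

context L2_representation
begin

lemma acts_as_cesaro_mean:
  assumes "acts_as A Z"
  shows "acts_as (cesaro_mean A n) (\<lambda>x. (\<Sum>k<n. Z x ^ k) / of_nat n)"
proof -
  have "acts_as (\<lambda>h. sc (1 / of_nat n) (\<Sum>k<n. (A ^^ k) h)) (\<lambda>x. 1 / of_nat n * (\<Sum>k<n. Z x ^ k))"
    by (intro acts_as_scale acts_as_sum acts_as_funpow assms)
  then show ?thesis by (simp add: cesaro_mean_def[abs_def])
qed

text \<open>On a set of finite measure the means of \<open>T\<close> move the indicator function by arbitrarily little;
  Fatou's lemma makes this pointwise.\<close>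

lemma dyadic_symbol_means_near_1:
  assumes T: "contractive_semigroup sc ip T" and Z [measurable]: "\<And>m. Z m \<in> borel_measurable M"
    and acts: "\<And>m. acts_as (T (1 / 2 ^ m)) (Z m)"
  shows "AE x in M. \<exists>p. \<exists>\<^sub>F m in sequentially. cmod ((\<Sum>k<2 ^ m. Z (p + m) x ^ k) / 2 ^ m - 1) < 1 / 2"
    (is "AE x in M. \<exists>p. \<exists>\<^sub>F m in sequentially. cmod (?mean p m x - 1) < 1 / 2")
proof (rule AE_if_AE_finite)
  show "{x \<in> space M. \<exists>p. \<exists>\<^sub>F m in sequentially. cmod (?mean p m x - 1) < 1 / 2} \<in> sets M"
    unfolding frequently_sequentially by measurable
  fix B h assume h: "AE x in M. \<gamma> h x = indicator B x"
  have "\<forall>i. \<exists>p. \<forall>m. \<parallel>cesaro_mean (T (1 / 2 ^ (p + m))) (2 ^ m) h - h\<parallel> \<le> (1 / 2) ^ i"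
    using semigroup_cesaro_mean_near[OF T] by simp
  then obtain p where p: "\<And>i m. \<parallel>cesaro_mean (T (1 / 2 ^ (p i + m))) (2 ^ m) h - h\<parallel> \<le> (1 / 2) ^ i"
    by metis
  let ?d = "\<lambda>i m. \<gamma> (cesaro_mean (T (1 / 2 ^ (p i + m))) (2 ^ m) h - h)"
  have "AE x in M. \<exists>i. \<exists>\<^sub>F m in sequentially. cmod (?d i m x) < 1 / 2"
  proof (rule L2_AE_frequently_small[OF square_integrable_\<gamma>])
    show "L2_norm M (?d i m) \<le> (1 / 2) ^ i" for i m by (simp only: L2_norm_\<gamma> p)
    show "(\<lambda>i. (1 / 2 :: real) ^ i) \<longlonglongrightarrow> 0" by (rule LIMSEQ_power_zero) simp
  qed simp
  moreover have "AE x in M. \<forall>i m. ?d i m x = ?mean (p i) m x * \<gamma> h x - \<gamma> h x"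
    unfolding AE_all_countable
  proof (intro allI)
    fix i m
    from \<gamma>_diff[of "cesaro_mean (T (1 / 2 ^ (p i + m))) (2 ^ m) h" h]
      acts_asD[OF acts_as_cesaro_mean[OF acts[of "p i + m"], of "2 ^ m"], of h]
    show "AE x in M. ?d i m x = ?mean (p i) m x * \<gamma> h x - \<gamma> h x" by eventually_elim simp
  qed
  ultimately show "AE x in M. x \<in> B \<longrightarrow> (\<exists>p. \<exists>\<^sub>F m in sequentially. cmod (?mean p m x - 1) < 1 / 2)"
    using h
  proof eventually_elim
    case (elim x)
    show ?case
    proof
      assume "x \<in> B"
      then have "?d i m x = ?mean (p i) m x - 1" for i m using elim by simp
      then show "\<exists>p. \<exists>\<^sub>F m in sequentially. cmod (?mean p m x - 1) < 1 / 2" using elim(1) by auto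
    qed
  qed
qed

lemma dyadic_symbols_exponential:
  assumes T: "contractive_semigroup sc ip T" and Z [measurable]: "\<And>m. Z m \<in> borel_measurable M"
    and acts: "\<And>m. acts_as (T (1 / 2 ^ m)) (Z m)"
  obtains g where "g \<in> borel_measurable M" "AE x in M. \<forall>m. Z m x = exp (g x / 2 ^ m)"
proof -
  define g where "g x = lim (\<lambda>m. 2 ^ m * (Z m x - 1))" for x
  have "g \<in> borel_measurable M" unfolding g_def[abs_def] by measurable
  moreover have "AE x in M. \<forall>m. (Z (Suc m) x)\<^sup>2 = Z m x"
    unfolding AE_all_countable
  proof
    fix m
    have "T (1 / 2 ^ Suc m) ^^ 2 = T (1 / 2 ^ m)" using semigroup_of_nat_mult[OF T, of "1 / 2 ^ Suc m" 2] by simp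
    then have "acts_as (T (1 / 2 ^ m)) (\<lambda>x. (Z (Suc m) x)\<^sup>2)" using acts_as_funpow[OF acts[of "Suc m"], of 2] by simp
    then show "AE x in M. (Z (Suc m) x)\<^sup>2 = Z m x" by (rule acts_as_unique[OF _ Z _ acts, rotated]) measurable
  qed
  with dyadic_symbol_means_near_1[OF T Z acts] have "AE x in M. \<forall>m. Z m x = exp (g x / 2 ^ m)"
  proof eventually_elim
    case (elim x)
    then obtain G where G: "\<And>m. Z m x = exp (G / 2 ^ m)"
      using root_sequence_exponential[of "\<lambda>m. Z m x"] by blast
    have "g x = G" unfolding g_def G by (rule limI[OF exp_difference_quotient])
    with G show ?case by simp
  qed
  ultimately show thesis by (rule that)
qed

lemma semigroup_acts_as_exp:
  assumes T: "contractive_semigroup sc ip T" and acts: "\<And>m. acts_as (T (1 / 2 ^ m)) (Z m)"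
    and exp: "AE x in M. \<forall>m. Z m x = exp (g x / 2 ^ m)" and t: "0 \<le> t"
  shows "acts_as (T t) (\<lambda>x. exp (of_real t * g x))"
proof -
  define k where "k i = nat \<lfloor>t * 2 ^ i\<rfloor>" for i
  have k: "real (k i) = \<lfloor>t * 2 ^ i\<rfloor>" for i using t by (simp add: k_def)
  have lim: "(\<lambda>i. real (k i) / 2 ^ i) \<longlonglongrightarrow> t" unfolding k by (rule floor_dyadic_tendsto)
  show ?thesis
  proof (rule acts_as_limit)
    show "acts_as (T (real (k i) / 2 ^ i)) (\<lambda>x. Z i x ^ k i)" for i
      using acts_as_funpow[OF acts[of i], of "k i"] semigroup_of_nat_mult[OF T, of "1 / 2 ^ i" "k i"] by simp
    have "real (k i) / 2 ^ i \<le> t" for i by (simp add: k divide_le_eq)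
    then show "hlim (\<lambda>i. T (real (k i) / 2 ^ i) h) (T t h)" for h
      by (intro semigroup_hlim[OF T] lim) simp
    show "AE x in M. (\<lambda>i. Z i x ^ k i) \<longlonglongrightarrow> exp (of_real t * g x)"
      using exp
    proof eventually_elim
      case (elim x)
      have "Z i x ^ k i = exp (of_real (real (k i) / 2 ^ i) * g x)" for i
        using elim by (simp flip: exp_of_nat_mult)
      then show ?case by (simp only:) (intro tendsto_intros lim)
    qed
  qed
qed

definition semigroup_symbol :: "(real \<Rightarrow> 'h \<Rightarrow> 'h) \<Rightarrow> ('x \<Rightarrow> complex) \<Rightarrow> bool" where
  "semigroup_symbol T \<psi> \<longleftrightarrow> \<psi> \<in> borel_measurable M \<and> (AE x in M. cmod (\<psi> x) \<le> 1) \<and>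
     emeasure M {x \<in> space M. \<psi> x = 1} = 0 \<and> (\<forall>t\<ge>0. acts_as (T t) (\<lambda>x. phi t (\<psi> x)))"

lemma semigroup_symbol_exists:
  assumes T: "contractive_semigroup sc ip T"
    and symbols: "\<And>m. \<exists>Z\<in>borel_measurable M. acts_as (T (1 / 2 ^ m)) Z"
  shows "\<exists>\<psi>. semigroup_symbol T \<psi>"
proof -
  from symbols obtain Z where Z: "\<And>m. Z m \<in> borel_measurable M" "\<And>m. acts_as (T (1 / 2 ^ m)) (Z m)" by metis
  obtain g where g [measurable]: "g \<in> borel_measurable M" and exp: "AE x in M. \<forall>m. Z m x = exp (g x / 2 ^ m)"
    using dyadic_symbols_exponential[OF T Z] .
  have "contraction sc ip (T 1)" by (rule semigroup_contraction[OF T]) simp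
  then have "AE x in M. cmod (Z 0 x) \<le> 1"
    by (rule cmod_le_1_if_acts_as_contraction[OF Z(1)]) (use Z(2)[of 0] in simp)
  with exp have Re_g: "AE x in M. Re (g x) \<le> 0"
  proof eventually_elim
    case (elim x)
    have "Z 0 x = exp (g x)" using elim(1)[rule_format, of 0] by simp
    then show ?case using elim(2) by (simp add: norm_exp_eq_Re)
  qed
  have "acts_as (T t) (\<lambda>x. phi t (cayley (g x)))" if "0 \<le> t" for t
    unfolding acts_as_def
  proof
    fix h
    from Re_g acts_asD[OF semigroup_acts_as_exp[OF T Z(2) exp that], of h]
    show "AE x in M. \<gamma> (T t h) x = phi t (cayley (g x)) * \<gamma> h x"
    proof eventually_elim
      case (elim x)
      then have "g x \<noteq> 1" by auto
      with elim(2) show ?case by (simp add: phi_cayley)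
    qed
  qed
  moreover have "AE x in M. cmod (cayley (g x)) \<le> 1" using Re_g by eventually_elim (rule cmod_cayley_le_1)
  ultimately have "semigroup_symbol T (\<lambda>x. cayley (g x))" by (simp add: semigroup_symbol_def cayley_neq_1)
  then show ?thesis by blast
qed

end

theorem mainTheorem9:
  fixes sc :: "complex \<Rightarrow> 'h::ab_group_add \<Rightarrow> 'h"
    and ip :: "'h \<Rightarrow> 'h \<Rightarrow> complex"
    and n :: nat
    and T :: "nat \<Rightarrow> real \<Rightarrow> 'h \<Rightarrow> 'h"
  assumes "complex_hilbert_space sc ip"
    and "\<And>j. j \<in> {1..n} \<Longrightarrow> normal_contractive_semigroup sc ip (T j)"
    and "\<And>i j t. i \<in> {1..n} \<Longrightarrow> j \<in> {1..n} \<Longrightarrow> t \<ge> 0 \<Longrightarrow> T i t \<circ> T j t = T j t \<circ> T i t"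
  shows "\<exists>(M :: ('h \<times> (nat \<Rightarrow> complex)) measure) (\<psi> :: nat \<Rightarrow> 'h \<times> (nat \<Rightarrow> complex) \<Rightarrow> complex) \<gamma>.
           semifinite M \<and>
           (\<forall>j\<in>{1..n}. \<psi> j \<in> borel_measurable M \<and> (AE x in M. cmod (\<psi> j x) \<le> 1) \<and>
                        emeasure M {x \<in> space M. \<psi> j x = 1} = 0) \<and>
           unitary_to_L2 ip M \<gamma> \<and>
           (\<forall>j\<in>{1..n}. \<forall>t\<ge>0. \<forall>h. AE x in M. \<gamma> (T j t h) x = phi t (\<psi> j x) * \<gamma> h x)"
proof -
  interpret hilbert_space sc ip using assms(1) by unfold_locales
  have semigroup: "contractive_semigroup sc ip (T j)" and normal: "0 \<le> t \<Longrightarrow> normal_op ip (T j t)"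
    if "j \<in> {1..n}" for j t
    using assms(2)[OF that] by (simp_all add: normal_contractive_semigroup_def)
  define N where "N = (\<lambda>(j, m). T j (1 / 2 ^ m))"
  have N: "contraction sc ip (N i)" "normal_op ip (N i)" if "i \<in> {1..n} \<times> (UNIV :: nat set)" for i
    using that by (auto simp: N_def intro!: semigroup_contraction semigroup normal)
  have "commuting (T i (1 / 2 ^ l)) (T j (1 / 2 ^ m))" if "i \<in> {1..n}" "j \<in> {1..n}" for i j l m
    by (rule semigroups_commuting_dyadic[OF semigroup semigroup]) (use assms(3) that in \<open>auto simp: commuting_def\<close>)
  then have N_commuting: "commuting (N i) (N k)" if "i \<in> {1..n} \<times> UNIV" "k \<in> {1..n} \<times> UNIV" for i k
    using that by (auto simp: N_def)
  obtain M :: "('h \<times> (nat \<Rightarrow> complex)) measure" and \<gamma> where "L2_representation sc ip M \<gamma>"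
    and symbols: "\<And>i. i \<in> {1..n} \<times> UNIV \<Longrightarrow> \<exists>Z\<in>borel_measurable M. L2_isometry.acts_as M \<gamma> (N i) Z"
    by (rule joint_spectral_theorem[of "{1..n} \<times> UNIV" N]) (use N N_commuting in auto)
  then interpret L2_representation sc ip M \<gamma> by blast
  have "\<exists>Z\<in>borel_measurable M. acts_as (T j (1 / 2 ^ m)) Z" if "j \<in> {1..n}" for j m
    using symbols[of "(j, m)"] that by (simp add: N_def)
  then have "\<forall>j\<in>{1..n}. \<exists>\<psi>. semigroup_symbol (T j) \<psi>" using semigroup_symbol_exists[OF semigroup] by blast
  then obtain \<psi> where "\<forall>j\<in>{1..n}. semigroup_symbol (T j) (\<psi> j)" unfolding bchoice_iff by blast
  then show ?thesis using semifinite unitary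
    by (intro exI[of _ M] exI[of _ \<psi>] exI[of _ \<gamma>]) (simp add: semigroup_symbol_def acts_as_def)
qed

end
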